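(* Let $\Lambda=\Lambda_0\oplus\Lambda_1$ be a finite-dimensional real commutative superalgebra satisfying conditions $(A_0)$ and $(A_1)$, and let $n,m\in\mathbb N$ with $n+m\ge2$ (and $\Lambda_1\ne\{0\}$ if $m\geq 1$). Let $\Omega$ be a bounded domain of $\Lambda_0^n\times\Lambda_1^m$ whose boundary $\partial\Omega$ is connected, and let $f$ be a $\Lambda$-valued qS-differentiable function in a connected neighbourhood of $\partial\Omega$. Then $f$ extends to a qS-differentiable function on $\Omega$; that is, there is a qS-differentiable function $F:\Omega\to\Lambda$ which coincides with $f$ on the intersection of $\Omega$ with some neighbourhood of $\partial\Omega$.
   Context: A real commutative superalgebra (CSA) is an associative unital real algebra with a grading $\Lambda=\Lambda_0\oplus\Lambda_1$, $\Lambda_i\Lambda_j\subset\Lambda_{i+j \bmod 2}$, such that $ab=(-1)^{\sigma(a)\sigma(b)}ba$ for homogeneous $a,b$, where $\sigma(a)=i$ for $a\in\Lambda_i$. Condition $(A_0)$: there is a basis $(e_0=1,e_1,\dots,e_p)$ of $\Lambda_0$ with $\sum_{k=0}^p e_k^2=0$. Condition $(A_1)$: there are a basis $(\varepsilon_1,\dots,\varepsilon_q)$ of $\Lambda_1$, integers $1=s_1<s_2<\dots<s_r<s_{r+1}=q+1$ and elements $a_1,\dots,a_q\in\Lambda_0$ such that $\varepsilon_j=a_j\varepsilon_{s_k}$ whenever $s_k\le j<s_{k+1}$, $a_{s_1}=\dots=a_{s_r}=e_0$, and $\sum_{j=s_k}^{s_{k+1}-1}a_j^2=0$ for every $k=1,\dots,r$.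 Such bases and elements are fixed. A point of $\Lambda_0^n\times\Lambda_1^m$ is written $(y_1,\dots,y_n,\theta_1,\dots,\theta_m)$ with $y_i=\sum_{k=0}^p y_i^k e_k$, $\theta_i=\sum_{l=1}^q\theta_i^l\varepsilon_l$, where $y_i^k,\theta_i^l$ are real coordinates. For a Fréchet-differentiable (over $\mathbb R$) function $f$ with values in $\Lambda$ put $$d''f=\sum_{i=1}^n\sum_{j=1}^p \Big(\frac{\partial f}{\partial y_i^j}-e_j\frac{\partial f}{\partial y_i^0}\Big)dy_i^j+\sum_{i=1}^m\sum_{k=1}^r\sum_{t=s_k+1}^{s_{k+1}-1}\Big(\frac{\partial f}{\partial\theta_i^t}-a_t\frac{\partial f}{\partial\theta_i^{s_k}}\Big)d\theta_i^t .$$ A function is qS-differentiable on an open set if it is Fréchet-differentiable there and $d''f\equiv0$. A domain is a connected open set. *)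

theory Defs
  imports "HOL-Analysis.Analysis"
begin

text \<open>
  The algebra is the whole type \<open>'a\<close>, of sort \<open>{euclidean_space, real_algebra_1}\<close>.
  The Euclidean structure only expresses finite dimension and supplies the (unique) vector space
  topology; no compatibility between the norm and the multiplication is assumed.
  The graded pieces are \<open>\<Lambda> 0\<close> and \<open>\<Lambda> 1\<close>; other values of \<open>\<Lambda>\<close> are irrelevant.
\<close>

definition comm_superalgebra :: "(nat \<Rightarrow> 'a::real_algebra_1 set) \<Rightarrow> bool" where
  "comm_superalgebra \<Lambda> \<longleftrightarrow>
     subspace (\<Lambda> 0) \<and> subspace (\<Lambda> 1) \<and>
     \<Lambda> 0 \<inter> \<Lambda> 1 = {0} \<and> (\<forall>x. \<exists>u\<in>\<Lambda> 0. \<exists>v\<in>\<Lambda> 1. x = u + v) \<and>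
     (\<forall>i\<in>{0,1}. \<forall>j\<in>{0,1}. \<forall>a\<in>\<Lambda> i. \<forall>b\<in>\<Lambda> j.
        a * b \<in> \<Lambda> ((i + j) mod 2) \<and> a * b = (-1) ^ (i * j) * (b * a))"

definition indexed_basis :: "(nat \<Rightarrow> 'a::real_vector) \<Rightarrow> nat set \<Rightarrow> 'a set \<Rightarrow> bool" where
  "indexed_basis b I S \<longleftrightarrow> inj_on b I \<and> independent (b ` I) \<and> span (b ` I) = S"

definition cond_A0 :: "(nat \<Rightarrow> 'a::real_algebra_1 set) \<Rightarrow> nat \<Rightarrow> (nat \<Rightarrow> 'a) \<Rightarrow> bool" where
  "cond_A0 \<Lambda> p e \<longleftrightarrow>
     indexed_basis e {0..p} (\<Lambda> 0) \<and> e 0 = 1 \<and> (\<Sum>k=0..p. (e k)\<^sup>2) = 0"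

text \<open>If \<open>\<Lambda> 1 = {0}\<close>, then \<open>q = r = 0\<close> and the condition below is met with no blocks.\<close>

definition cond_A1 ::
  "(nat \<Rightarrow> 'a::real_algebra_1 set) \<Rightarrow> nat \<Rightarrow> nat \<Rightarrow> (nat \<Rightarrow> nat) \<Rightarrow> (nat \<Rightarrow> 'a) \<Rightarrow> (nat \<Rightarrow> 'a) \<Rightarrow> bool"
where
  "cond_A1 \<Lambda> q r s \<epsilon> a \<longleftrightarrow>
     indexed_basis \<epsilon> {1..q} (\<Lambda> 1) \<and>
     s 1 = 1 \<and> s (r + 1) = q + 1 \<and> strict_mono_on {1..r+1} s \<and>
     (\<forall>j\<in>{1..q}. a j \<in> \<Lambda> 0) \<and>
     (\<forall>k\<in>{1..r}.
        (\<forall>j\<in>{s k..<s (k + 1)}. \<epsilon> j = a j * \<epsilon> (s k)) \<and>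
        a (s k) = 1 \<and>
        (\<Sum>j = s k..<s (k + 1). (a j)\<^sup>2) = 0)"

text \<open>
  The space \<open>\<Lambda> 0 ^ n \<times> \<Lambda> 1 ^ m\<close>, where \<open>n\<close> or \<open>m\<close> may be \<open>0\<close>, is realised as a linear subspace of
  \<open>'a ^ 'v\<close>: the set \<open>E\<close> consists of the \<open>n\<close> indices of the even variables \<open>y\<close>, its complement of the
  \<open>m\<close> indices of the odd variables \<open>\<theta>\<close>. Open sets, frontiers and derivatives are
  relative to this subspace.
\<close>

definition superspace :: "(nat \<Rightarrow> 'a::real_algebra_1 set) \<Rightarrow> 'v set \<Rightarrow> ('a ^ 'v::finite) set" where
  "superspace \<Lambda> E = {x. (\<forall>i\<in>E. x $ i \<in> \<Lambda> 0) \<and> (\<forall>i\<in>-E. x $ i \<in> \<Lambda> 1)}"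

text \<open>
  For a basis vector \<open>b\<close>, the derivative of \<open>f\<close> with respect to the real coordinate
  of the \<open>i\<close>-th variable belonging to \<open>b\<close>.
\<close>

definition pd :: "('a ^ 'v \<Rightarrow> 'a) \<Rightarrow> 'v::finite \<Rightarrow> 'a \<Rightarrow> 'a ^ 'v \<Rightarrow> 'a::real_normed_vector" where
  "pd f i b x = vector_derivative (\<lambda>t. f (x + t *\<^sub>R axis i b)) (at 0)"

text \<open>
  The value on a tangent vector \<open>h\<close> of the \<open>'a\<close>-valued 1-form \<open>d''f\<close> at \<open>x\<close>.
  The factor \<open>representation (e ` {0..p}) (h $ i) (e j)\<close> is the coordinate form
  \<open>dy\<^sub>i\<^sup>j\<close> applied to \<open>h\<close>, and similarly for the odd variables.
\<close>

definition d_second ::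
  "'v set \<Rightarrow> nat \<Rightarrow> (nat \<Rightarrow> 'a) \<Rightarrow> nat \<Rightarrow> nat \<Rightarrow> (nat \<Rightarrow> nat) \<Rightarrow> (nat \<Rightarrow> 'a) \<Rightarrow> (nat \<Rightarrow> 'a) \<Rightarrow>
   ('a ^ 'v \<Rightarrow> 'a) \<Rightarrow> 'a ^ 'v \<Rightarrow> 'a ^ 'v::finite \<Rightarrow> 'a::{euclidean_space, real_algebra_1}"
where
  "d_second E p e q r s \<epsilon> a f x h =
     (\<Sum>i\<in>E. \<Sum>j=1..p.
        representation (e ` {0..p}) (h $ i) (e j) *\<^sub>R
          (pd f i (e j) x - e j * pd f i (e 0) x)) +
     (\<Sum>i\<in>-E. \<Sum>k=1..r. \<Sum>t = s k + 1..<s (k + 1).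
        representation (\<epsilon> ` {1..q}) (h $ i) (\<epsilon> t) *\<^sub>R
          (pd f i (\<epsilon> t) x - a t * pd f i (\<epsilon> (s k)) x))"

text \<open>
  Only used for \<open>U\<close> open in \<^term>\<open>superspace \<Lambda> E\<close>; then differentiability within \<open>U\<close>
  is Frechet differentiability over the reals on that space.
\<close>

definition qS_differentiable_on ::
  "(nat \<Rightarrow> 'a set) \<Rightarrow> 'v set \<Rightarrow> nat \<Rightarrow> (nat \<Rightarrow> 'a) \<Rightarrow> nat \<Rightarrow> nat \<Rightarrow> (nat \<Rightarrow> nat) \<Rightarrow>
   (nat \<Rightarrow> 'a) \<Rightarrow> (nat \<Rightarrow> 'a) \<Rightarrow> ('a ^ 'v::finite \<Rightarrow> 'a::{euclidean_space, real_algebra_1}) \<Rightarrow>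
   ('a ^ 'v) set \<Rightarrow> bool"
where
  "qS_differentiable_on \<Lambda> E p e q r s \<epsilon> a f U \<longleftrightarrow>
     f differentiable_on U \<and>
     (\<forall>x\<in>U. \<forall>h\<in>superspace \<Lambda> E. d_second E p e q r s \<epsilon> a f x h = 0)"

end

(* A point of the space is moved only inside a real plane spanned by two directions u, v of one variable
   on which the equations read d_v f = a * d_u f with a central and without real eigenvalues; condition
   (A_0), respectively (A_1), rules out a common real character of the coefficients, so a generic
   combination of the basis directions has this property. On such a plane x + y a is invertible for
   (x, y) <> 0, its inverse is a Cauchy kernel, and a Goursat argument gives Cauchy formulas for
   functions that are merely differentiable; in particular solutions are C^1 and satisfy unique
   continuation.
   Put K = Omega - U. In every plane parallel to (u, v), integrating the kernel against f times the
   antiholomorphic derivative of a cutoff around the slice of K splits f = f1 - f2 with f1 a solution on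
   Omega and f2 a solution off K: all equations survive because the kernel is central and only averages
   translates of f. Planes far away miss K, so f2 vanishes there, hence along a segment running to
   the boundary of Omega and then along the whole boundary, which is connected. So f1 extends f. *)
theory Submission
  imports Defs
begin

section \<open>Central elements of a finite-dimensional real algebra\<close>

text \<open>The coefficients are even, hence central, although \<open>f\<close> may take values in a
  noncommutative algebra; so kernel and coefficients pass each other freely. The norm is only an
  auxiliary Euclidean one: products are estimated with a constant from finite dimension, and
  exponentials are handled through partial sums. The period of the kernel replaces
  \<open>2 * pi * i\<close>. It is not computed for general \<open>a\<close>, and the obstacle is to
  show that it is invertible: half of it is a logarithm of -1, which cannot annihilate a nonzero
  vector. The mere differentiability of \<open>f\<close> forces the Goursat argument; continuity of
  the derivative has to be recovered afterwards, since differentiation under the integral requires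
  it. The equations live on a subspace, so \<open>f\<close> is pulled back along a linear
  projection, and equations making it constant along the fibres join the system. The condition
  \<open>n + m \<ge> 2\<close> supplies a direction outside the plane, hence translates of the plane
  that miss the bounded set \<open>K\<close>.\<close>

lemma bounded_bilinear_mult_fin_dim:
  "bounded_bilinear ((*) :: 'a::{euclidean_space,real_algebra_1} \<Rightarrow> 'a \<Rightarrow> 'a)"
  unfolding bilinear_conv_bounded_bilinear[symmetric] bilinear_def
  by (auto intro!: linearI simp: algebra_simps)

interpretation mult: bounded_bilinear "(*) :: 'a::{euclidean_space,real_algebra_1} \<Rightarrow> 'a \<Rightarrow> 'a"
  by (rule bounded_bilinear_mult_fin_dim)

definition central :: "'a::{euclidean_space,real_algebra_1} \<Rightarrow> bool" where
  "central c \<longleftrightarrow> (\<forall>y. c * y = y * c)"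

lemma centralD: "central c \<Longrightarrow> c * y = y * c"
  by (simp add: central_def)

lemma central_left_commute: "central c \<Longrightarrow> y * (c * z) = c * (y * z)"
  by (metis central_def mult.assoc)

lemma central_0 [simp]: "central 0" and central_1 [simp]: "central 1"
  by (simp_all add: central_def)

lemma central_add: "central c \<Longrightarrow> central d \<Longrightarrow> central (c + d)"
  by (simp add: central_def algebra_simps)

lemma central_diff: "central c \<Longrightarrow> central d \<Longrightarrow> central (c - d)"
  by (simp add: central_def algebra_simps)

lemma central_minus: "central c \<Longrightarrow> central (- c)"
  by (simp add: central_def algebra_simps)

lemma central_scaleR: "central c \<Longrightarrow> central (x *\<^sub>R c)"
  by (simp add: central_def)

lemma central_mult: "central c \<Longrightarrow> central d \<Longrightarrow> central (c * d)"
  by (metis central_def mult.assoc)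

lemma central_power: "central c \<Longrightarrow> central (c ^ n)"
  by (induction n) (auto intro: central_mult)

lemma central_sum: "(\<And>i. i \<in> I \<Longrightarrow> central (c i)) \<Longrightarrow> central (\<Sum>i\<in>I. c i)"
  by (induction I rule: infinite_finite_induct) (auto intro: central_add)

lemmas central_intros =
  central_add central_diff central_minus central_scaleR central_mult central_power central_sum

text \<open>Left and right multiplication by \<open>y\<close> are bounded linear maps and pass under
  the integral. If \<open>\<phi>\<close> is not integrable, the integral takes the default value 0,
  which is central.\<close>

lemma central_integral:
  assumes "\<And>z. z \<in> S \<Longrightarrow> central (\<phi> z)"
  shows "central (integral S \<phi>)"
proof (cases "\<phi> integrable_on S")
  case True
  have "integral S \<phi> * y = y * integral S \<phi>" for y
  proof -
    have "integral S \<phi> * y = integral S (\<lambda>z. \<phi> z * y)"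
      using integral_linear[OF True mult.bounded_linear_left[of y]] by (simp add: o_def)
    also have "\<dots> = integral S (\<lambda>z. y * \<phi> z)"
      by (rule integral_cong) (use assms in \<open>auto simp: centralD\<close>)
    also have "\<dots> = y * integral S \<phi>"
      using integral_linear[OF True mult.bounded_linear_right[of y]] by (simp add: o_def)
    finally show ?thesis .
  qed
  then show ?thesis by (simp add: central_def)
qed (simp add: not_integrable_integral)

text \<open>In finite dimension an injective multiplication is onto, which gives the inverse
  \<open>d\<close>; it is central because \<open>q\<close> annihilates every commutator of
  \<open>d\<close>.\<close>

lemma central_inverse_ex:
  fixes q :: "'a::{euclidean_space,real_algebra_1}"
  assumes q: "central q" and inj: "\<And>w. q * w = 0 \<Longrightarrow> w = 0"
  obtains d where "central d" "q * d = 1"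
proof -
  have lin: "linear ((*) q)" by (simp add: mult.bounded_linear_right bounded_linear.linear)
  have "inj ((*) q)"
    using inj by (simp add: linear_injective_0[OF lin])
  then have "surj ((*) q)" using linear_injective_imp_surjective[OF lin] by simp
  then obtain d where d: "q * d = 1" by (metis surjD)
  have "q * (d * y - y * d) = 0" for y
  proof -
    have "q * (d * y) = y" using d by (simp flip: mult.assoc)
    moreover have "q * (y * d) = y" using central_left_commute[OF q, of y d] d by simp
    ultimately show ?thesis by (simp add: right_diff_distrib)
  qed
  then have "d * y - y * d = 0" for y by (rule inj)
  then have "central d" by (simp add: central_def)
  with d that show ?thesis by blast
qed

text \<open>For an imaginary unit of the complex numbers the equation with coefficient
  \<open>a\<close> is the Cauchy-Riemann equation. In general the absence of real eigenvalues makes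
  \<open>x + y a\<close> invertible for real \<open>(x, y)\<close> other than the origin.\<close>

definition elliptic :: "'a::{euclidean_space,real_algebra_1} \<Rightarrow> bool" where
  "elliptic a \<longleftrightarrow> central a \<and> (\<forall>x w. a * w = x *\<^sub>R w \<longrightarrow> w = 0)"

section \<open>Real eigenvalues along polynomial curves of central elements\<close>

lemma vector_polynomial_zero:
  fixes c :: "nat \<Rightarrow> 'b::euclidean_space"
  assumes inf: "infinite {t::nat. (\<Sum>k\<le>d. (real t ^ k) *\<^sub>R c k) = 0}" and k: "k \<le> d"
  shows "c k = 0"
proof (rule euclidean_eqI)
  fix b :: 'b assume b: "b \<in> Basis"
  have "\<not> finite {x::real. (\<Sum>i\<le>d. (c i \<bullet> b) * x ^ i) = 0}"
  proof
    assume fin: "finite {x::real. (\<Sum>i\<le>d. (c i \<bullet> b) * x ^ i) = 0}"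
    have "real ` {t::nat. (\<Sum>k\<le>d. (real t ^ k) *\<^sub>R c k) = 0}
        \<subseteq> {x::real. (\<Sum>i\<le>d. (c i \<bullet> b) * x ^ i) = 0}"
    proof clarsimp
      fix t assume "(\<Sum>k\<le>d. (real t ^ k) *\<^sub>R c k) = 0"
      then have "(\<Sum>k\<le>d. (real t ^ k) *\<^sub>R c k) \<bullet> b = 0" by simp
      then show "(\<Sum>i\<le>d. (c i \<bullet> b) * real t ^ i) = 0"
        by (simp add: inner_sum_left mult.commute)
    qed
    then have "finite (real ` {t::nat. (\<Sum>k\<le>d. (real t ^ k) *\<^sub>R c k) = 0})"
      using fin finite_subset by blast
    then show False using inf finite_imageD[of real] by (simp add: inj_on_def)
  qed
  then show "c k \<bullet> b = 0 \<bullet> b"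
    using k polyfun_finite_roots[of "\<lambda>i. c i \<bullet> b" d] by auto
qed

text \<open>For a projection \<open>\<pi>\<close> onto \<open>S\<close> the map
  \<open>v - \<pi> v\<close> has kernel \<open>S\<close> and turns membership in \<open>S\<close>
  into vanishing, so infinitely many parameters determine each coefficient modulo
  \<open>S\<close>.\<close>

lemma vector_polynomial_in_subspace:
  fixes c :: "nat \<Rightarrow> 'b::euclidean_space"
  assumes S: "subspace S" and inf: "infinite {t::nat. (\<Sum>k\<le>d. (real t ^ k) *\<^sub>R c k) \<in> S}"
    and k: "k \<le> d"
  shows "c k \<in> S"
proof -
  obtain \<pi> where \<pi>: "range \<pi> \<subseteq> S" "linear \<pi>" "\<And>v. v \<in> S \<Longrightarrow> \<pi> v = v"
    using linear_exists_left_inverse_on[OF linear_id S] by auto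
  have lin: "linear (\<lambda>v. v - \<pi> v)" using \<pi>(2) by (simp add: linear_compose_sub linear_id[unfolded id_def])
  have "{t::nat. (\<Sum>k\<le>d. (real t ^ k) *\<^sub>R c k) \<in> S}
      \<subseteq> {t. (\<Sum>k\<le>d. (real t ^ k) *\<^sub>R (c k - \<pi> (c k))) = 0}"
  proof
    fix t assume "t \<in> {t::nat. (\<Sum>k\<le>d. (real t ^ k) *\<^sub>R c k) \<in> S}"
    then have "(\<lambda>v. v - \<pi> v) (\<Sum>k\<le>d. (real t ^ k) *\<^sub>R c k) = 0" using \<pi>(3) by simp
    also have "(\<lambda>v. v - \<pi> v) (\<Sum>k\<le>d. (real t ^ k) *\<^sub>R c k) = (\<Sum>k\<le>d. (real t ^ k) *\<^sub>R (c k - \<pi> (c k)))"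
      unfolding linear_sum[OF lin] linear_cmul[OF lin] ..
    finally show "t \<in> {t. (\<Sum>k\<le>d. (real t ^ k) *\<^sub>R (c k - \<pi> (c k))) = 0}" by simp
  qed
  then have "c k - \<pi> (c k) = 0"
    by (intro vector_polynomial_zero[OF _ k]) (use inf finite_subset in blast)
  then show ?thesis using \<pi>(1) by auto
qed

text \<open>
  Splitting an invariant subspace into the kernel and the image of a central element reduces
  to the case that every central element acts on \<open>W\<close> injectively or as zero. There, if infinitely many
  elements of the curve have a real eigenvalue, then all \<open>\<alpha> k\<close> act as real scalars, and
  real squares with sum zero all vanish, contradicting \<open>\<alpha> 0 = 1\<close>.
\<close>
lemma finite_real_eigenvalue_parameters_on:
  fixes \<alpha> :: "nat \<Rightarrow> 'a::{euclidean_space,real_algebra_1}" and W :: "'a set"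
  assumes cen: "\<And>k. k \<le> d \<Longrightarrow> central (\<alpha> k)" and one: "\<alpha> 0 = 1"
    and sq: "(\<Sum>k\<le>d. (\<alpha> k)\<^sup>2) = 0"
    and "subspace W" and "\<And>c w. central c \<Longrightarrow> w \<in> W \<Longrightarrow> c * w \<in> W"
  shows "finite {t::nat. \<exists>x. \<exists>w\<in>W. w \<noteq> 0 \<and> (\<Sum>k\<le>d. (real t ^ k) *\<^sub>R \<alpha> k) * w = x *\<^sub>R w}"
  using assms(4,5)
proof (induction "dim W" arbitrary: W rule: less_induct)
  case less
  define a where "a t = (\<Sum>k\<le>d. (real t ^ k) *\<^sub>R \<alpha> k)" for t :: nat
  define bad where "bad W = {t::nat. \<exists>x. \<exists>w\<in>W. w \<noteq> 0 \<and> a t * w = x *\<^sub>R w}" for W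
  have ca: "central (a t)" for t
    unfolding a_def by (intro central_intros) (use cen in auto)
  have IH: "finite (bad V)" if "dim V < dim W" "subspace V" "\<And>c w. central c \<Longrightarrow> w \<in> V \<Longrightarrow> c * w \<in> V" for V
    using less.hyps[OF that] by (simp add: bad_def a_def)
  have "finite (bad W)"
  proof (cases "\<exists>c. central c \<and> (\<exists>w\<in>W. c * w \<noteq> 0) \<and> (\<exists>w\<in>W. w \<noteq> 0 \<and> c * w = 0)")
    case True
    then obtain c w0 w1 where c: "central c" and w0: "w0 \<in> W" "c * w0 \<noteq> 0"
      and w1: "w1 \<in> W" "w1 \<noteq> 0" "c * w1 = 0" by blast
    define K I where "K = {w\<in>W. c * w = 0}" and "I = (*) c ` W"
    have lin: "linear ((*) c)" by (simp add: mult.bounded_linear_right bounded_linear.linear)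
    have sK: "subspace K"
      using less.prems(1) by (auto simp: K_def subspace_def algebra_simps)
    have sI: "subspace I" unfolding I_def by (rule linear_subspace_image[OF lin less.prems(1)])
    have IW: "I \<subseteq> W" using less.prems(2) c by (auto simp: I_def)
    have invK: "b * w \<in> K" if "central b" "w \<in> K" for b w
      using that less.prems(2) by (auto simp: K_def central_left_commute)
    have invI: "b * w \<in> I" if b: "central b" and "w \<in> I" for b w
    proof -
      from \<open>w \<in> I\<close> obtain v where v: "v \<in> W" "w = c * v" by (auto simp: I_def)
      have "b * w = c * (b * v)" using central_left_commute[OF c] v by simp
      then show ?thesis using less.prems(2)[OF b v(1)] by (auto simp: I_def)
    qed
    have "span K \<subset> span W"
      unfolding span_eq_iff[THEN iffD2, OF sK] span_eq_iff[THEN iffD2, OF less.prems(1)]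
      using w0 by (auto simp: K_def)
    then have dK: "dim K < dim W" by (rule dim_psubset)
    have "I \<noteq> W"
    proof
      assume eq: "I = W"
      obtain \<pi> where \<pi>: "range \<pi> \<subseteq> W" "linear \<pi>" "\<And>v. v \<in> W \<Longrightarrow> \<pi> v = v"
        using linear_exists_left_inverse_on[OF linear_id less.prems(1)] by auto
      \<comment> \<open>If \<open>c\<close> mapped \<open>W\<close> onto itself it would be
        injective there, against \<open>w1\<close>. The dimension argument concerns the whole type,
        so \<open>c\<close> is extended by the identity along the kernel of
        \<open>\<pi>\<close>.\<close>
      define h where "h x = c * \<pi> x + (x - \<pi> x)" for x
      interpret pi: linear \<pi> by fact
      have linh: "linear h"
        by (auto intro!: linearI simp: h_def algebra_simps pi.add pi.scale)
      have "surj h"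
      proof (rule surjI)
        fix y
        have "\<pi> y \<in> I" using \<pi>(1) eq by auto
        then have *: "\<exists>w. w \<in> W \<and> c * w = \<pi> y" by (auto simp: I_def)
        define w where "w = (SOME w. w \<in> W \<and> c * w = \<pi> y)"
        have w: "w \<in> W" "c * w = \<pi> y" using someI_ex[OF *] by (auto simp: w_def)
        have "\<pi> (\<pi> y) = \<pi> y" using \<pi>(1) \<pi>(3) by auto
        then have "\<pi> (w + (y - \<pi> y)) = w" using \<pi>(3)[OF w(1)] by (simp add: pi.add pi.diff)
        then show "h ((\<lambda>y. (SOME w. w \<in> W \<and> c * w = \<pi> y) + (y - \<pi> y)) y) = y"
          using w(2) by (simp add: h_def flip: w_def)
      qed
      then have "inj h" using linear_surjective_imp_injective[OF linh] by simp
      moreover have "h w1 = 0" using w1 \<pi>(3) by (simp add: h_def)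
      ultimately show False using w1 linear_injective_0[OF linh] by blast
    qed
    then have "span I \<subset> span W"
      unfolding span_eq_iff[THEN iffD2, OF sI] span_eq_iff[THEN iffD2, OF less.prems(1)]
      using IW by blast
    then have dI: "dim I < dim W" by (rule dim_psubset)
    have "bad W \<subseteq> bad K \<union> bad I"
    proof
      fix t assume "t \<in> bad W"
      then obtain x w where w: "w \<in> W" "w \<noteq> 0" "a t * w = x *\<^sub>R w" by (auto simp: bad_def)
      show "t \<in> bad K \<union> bad I"
      proof (cases "c * w = 0")
        case True
        with w have "t \<in> bad K" unfolding bad_def K_def by blast
        then show ?thesis ..
      next
        case False
        have "a t * (c * w) = x *\<^sub>R (c * w)"
          using central_left_commute[OF c, of "a t" w] w(3) by simp
        with False w(1) have "t \<in> bad I" unfolding bad_def I_def by blast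
        then show ?thesis ..
      qed
    qed
    then show ?thesis
      using IH[OF dK sK invK] IH[OF dI sI invI] by (meson finite_UnI finite_subset)
  next
    case False
    show ?thesis
    proof (rule ccontr)
      assume inf: "infinite (bad W)"
      then obtain t0 where "t0 \<in> bad W" by (metis finite.emptyI ex_in_conv)
      then obtain w where w: "w \<in> W" "w \<noteq> 0" by (auto simp: bad_def)
      have "bad W \<subseteq> {t. (\<Sum>k\<le>d. (real t ^ k) *\<^sub>R (\<alpha> k * w)) \<in> span {w}}"
      proof
        fix t assume "t \<in> bad W"
        then obtain x v where v: "v \<in> W" "v \<noteq> 0" "a t * v = x *\<^sub>R v" by (auto simp: bad_def)
        \<comment> \<open>\<open>a t - x\<close> is central and kills the nonzero \<open>v\<close>;
          in the present case it must therefore kill all of \<open>W\<close>, in particular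
          \<open>w\<close>. Thus a single \<open>w\<close> serves for every bad
          \<open>t\<close>.\<close>
        have "central (a t - x *\<^sub>R 1)" using ca by (intro central_intros) auto
        moreover have "(a t - x *\<^sub>R 1) * v = 0" using v by (simp add: algebra_simps)
        ultimately have "(a t - x *\<^sub>R 1) * w = 0" using False v w by blast
        then have "a t * w = x *\<^sub>R w" by (simp add: algebra_simps)
        moreover have "a t * w = (\<Sum>k\<le>d. (real t ^ k) *\<^sub>R (\<alpha> k * w))"
          by (simp add: a_def sum_distrib_right)
        ultimately show "t \<in> {t. (\<Sum>k\<le>d. (real t ^ k) *\<^sub>R (\<alpha> k * w)) \<in> span {w}}"
          by (auto simp: span_singleton)
      qed
      then have "infinite {t. (\<Sum>k\<le>d. (real t ^ k) *\<^sub>R (\<alpha> k * w)) \<in> span {w}}"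
        using inf finite_subset by blast
      then have "\<alpha> k * w \<in> span {w}" if "k \<le> d" for k
        by (rule vector_polynomial_in_subspace[OF subspace_span _ that])
      then have "\<forall>k\<in>{..d}. \<exists>x. \<alpha> k * w = x *\<^sub>R w" by (auto simp: span_singleton)
      then obtain x where x: "\<And>k. k \<le> d \<Longrightarrow> \<alpha> k * w = x k *\<^sub>R w"
        by (metis atMost_iff)
      have "(\<Sum>k\<le>d. (x k)\<^sup>2) *\<^sub>R w = (\<Sum>k\<le>d. (\<alpha> k)\<^sup>2) * w"
        unfolding scaleR_sum_left sum_distrib_right
        by (rule sum.cong) (auto simp: x power2_eq_square mult.assoc)
      then have "(\<Sum>k\<le>d. (x k)\<^sup>2) = 0" using sq w(2) by simp
      then have "x 0 = 0" by (subst (asm) sum_nonneg_eq_0_iff) auto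
      then show False using x[of 0] one w(2) by simp
    qed
  qed
  then show ?case by (simp add: bad_def a_def)
qed

lemma finite_not_elliptic_parameters:
  fixes \<alpha> :: "nat \<Rightarrow> 'a::{euclidean_space,real_algebra_1}"
  assumes cen: "\<And>k. k \<le> d \<Longrightarrow> central (\<alpha> k)" and one: "\<alpha> 0 = 1"
    and sq: "(\<Sum>k\<le>d. (\<alpha> k)\<^sup>2) = 0"
  shows "finite {t::nat. \<not> elliptic (\<Sum>k\<le>d. (real t ^ k) *\<^sub>R \<alpha> k)}"
proof -
  have "central (\<Sum>k\<le>d. (real t ^ k) *\<^sub>R \<alpha> k)" for t :: nat
    by (intro central_intros) (use cen in auto)
  then have "{t::nat. \<not> elliptic (\<Sum>k\<le>d. (real t ^ k) *\<^sub>R \<alpha> k)} =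
      {t::nat. \<exists>x. \<exists>w\<in>UNIV. w \<noteq> 0 \<and> (\<Sum>k\<le>d. (real t ^ k) *\<^sub>R \<alpha> k) * w = x *\<^sub>R w}"
    by (auto simp: elliptic_def)
  then show ?thesis
    using finite_real_eigenvalue_parameters_on[OF cen one sq subspace_UNIV] by simp
qed

section \<open>A Goursat-type Stokes formula\<close>

lemma integral_split_fst:
  fixes \<phi> :: "real \<times> real \<Rightarrow> 'b::euclidean_space"
  assumes c: "continuous_on (cbox (x0, y0) (x1, y1)) \<phi>" and m: "x0 \<le> m" "m \<le> x1"
  shows "integral (cbox (x0, y0) (x1, y1)) \<phi> =
    integral (cbox (x0, y0) (m, y1)) \<phi> + integral (cbox (m, y0) (x1, y1)) \<phi>"
proof -
  have "cbox (x0, y0) (x1, y1) \<inter> {z. z \<bullet> (1, 0) \<le> m} = cbox (x0, y0) (m, y1)"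
    "cbox (x0, y0) (x1, y1) \<inter> {z. m \<le> z \<bullet> (1, 0)} = cbox (m, y0) (x1, y1)"
    using m by (auto simp: cbox_Pair_eq)
  then show ?thesis
    using integral_split[OF integrable_continuous[OF c], of "(1, 0)" m] by (simp add: Basis_prod_def)
qed

lemma integral_split_snd:
  fixes \<phi> :: "real \<times> real \<Rightarrow> 'b::euclidean_space"
  assumes c: "continuous_on (cbox (x0, y0) (x1, y1)) \<phi>" and m: "y0 \<le> m" "m \<le> y1"
  shows "integral (cbox (x0, y0) (x1, y1)) \<phi> =
    integral (cbox (x0, y0) (x1, m)) \<phi> + integral (cbox (x0, m) (x1, y1)) \<phi>"
proof -
  have "cbox (x0, y0) (x1, y1) \<inter> {z. z \<bullet> (0, 1) \<le> m} = cbox (x0, y0) (x1, m)"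
    "cbox (x0, y0) (x1, y1) \<inter> {z. m \<le> z \<bullet> (0, 1)} = cbox (x0, m) (x1, y1)"
    using m by (auto simp: cbox_Pair_eq)
  then show ?thesis
    using integral_split[OF integrable_continuous[OF c], of "(0, 1)" m] by (simp add: Basis_prod_def)
qed

text \<open>With \<open>T\<close> the multiplication by \<open>a\<close>, this is minus the
  counterclockwise integral of \<open>g dx + a g dy\<close>, the analogue of \<open>g dz\<close>.
  The sign matches the area integral of the \<open>y\<close>-derivative minus \<open>T\<close> of
  the \<open>x\<close>-derivative.\<close>

definition boundary_integral ::
  "('b::euclidean_space \<Rightarrow> 'b) \<Rightarrow> (real \<times> real \<Rightarrow> 'b) \<Rightarrow> real \<Rightarrow> real \<Rightarrow> real \<Rightarrow> real \<Rightarrow> 'b" where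
  "boundary_integral T g x0 y0 x1 y1 =
     integral {x0..x1} (\<lambda>x. g (x, y1)) - integral {x0..x1} (\<lambda>x. g (x, y0)) -
     T (integral {y0..y1} (\<lambda>y. g (x1, y)) - integral {y0..y1} (\<lambda>y. g (x0, y)))"

lemma integrable_slices:
  fixes g :: "real \<times> real \<Rightarrow> 'b::euclidean_space"
  assumes c: "continuous_on (cbox (x0, y0) (x1, y1)) g"
  shows "y \<in> {y0..y1} \<Longrightarrow> x0 \<le> l \<Longrightarrow> r \<le> x1 \<Longrightarrow> (\<lambda>x. g (x, y)) integrable_on {l..r}"
    and "x \<in> {x0..x1} \<Longrightarrow> y0 \<le> l \<Longrightarrow> r \<le> y1 \<Longrightarrow> (\<lambda>y. g (x, y)) integrable_on {l..r}"
  by (auto intro!: integrable_continuous_interval continuous_on_compose2[OF c] continuous_intros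
      simp: cbox_Pair_eq)

text \<open>The edges interior to the large rectangle occur twice with opposite signs.\<close>

lemma boundary_integral_split4:
  fixes T :: "'b::euclidean_space \<Rightarrow> 'b" and g :: "real \<times> real \<Rightarrow> 'b"
  assumes T: "linear T" and c: "continuous_on (cbox (x0, y0) (x1, y1)) g"
    and m: "x0 \<le> m" "m \<le> x1" "y0 \<le> k" "k \<le> y1"
  shows "boundary_integral T g x0 y0 x1 y1 =
    boundary_integral T g x0 y0 m k + boundary_integral T g m y0 x1 k +
    boundary_integral T g x0 k m y1 + boundary_integral T g m k x1 y1"
proof -
  have h: "integral {x0..x1} (\<lambda>x. g (x, y)) = integral {x0..m} (\<lambda>x. g (x, y)) + integral {m..x1} (\<lambda>x. g (x, y))"
    if "y \<in> {y0..y1}" for y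
    by (rule Henstock_Kurzweil_Integration.integral_combine[symmetric, OF m(1,2)])
      (rule integrable_slices(1)[OF c that], auto)
  have v: "integral {y0..y1} (\<lambda>y. g (x, y)) = integral {y0..k} (\<lambda>y. g (x, y)) + integral {k..y1} (\<lambda>y. g (x, y))"
    if "x \<in> {x0..x1}" for x
    by (rule Henstock_Kurzweil_Integration.integral_combine[symmetric, OF m(3,4)])
      (rule integrable_slices(2)[OF c that], auto)
  have "y0 \<in> {y0..y1}" "y1 \<in> {y0..y1}" "x0 \<in> {x0..x1}" "x1 \<in> {x0..x1}" using m by auto
  then show ?thesis
    unfolding boundary_integral_def by (simp add: h v linear_diff[OF T] linear_add[OF T])
qed

text \<open>Affine functions satisfy the Stokes formula exactly; they carry the main term of the
  Goursat estimate.\<close>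

lemma boundary_integral_affine:
  fixes T :: "'b::euclidean_space \<Rightarrow> 'b"
  assumes T: "linear T" and L: "linear L" and le: "x0 \<le> x1" "y0 \<le> y1"
  shows "boundary_integral T (\<lambda>z. c + L (z - z0)) x0 y0 x1 y1 =
    ((x1 - x0) * (y1 - y0)) *\<^sub>R (L (0, 1) - T (L (1, 0)))"
proof -
  have cL: "continuous_on UNIV L" by (simp add: L linear_continuous_on linear_conv_bounded_linear[symmetric])
  let ?g = "\<lambda>z. c + L (z - z0)"
  have i1: "(\<lambda>x. ?g (x, y)) integrable_on {l..r}" and i2: "(\<lambda>y. ?g (x, y)) integrable_on {l..r}" for x y l r
    by (auto intro!: integrable_continuous_interval continuous_on_compose2[OF cL] continuous_intros)
  have d1: "?g (x, y1) - ?g (x, y0) = (y1 - y0) *\<^sub>R L (0, 1)" for x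
  proof -
    have "?g (x, y1) - ?g (x, y0) = L ((x, y1) - z0 - ((x, y0) - z0))"
      by (simp add: linear_diff[OF L, symmetric])
    also have "(x, y1) - z0 - ((x, y0) - z0) = (y1 - y0) *\<^sub>R (0, 1)" by simp
    finally show ?thesis by (simp only: linear_cmul[OF L])
  qed
  have d2: "?g (x1, y) - ?g (x0, y) = (x1 - x0) *\<^sub>R L (1, 0)" for y
  proof -
    have "?g (x1, y) - ?g (x0, y) = L ((x1, y) - z0 - ((x0, y) - z0))"
      by (simp add: linear_diff[OF L, symmetric])
    also have "(x1, y) - z0 - ((x0, y) - z0) = (x1 - x0) *\<^sub>R (1, 0)" by simp
    finally show ?thesis by (simp only: linear_cmul[OF L])
  qed
  have e1: "integral {x0..x1} (\<lambda>x. ?g (x, y1)) - integral {x0..x1} (\<lambda>x. ?g (x, y0))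
      = integral {x0..x1} (\<lambda>x. (y1 - y0) *\<^sub>R L (0, 1))"
    by (subst Henstock_Kurzweil_Integration.integral_diff[OF i1 i1, symmetric]) (simp only: d1)
  have e2: "integral {y0..y1} (\<lambda>y. ?g (x1, y)) - integral {y0..y1} (\<lambda>y. ?g (x0, y))
      = integral {y0..y1} (\<lambda>y. (x1 - x0) *\<^sub>R L (1, 0))"
    by (subst Henstock_Kurzweil_Integration.integral_diff[OF i2 i2, symmetric]) (simp only: d2)
  show ?thesis
    unfolding boundary_integral_def e1 e2 using le
    by (simp add: linear_cmul[OF T] scaleR_diff_right mult.commute)
qed

text \<open>\<open>S\<close> only has to contain the four edges, so the estimate also covers
  functions with a singularity inside the rectangle.\<close>

lemma boundary_integral_bound:
  fixes T :: "'b::euclidean_space \<Rightarrow> 'b" and g :: "real \<times> real \<Rightarrow> 'b"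
  assumes T: "\<And>v. norm (T v) \<le> K * norm v" and K: "0 \<le> K"
    and le: "x0 \<le> x1" "y0 \<le> y1"
    and S: "{x0..x1} \<times> {y0, y1} \<subseteq> S" "{x0, x1} \<times> {y0..y1} \<subseteq> S"
    and c: "continuous_on S g" and B: "\<And>z. z \<in> S \<Longrightarrow> norm (g z) \<le> B"
  shows "norm (boundary_integral T g x0 y0 x1 y1) \<le> 2 * (1 + K) * B * ((x1 - x0) + (y1 - y0))"
proof -
  have "norm (g (x0, y0)) \<le> B" by (rule B) (use le S in auto)
  then have B0: "0 \<le> B" by (rule order_trans[OF norm_ge_zero])
  have h: "norm (integral {x0..x1} (\<lambda>x. g (x, y))) \<le> B * (x1 - x0)" if "y \<in> {y0, y1}" for y
    by (rule integral_bound) (use le that in \<open>auto intro!: continuous_on_compose2[OF c] continuous_intros B subsetD[OF S(1)]\<close>)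
  have v: "norm (integral {y0..y1} (\<lambda>y. g (x, y))) \<le> B * (y1 - y0)" if "x \<in> {x0, x1}" for x
    by (rule integral_bound) (use le that in \<open>auto intro!: continuous_on_compose2[OF c] continuous_intros B subsetD[OF S(2)]\<close>)
  have "norm (boundary_integral T g x0 y0 x1 y1) \<le>
      norm (integral {x0..x1} (\<lambda>x. g (x, y1))) + norm (integral {x0..x1} (\<lambda>x. g (x, y0))) +
      K * (norm (integral {y0..y1} (\<lambda>y. g (x1, y))) + norm (integral {y0..y1} (\<lambda>y. g (x0, y))))"
    unfolding boundary_integral_def
    by (intro order_trans[OF norm_triangle_ineq4] add_mono order_trans[OF T] mult_left_mono K order_refl)
  also have "\<dots> \<le> B * (x1 - x0) + B * (x1 - x0) + K * (B * (y1 - y0) + B * (y1 - y0))"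
    by (intro add_mono mult_left_mono h v K) auto
  also have "\<dots> \<le> 2 * (1 + K) * B * ((x1 - x0) + (y1 - y0))"
  proof -
    have "2 * (1 + K) * B * ((x1 - x0) + (y1 - y0)) -
      (B * (x1 - x0) + B * (x1 - x0) + K * (B * (y1 - y0) + B * (y1 - y0)))
      = 2 * B * (y1 - y0) + 2 * K * B * (x1 - x0)" by (simp add: algebra_simps)
    moreover have "\<dots> \<ge> 0" using B0 K le by simp
    ultimately show ?thesis by linarith
  qed
  finally show ?thesis .
qed

lemma boundary_integral_diff:
  fixes T :: "'b::euclidean_space \<Rightarrow> 'b" and g :: "real \<times> real \<Rightarrow> 'b"
  assumes T: "linear T" and le: "x0 \<le> x1" "y0 \<le> y1"
    and c: "continuous_on (cbox (x0, y0) (x1, y1)) g" "continuous_on (cbox (x0, y0) (x1, y1)) h"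
  shows "boundary_integral T (\<lambda>z. g z - h z) x0 y0 x1 y1 =
    boundary_integral T g x0 y0 x1 y1 - boundary_integral T h x0 y0 x1 y1"
proof -
  have "integral {x0..x1} (\<lambda>x. g (x, y) - h (x, y)) =
      integral {x0..x1} (\<lambda>x. g (x, y)) - integral {x0..x1} (\<lambda>x. h (x, y))" if "y \<in> {y0..y1}" for y
    by (intro Henstock_Kurzweil_Integration.integral_diff integrable_slices[OF c(1)] integrable_slices[OF c(2)])
      (use that in auto)
  moreover have "integral {y0..y1} (\<lambda>y. g (x, y) - h (x, y)) =
      integral {y0..y1} (\<lambda>y. g (x, y)) - integral {y0..y1} (\<lambda>y. h (x, y))" if "x \<in> {x0..x1}" for x
    by (intro Henstock_Kurzweil_Integration.integral_diff integrable_slices[OF c(1)] integrable_slices[OF c(2)])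
      (use that in auto)
  ultimately show ?thesis
    using le unfolding boundary_integral_def by (simp add: linear_diff[OF T])
qed

text \<open>
  Only pointwise differentiability of \<open>g\<close> is required, as in Goursat's lemma: a defect of the formula
  would survive on a nested sequence of quarters shrinking to a point, where differentiability bounds it
  by a small multiple of the area.
\<close>
theorem stokes_rectangle:
  fixes T :: "'b::euclidean_space \<Rightarrow> 'b" and g \<phi> :: "real \<times> real \<Rightarrow> 'b"
  assumes T: "linear T" and le: "x0 \<le> x1" "y0 \<le> y1"
    and g: "\<And>z. z \<in> cbox (x0, y0) (x1, y1) \<Longrightarrow>
      (g has_derivative g' z) (at z within cbox (x0, y0) (x1, y1))"
    and \<phi>: "\<And>z. z \<in> cbox (x0, y0) (x1, y1) \<Longrightarrow> \<phi> z = g' z (0, 1) - T (g' z (1, 0))"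
    and c\<phi>: "continuous_on (cbox (x0, y0) (x1, y1)) \<phi>"
  shows "integral (cbox (x0, y0) (x1, y1)) \<phi> = boundary_integral T g x0 y0 x1 y1"
proof (rule ccontr)
  let ?Q = "cbox (x0, y0) (x1, y1)"
  define \<Phi> where "\<Phi> p q = boundary_integral T g (fst p) (snd p) (fst q) (snd q) - integral (cbox p q) \<phi>"
    for p q :: "real \<times> real"
  define X Y where "X = x1 - x0" and "Y = y1 - y0"
  assume "integral ?Q \<phi> \<noteq> boundary_integral T g x0 y0 x1 y1"
  then have c: "norm (\<Phi> (x0, y0) (x1, y1)) > 0" by (simp add: \<Phi>_def)
  define \<epsilon> where "\<epsilon> = norm (\<Phi> (x0, y0) (x1, y1))"
  have cg: "continuous_on ?Q g" using g has_derivative_continuous_on by blast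
  \<comment> \<open>\<open>u\<close> lists the lower left and the upper right corner of a quarter of
    generation \<open>n\<close>; its defect \<open>\<Phi>\<close> keeps at least the share of the
    total defect \<open>\<epsilon>\<close> that corresponds to its area.\<close>
  define P where "P n u \<longleftrightarrow> fst (snd u) = fst (fst u) + X / 2 ^ n \<and> snd (snd u) = snd (fst u) + Y / 2 ^ n \<and>
      cbox (fst u) (snd u) \<subseteq> ?Q \<and> \<epsilon> / 4 ^ n \<le> norm (\<Phi> (fst u) (snd u))"
    for n and u :: "(real \<times> real) \<times> real \<times> real"
  have X0: "0 \<le> X" "0 \<le> Y" using le by (auto simp: X_def Y_def)
  have "\<exists>u. \<forall>n. P n (u n) \<and> cbox (fst (u (Suc n))) (snd (u (Suc n))) \<subseteq> cbox (fst (u n)) (snd (u n))"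
  proof (rule dependent_nat_choice)
    show "\<exists>u. P 0 u"
      by (rule exI[of _ "((x0, y0), (x1, y1))"]) (simp add: P_def X_def Y_def \<epsilon>_def)
  next
    fix u n assume P: "P n u"
    obtain l b r t where u: "u = ((l, b), (r, t))" by (metis prod.collapse)
    define m k where "m = l + X / 2 ^ Suc n" and "k = b + Y / 2 ^ Suc n"
    have r: "r = m + X / 2 ^ Suc n" "t = k + Y / 2 ^ Suc n" and sub: "cbox (l, b) (r, t) \<subseteq> ?Q"
      and big: "\<epsilon> / 4 ^ n \<le> norm (\<Phi> (l, b) (r, t))"
      using P by (auto simp: P_def u m_def k_def field_simps)
    have pos: "0 \<le> X / 2 ^ Suc n" "0 \<le> Y / 2 ^ Suc n" using X0 by auto
    then have ord: "l \<le> m" "m \<le> r" "b \<le> k" "k \<le> t" by (simp_all add: m_def k_def r)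
    have subs: "cbox (l, b) (m, k) \<subseteq> cbox (l, b) (r, t)" "cbox (m, b) (r, k) \<subseteq> cbox (l, b) (r, t)"
      "cbox (l, k) (m, t) \<subseteq> cbox (l, b) (r, t)" "cbox (m, k) (r, t) \<subseteq> cbox (l, b) (r, t)"
      using ord by (auto simp: cbox_Pair_eq)
    have c1: "continuous_on (cbox (l, b) (r, t)) \<phi>" "continuous_on (cbox (l, b) (r, t)) g"
      using c\<phi> cg sub continuous_on_subset by blast+
    have split: "\<Phi> (l, b) (r, t) = \<Phi> (l, b) (m, k) + \<Phi> (m, b) (r, k) + \<Phi> (l, k) (m, t) + \<Phi> (m, k) (r, t)"
    proof -
      have "integral (cbox (l, b) (r, t)) \<phi> = integral (cbox (l, b) (r, k)) \<phi> + integral (cbox (l, k) (r, t)) \<phi>"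
        by (rule integral_split_snd[OF c1(1) ord(3,4)])
      moreover have "integral (cbox (l, b) (r, k)) \<phi> = integral (cbox (l, b) (m, k)) \<phi> + integral (cbox (m, b) (r, k)) \<phi>"
        by (rule integral_split_fst[OF continuous_on_subset[OF c1(1)] ord(1,2)])
          (use ord in \<open>auto simp: cbox_Pair_eq\<close>)
      moreover have "integral (cbox (l, k) (r, t)) \<phi> = integral (cbox (l, k) (m, t)) \<phi> + integral (cbox (m, k) (r, t)) \<phi>"
        by (rule integral_split_fst[OF continuous_on_subset[OF c1(1)] ord(1,2)])
          (use ord in \<open>auto simp: cbox_Pair_eq\<close>)
      ultimately show ?thesis
        using boundary_integral_split4[OF T c1(2) ord] by (simp add: \<Phi>_def)
    qed
    have "\<exists>p q. (p, q) \<in> {((l, b), (m, k)), ((m, b), (r, k)), ((l, k), (m, t)), ((m, k), (r, t))} \<and>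
        \<epsilon> / 4 ^ Suc n \<le> norm (\<Phi> p q)"
    proof (rule ccontr)
      assume *: "\<not> ?thesis"
      have "norm (\<Phi> (l, b) (r, t)) \<le> norm (\<Phi> (l, b) (m, k)) + norm (\<Phi> (m, b) (r, k)) +
          norm (\<Phi> (l, k) (m, t)) + norm (\<Phi> (m, k) (r, t))"
        unfolding split by (intro order_trans[OF norm_triangle_ineq] add_right_mono order_refl)
      moreover have "norm (\<Phi> (l, b) (m, k)) < \<epsilon> / 4 ^ Suc n" "norm (\<Phi> (m, b) (r, k)) < \<epsilon> / 4 ^ Suc n"
        "norm (\<Phi> (l, k) (m, t)) < \<epsilon> / 4 ^ Suc n" "norm (\<Phi> (m, k) (r, t)) < \<epsilon> / 4 ^ Suc n"
        using * by (auto simp: not_le)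
      moreover have "4 * (\<epsilon> / 4 ^ Suc n) = \<epsilon> / 4 ^ n" by simp
      ultimately show False using big by linarith
    qed
    then obtain p q where pq: "(p, q) \<in> {((l, b), (m, k)), ((m, b), (r, k)), ((l, k), (m, t)), ((m, k), (r, t))}"
        "\<epsilon> / 4 ^ Suc n \<le> norm (\<Phi> p q)" by blast
    have sub': "cbox p q \<subseteq> cbox (l, b) (r, t)" using pq(1) subs by auto
    have "P (Suc n) (p, q)"
      unfolding P_def using pq sub sub' by (auto simp: m_def k_def r)
    then show "\<exists>v. P (Suc n) v \<and> cbox (fst v) (snd v) \<subseteq> cbox (fst u) (snd u)"
      using sub' by (intro exI[of _ "(p, q)"]) (simp add: u)
  qed
  then obtain u where P: "\<And>n. P n (u n)"
    and nest: "\<And>n. cbox (fst (u (Suc n))) (snd (u (Suc n))) \<subseteq> cbox (fst (u n)) (snd (u n))" by blast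
  define F where "F n = cbox (fst (u n)) (snd (u n))" for n
  have dec: "F n \<subseteq> F m" if "m \<le> n" for m n
    using lift_Suc_antimono_le[of F, OF _ that] nest by (simp add: F_def)
  have corner: "fst (u n) \<in> F n" for n
  proof -
    obtain l b r t where u: "u n = ((l, b), (r, t))" by (metis prod.collapse)
    have "l \<le> r" "b \<le> t" using P[of n] X0 by (auto simp: P_def u)
    then show ?thesis by (simp add: F_def u cbox_Pair_eq)
  qed
  have "\<Inter> (range F) \<noteq> {}"
  proof (rule compact_nest)
    show "F n \<noteq> {}" for n using corner by blast
  qed (use dec in \<open>auto simp: F_def\<close>)
  then obtain z where z: "\<And>n. z \<in> F n" by blast
  have FQ: "F n \<subseteq> ?Q" for n using P[of n] by (simp add: F_def P_def)
  have zQ: "z \<in> ?Q" using z FQ by blast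
  obtain K where K: "K > 0" "\<And>v. norm (T v) \<le> norm v * K"
    using bounded_linear.pos_bounded T linear_conv_bounded_linear by blast
  define D where "D = X + Y"
  \<comment> \<open>\<open>2 * (1 + K)\<close> comes from the boundary estimate and the 1 added to
    it from the area estimate, both for a rectangle of side sum \<open>D / 2 ^ n\<close>; the last
    \<open>+ 1\<close> and the factor 2 keep the denominator positive and the final inequality
    strict.\<close>
  define \<eta> where "\<eta> = \<epsilon> / (2 * ((2 * (1 + K) + 1) * D\<^sup>2 + 1))"
  have den: "2 * ((2 * (1 + K) + 1) * D\<^sup>2 + 1) > 0" using K by (intro mult_pos_pos add_nonneg_pos) auto
  have \<eta>: "\<eta> > 0" using c den by (simp add: \<eta>_def \<epsilon>_def)
  have g'lin: "linear (g' z)" using g[OF zQ] has_derivative_linear by blast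
  have "\<forall>\<^sub>F y in at z within ?Q. norm (g y - g z - g' z (y - z)) \<le> \<eta> * norm (y - z)"
    using g[OF zQ] \<eta> unfolding has_derivative_within_alt2 by blast
  then obtain d1 where d1: "d1 > 0"
    "\<And>y. y \<in> ?Q \<Longrightarrow> dist y z < d1 \<Longrightarrow> norm (g y - g z - g' z (y - z)) \<le> \<eta> * norm (y - z)"
    unfolding eventually_at using linear_0[OF g'lin] by (metis diff_self norm_zero mult_zero_right order_refl)
  obtain d2 where d2: "d2 > 0" "\<And>y. y \<in> ?Q \<Longrightarrow> dist y z < d2 \<Longrightarrow> dist (\<phi> y) (\<phi> z) < \<eta>"
    using c\<phi> zQ \<eta> unfolding continuous_on_iff by metis
  have "(\<lambda>n. D * (1/2) ^ n) \<longlonglongrightarrow> D * 0" by (intro tendsto_intros) auto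
  then have "\<forall>\<^sub>F n in sequentially. D * (1/2) ^ n < min d1 d2"
    using d1 d2 by (auto dest: order_tendstoD(2)[of _ _ _ "min d1 d2"])
  then obtain n where n: "D * (1/2) ^ n < min d1 d2" by (auto simp: eventually_sequentially)
  obtain l b r t where u: "u n = ((l, b), (r, t))" by (metis prod.collapse)
  have rt: "r = l + X / 2 ^ n" "t = b + Y / 2 ^ n" and big: "\<epsilon> / 4 ^ n \<le> norm (\<Phi> (l, b) (r, t))"
    using P[of n] by (auto simp: P_def u)
  have ord: "l \<le> r" "b \<le> t" using rt X0 by auto
  have Q': "cbox (l, b) (r, t) \<subseteq> ?Q" "z \<in> cbox (l, b) (r, t)" using FQ[of n] z[of n] by (auto simp: F_def u)
  define s where "s = D / 2 ^ n"
  have s0: "0 \<le> s" using X0 by (simp add: s_def D_def)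
  have s: "s = (r - l) + (t - b)" by (simp add: s_def rt D_def add_divide_distrib)
  have near: "norm (y - z) \<le> s" if "y \<in> cbox (l, b) (r, t)" for y
  proof -
    have "norm (y - z) \<le> norm (fst (y - z)) + norm (snd (y - z))"
      using norm_Pair_le[of "fst (y - z)" "snd (y - z)"] by (simp only: prod.collapse)
    also have "\<dots> \<le> (r - l) + (t - b)"
      using that Q'(2) by (intro add_mono) (auto simp: cbox_Pair_eq mem_Times_iff abs_le_iff)
    finally show ?thesis by (simp add: s)
  qed
  have sd: "s < d1" "s < d2" using n by (auto simp: s_def power_one_over field_simps)
  have cgQ: "continuous_on (cbox (l, b) (r, t)) g" and cfQ: "continuous_on (cbox (l, b) (r, t)) \<phi>"
    using cg c\<phi> Q' continuous_on_subset by blast+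
  have cg': "continuous_on S (\<lambda>y. g z + g' z (y - z))" for S
    by (intro continuous_intros linear_continuous_on_compose[OF _ g'lin])
  have b1: "norm (boundary_integral T (\<lambda>y. g y - (g z + g' z (y - z))) l b r t) \<le> 2 * (1 + K) * (\<eta> * s) * s"
    unfolding s
  proof (rule boundary_integral_bound)
    show "norm (T v) \<le> K * norm v" for v using K(2)[of v] by (simp add: mult.commute)
    show "{l..r} \<times> {b, t} \<subseteq> cbox (l, b) (r, t)" "{l, r} \<times> {b..t} \<subseteq> cbox (l, b) (r, t)"
      using ord by (auto simp: cbox_Pair_eq)
    show "continuous_on (cbox (l, b) (r, t)) (\<lambda>y. g y - (g z + g' z (y - z)))"
      by (intro continuous_on_diff cgQ cg')
    fix y assume y: "y \<in> cbox (l, b) (r, t)"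
    have "norm (g y - (g z + g' z (y - z))) = norm (g y - g z - g' z (y - z))" by (simp add: algebra_simps)
    also have "\<dots> \<le> \<eta> * norm (y - z)"
      by (rule d1(2)) (use y Q' near[OF y] sd in \<open>auto simp: dist_norm\<close>)
    also have "\<dots> \<le> \<eta> * (r - l + (t - b))" using near[OF y] \<eta> by (simp add: s)
    finally show "norm (g y - (g z + g' z (y - z))) \<le> \<eta> * (r - l + (t - b))" .
  qed (use K ord in auto)
  have b2: "norm (integral (cbox (l, b) (r, t)) (\<lambda>y. \<phi> y - \<phi> z)) \<le> \<eta> * ((r - l) * (t - b))"
  proof -
    have "norm (\<phi> y - \<phi> z) \<le> \<eta>" if "y \<in> cbox (l, b) (r, t)" for y
      using d2(2)[of y] that Q' near[OF that] sd by (auto simp: dist_norm intro: less_imp_le)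
    then have "norm (integral (cbox (l, b) (r, t)) (\<lambda>y. \<phi> y - \<phi> z)) \<le> \<eta> * measure lborel (cbox (l, b) (r, t))"
      using \<eta> cfQ by (intro integrable_bound integrable_continuous continuous_intros) auto
    then show ?thesis using ord by (simp add: content_Pair)
  qed
  \<comment> \<open>The affine part of \<open>g\<close> contributes the area times
    \<open>\<phi> z\<close>, which is also the integral of the constant \<open>\<phi> z\<close>; the
    two cancel in \<open>\<Phi>\<close>.\<close>
  have "boundary_integral T g l b r t = boundary_integral T (\<lambda>y. g y - (g z + g' z (y - z))) l b r t
      + ((r - l) * (t - b)) *\<^sub>R \<phi> z"
    using boundary_integral_diff[OF T ord cgQ cg'] boundary_integral_affine[OF T g'lin ord, of "g z" z] \<phi>[OF zQ]
    by simp
  moreover have "integral (cbox (l, b) (r, t)) \<phi> = integral (cbox (l, b) (r, t)) (\<lambda>y. \<phi> y - \<phi> z)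
      + ((r - l) * (t - b)) *\<^sub>R \<phi> z"
    by (subst Henstock_Kurzweil_Integration.integral_diff) (use ord cfQ in \<open>auto intro: integrable_continuous simp: content_Pair\<close>)
  ultimately have "norm (\<Phi> (l, b) (r, t)) \<le> 2 * (1 + K) * (\<eta> * s) * s + \<eta> * ((r - l) * (t - b))"
    using norm_triangle_ineq4[of "boundary_integral T (\<lambda>y. g y - (g z + g' z (y - z))) l b r t"
        "integral (cbox (l, b) (r, t)) (\<lambda>y. \<phi> y - \<phi> z)"] b1 b2
    by (simp add: \<Phi>_def)
  also have "2 * (1 + K) * (\<eta> * s) * s + \<eta> * ((r - l) * (t - b)) \<le> \<eta> * ((2 * (1 + K) + 1) * s\<^sup>2)"
  proof -
    have "(r - l) * (t - b) \<le> s * s"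
      using ord by (intro mult_mono) (auto simp: s)
    then have "\<eta> * ((r - l) * (t - b)) \<le> \<eta> * (s * s)"
      using \<eta> by (intro mult_left_mono) auto
    then show ?thesis by (simp add: algebra_simps power2_eq_square)
  qed
  also have "\<dots> = \<eta> * ((2 * (1 + K) + 1) * D\<^sup>2) / 4 ^ n"
  proof -
    have "((2::real) ^ n)\<^sup>2 = (2\<^sup>2) ^ n" by (simp only: power_mult[symmetric] mult.commute)
    then have "s\<^sup>2 = D\<^sup>2 / 4 ^ n" by (simp add: s_def power_divide)
    then show ?thesis by simp
  qed
  also have "\<dots> < \<epsilon> / 4 ^ n"
  proof -
    have "\<eta> * ((2 * (1 + K) + 1) * D\<^sup>2) < \<eta> * (2 * ((2 * (1 + K) + 1) * D\<^sup>2 + 1))"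
      using \<eta> K by (intro mult_strict_left_mono) (auto simp: add_nonneg_pos)
    also have "\<dots> = \<epsilon>" using den by (simp add: \<eta>_def)
    finally show ?thesis by (simp add: divide_strict_right_mono)
  qed
  finally show False using big by simp
qed

section \<open>Continuously differentiable cutoff functions\<close>

text \<open>\<open>\<psi>'\<close> carries the derivative as data, because the antiholomorphic
  derivative of a cutoff is the density in all later integrals. One continuous derivative makes this
  density continuous.\<close>

definition C1_function ::
  "('x::euclidean_space \<Rightarrow> real) \<Rightarrow> ('x \<Rightarrow> 'x \<Rightarrow> real) \<Rightarrow> bool" where
  "C1_function \<psi> \<psi>' \<longleftrightarrow>
     (\<forall>z. (\<psi> has_derivative \<psi>' z) (at z)) \<and> (\<forall>h. continuous_on UNIV (\<lambda>z. \<psi>' z h))"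

lemma C1_functionD:
  assumes "C1_function \<psi> \<psi>'"
  shows "(\<psi> has_derivative \<psi>' z) (at z)" and "continuous_on S (\<lambda>z. \<psi>' z h)"
    and "continuous_on S \<psi>"
proof -
  show *: "(\<psi> has_derivative \<psi>' z) (at z)" for z using assms by (simp add: C1_function_def)
  show "continuous_on S (\<lambda>z. \<psi>' z h)"
    using assms continuous_on_subset[OF _ subset_UNIV] by (auto simp: C1_function_def)
  show "continuous_on S \<psi>"
    using has_derivative_continuous[OF *] by (intro continuous_at_imp_continuous_on) auto
qed

lemma C1_function_diff:
  assumes "C1_function \<psi> \<psi>'" "C1_function \<eta> \<eta>'"
  shows "C1_function (\<lambda>z. \<psi> z - \<eta> z) (\<lambda>z h. \<psi>' z h - \<eta>' z h)"
  using assms unfolding C1_function_def by (auto intro!: derivative_intros continuous_intros)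

lemma C1_function_add:
  assumes "C1_function \<psi> \<psi>'" "C1_function \<eta> \<eta>'"
  shows "C1_function (\<lambda>z. \<psi> z + \<eta> z) (\<lambda>z h. \<psi>' z h + \<eta>' z h)"
  using assms unfolding C1_function_def by (auto intro!: derivative_intros continuous_intros)

lemma C1_function_sum:
  assumes "\<And>i. i \<in> I \<Longrightarrow> C1_function (\<psi> i) (\<psi>' i)"
  shows "C1_function (\<lambda>z. \<Sum>i\<in>I. \<psi> i z) (\<lambda>z h. \<Sum>i\<in>I. \<psi>' i z h)"
  using assms unfolding C1_function_def by (auto intro!: derivative_intros continuous_intros)

lemma C1_function_derivative_locally_const:
  assumes "C1_function \<psi> \<psi>'" "open G" "z \<in> G" "\<And>y. y \<in> G \<Longrightarrow> \<psi> y = c"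
  shows "\<psi>' z h = 0"
proof -
  have "((\<lambda>_. c) has_derivative \<psi>' z) (at z)"
    by (rule has_derivative_transform_within_open[OF C1_functionD(1)[OF assms(1)] assms(2,3)])
      (use assms(4) in auto)
  then have "\<psi>' z = (\<lambda>h. 0)" using has_derivative_const has_derivative_unique by blast
  then show ?thesis by simp
qed

text \<open>In each of the four sign cases the error of the linear approximation is at most
  \<open>h\<^sup>2\<close>.\<close>

lemma has_real_derivative_pos_part_sq:
  "((\<lambda>t::real. (max 0 t)\<^sup>2) has_real_derivative 2 * max 0 t) (at t)"
proof -
  have *: "\<bar>(max 0 (t + h))\<^sup>2 - (max 0 t)\<^sup>2 - 2 * max 0 t * h\<bar> \<le> h\<^sup>2" for h
  proof (cases "t \<ge> 0"; cases "t + h \<ge> 0")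
    assume "t \<ge> 0" "t + h \<ge> 0" then show ?thesis
      by (simp add: max_def power2_eq_square algebra_simps)
  next
    assume a: "t \<ge> 0" "\<not> t + h \<ge> 0"
    have "\<bar>(max 0 (t + h))\<^sup>2 - (max 0 t)\<^sup>2 - 2 * max 0 t * h\<bar> = \<bar>t * (- t - 2 * h)\<bar>"
      using a by (simp add: max_def power2_eq_square algebra_simps)
    also have "\<dots> = t * (- t - 2 * h)" using a by simp
    also have "\<dots> = h\<^sup>2 - (t + h)\<^sup>2" by (simp add: power2_eq_square algebra_simps)
    finally show ?thesis by simp
  next
    assume a: "\<not> t \<ge> 0" "t + h \<ge> 0"
    then have "(t + h)\<^sup>2 \<le> h\<^sup>2" by (intro power_mono) auto
    with a show ?thesis by (simp add: max_def)
  next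
    assume "\<not> t \<ge> 0" "\<not> t + h \<ge> 0" then show ?thesis by (simp add: max_def)
  qed
  have "((\<lambda>h. ((max 0 (t + h))\<^sup>2 - (max 0 t)\<^sup>2) / h - 2 * max 0 t) \<longlongrightarrow> 0) (at 0)"
  proof (rule Lim_null_comparison)
    show "\<forall>\<^sub>F h in at 0. norm (((max 0 (t + h))\<^sup>2 - (max 0 t)\<^sup>2) / h - 2 * max 0 t) \<le> \<bar>h\<bar>"
    proof (rule eventually_at_topological[THEN iffD2], intro exI[of _ UNIV] conjI ballI impI)
      fix h :: real assume "h \<noteq> 0"
      then have "((max 0 (t + h))\<^sup>2 - (max 0 t)\<^sup>2) / h - 2 * max 0 t =
          ((max 0 (t + h))\<^sup>2 - (max 0 t)\<^sup>2 - 2 * max 0 t * h) / h" by (simp add: field_simps)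
      then have "norm (((max 0 (t + h))\<^sup>2 - (max 0 t)\<^sup>2) / h - 2 * max 0 t) \<le> h\<^sup>2 / \<bar>h\<bar>"
        using *[of h] by (simp add: divide_right_mono)
      also have "h\<^sup>2 / \<bar>h\<bar> = \<bar>h\<bar>"
        using \<open>h \<noteq> 0\<close> by (simp add: divide_eq_eq power2_eq_square)
      finally show "norm (((max 0 (t + h))\<^sup>2 - (max 0 t)\<^sup>2) / h - 2 * max 0 t) \<le> \<bar>h\<bar>" .
    qed auto
    show "((\<lambda>h::real. \<bar>h\<bar>) \<longlongrightarrow> 0) (at 0)" by (rule tendsto_eq_intros refl | simp)+
  qed
  then show ?thesis by (simp add: DERIV_def LIM_zero_iff)
qed

lemma C1_function_pos_part_sq:
  assumes "C1_function \<psi> \<psi>'"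
  shows "C1_function (\<lambda>z. (max 0 (\<psi> z))\<^sup>2) (\<lambda>z h. \<psi>' z h * (2 * max 0 (\<psi> z)))"
  unfolding C1_function_def
proof (intro conjI allI)
  show "((\<lambda>z. (max 0 (\<psi> z))\<^sup>2) has_derivative (\<lambda>h. \<psi>' z h * (2 * max 0 (\<psi> z)))) (at z)" for z
    by (rule DERIV_compose_FDERIV[OF has_real_derivative_pos_part_sq C1_functionD(1)[OF assms]])
  show "continuous_on UNIV (\<lambda>z. \<psi>' z h * (2 * max 0 (\<psi> z)))" for h
    by (intro continuous_intros C1_functionD[OF assms])
qed

lemma C1_function_const_minus_norm_sq:
  "C1_function (\<lambda>z::'x::euclidean_space. \<rho> - (z - c) \<bullet> (z - c)) (\<lambda>z h. - (2 * ((z - c) \<bullet> h)))"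
  unfolding C1_function_def
  by (auto intro!: derivative_eq_intros continuous_intros simp: inner_commute)

lemma C1_function_affine:
  assumes "C1_function \<psi> \<psi>'"
  shows "C1_function (\<lambda>z. a + b * \<psi> z) (\<lambda>z h. b * \<psi>' z h)"
  using assms unfolding C1_function_def by (auto intro!: derivative_eq_intros continuous_intros)

text \<open>Squared positive parts of \<open>r\<^sup>2 - |z - c|\<^sup>2\<close> are C1 bumps.
  Finitely many cover \<open>C\<close>, and their sum \<open>\<phi>\<close> stays above some
  \<open>m > 0\<close> on \<open>C\<close>; capping at the height \<open>m\<close> makes the result
  exactly 1 near \<open>C\<close>.\<close>

lemma C1_cutoff_exists:
  fixes C G :: "'x::euclidean_space set"
  assumes C: "compact C" and G: "open G" and CG: "C \<subseteq> G"
  obtains \<psi> \<psi>' G1 C2 where "C1_function \<psi> \<psi>'" "open G1" "C \<subseteq> G1" "\<And>z. z \<in> G1 \<Longrightarrow> \<psi> z = 1"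
    "compact C2" "C2 \<subseteq> G" "\<And>z. z \<notin> C2 \<Longrightarrow> \<psi> z = 0"
proof -
  have "\<forall>c\<in>C. \<exists>r>0. cball c r \<subseteq> G" using CG G open_contains_cball by blast
  then obtain r where r: "\<And>c. c \<in> C \<Longrightarrow> r c > 0" "\<And>c. c \<in> C \<Longrightarrow> cball c (r c) \<subseteq> G" by metis
  have "C \<subseteq> (\<Union>c\<in>C. ball c (r c))" using r(1) by force
  then obtain I where I: "I \<subseteq> C" "finite I" "C \<subseteq> (\<Union>c\<in>I. ball c (r c))"
    using compactE_image[OF C, of C "\<lambda>c. ball c (r c)"] by blast
  define b where "b c z = (max 0 ((r c)\<^sup>2 - (z - c) \<bullet> (z - c)))\<^sup>2" for c z
  define b' where "b' c z h = - (2 * ((z - c) \<bullet> h)) * (2 * max 0 ((r c)\<^sup>2 - (z - c) \<bullet> (z - c)))" for c z h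
  have b: "C1_function (b c) (b' c)" for c
    unfolding b_def b'_def by (rule C1_function_pos_part_sq[OF C1_function_const_minus_norm_sq])
  have b0: "b c z \<ge> 0" for c z by (simp add: b_def)
  have bz: "b c z = 0" if "z \<notin> cball c (r c)" "c \<in> C" for c z
  proof -
    have "r c < norm (z - c)" using that by (simp add: dist_norm norm_minus_commute)
    then have "(r c)\<^sup>2 \<le> (z - c) \<bullet> (z - c)"
      using r(1)[OF that(2)] by (simp add: dot_square_norm power_mono)
    then show ?thesis by (simp add: b_def)
  qed
  have bp: "b c z > 0" if "z \<in> ball c (r c)" for c z
  proof -
    have "norm (z - c) < r c" using that by (simp add: dist_norm norm_minus_commute)
    then have "(z - c) \<bullet> (z - c) < (r c)\<^sup>2"
      by (simp add: dot_square_norm power_strict_mono)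
    then show ?thesis by (simp add: b_def max_def)
  qed
  define \<phi> \<phi>' where "\<phi> z = (\<Sum>c\<in>I. b c z)" and "\<phi>' z h = (\<Sum>c\<in>I. b' c z h)" for z h
  have \<phi>: "C1_function \<phi> \<phi>'"
    unfolding \<phi>_def \<phi>'_def by (rule C1_function_sum[OF b])
  have \<phi>p: "\<phi> z > 0" if z: "z \<in> C" for z
  proof -
    obtain c where "c \<in> I" "z \<in> ball c (r c)" using z I by blast
    then show ?thesis unfolding \<phi>_def using I(2) b0 bp by (intro sum_pos2[of I c]) auto
  qed
  have \<phi>0: "\<phi> z \<ge> 0" for z by (simp add: \<phi>_def sum_nonneg b0)
  obtain m where m: "m > 0" "\<And>z. z \<in> C \<Longrightarrow> \<phi> z > m"
  proof (cases "C = {}")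
    case True then show ?thesis using that[of 1] by simp
  next
    case False
    obtain z0 where "z0 \<in> C" "\<forall>z\<in>C. \<phi> z0 \<le> \<phi> z"
      using continuous_attains_inf[OF C False C1_functionD(3)[OF \<phi>]] by blast
    then show ?thesis using that[of "\<phi> z0 / 2"] \<phi>p by fastforce
  qed
  \<comment> \<open>This profile is 0 where \<open>\<phi>\<close> vanishes and 1 where
    \<open>\<phi> > m\<close>; squaring the positive part keeps it C1 at the height
    \<open>m\<close>.\<close>
  define \<psi> where "\<psi> z = 1 + (- 1) * (max 0 (1 + (- 1 / m) * \<phi> z))\<^sup>2" for z
  define \<psi>' where "\<psi>' z h = (- 1) * ((- 1 / m) * \<phi>' z h * (2 * max 0 (1 + (- 1 / m) * \<phi> z)))" for z h
  have \<psi>: "C1_function \<psi> \<psi>'"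
    unfolding \<psi>_def \<psi>'_def
    by (rule C1_function_affine[OF C1_function_pos_part_sq[OF C1_function_affine[OF \<phi>]]])
  show ?thesis
  proof (rule that[OF \<psi>])
    have "open (\<phi> -` {m<..})"
      using C1_functionD(3)[OF \<phi>, of UNIV] by (intro open_vimage) auto
    then show "open {z. \<phi> z > m}" by (simp add: vimage_def)
    show "C \<subseteq> {z. \<phi> z > m}" using m by auto
    show "\<psi> z = 1" if "z \<in> {z. \<phi> z > m}" for z
      using that m(1) by (simp add: \<psi>_def max_def field_simps)
    show "compact (\<Union>c\<in>I. cball c (r c))" using I(2) by auto
    show "(\<Union>c\<in>I. cball c (r c)) \<subseteq> G" using I(1) r(2) by blast
    show "\<psi> z = 0" if "z \<notin> (\<Union>c\<in>I. cball c (r c))" for z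
    proof -
      have "\<phi> z = 0" unfolding \<phi>_def using that I(1) by (intro sum.neutral ballI bz) auto
      then show ?thesis by (simp add: \<psi>_def)
    qed
  qed
qed

section \<open>The Cauchy kernel of an elliptic element\<close>

locale elliptic_plane =
  fixes a :: "'a::{euclidean_space,real_algebra_1}"
  assumes elliptic: "elliptic a"
begin

lemma central_a: "central a"
  using elliptic by (simp add: elliptic_def)

definition kap :: "real \<times> real \<Rightarrow> 'a" where
  "kap z = fst z *\<^sub>R 1 + snd z *\<^sub>R a"

text \<open>The Cauchy kernel. Its value at the origin is unspecified; in the area integrals below
  it is multiplied by a density that vanishes near the origin.\<close>

definition ikap :: "real \<times> real \<Rightarrow> 'a" where
  "ikap z = (SOME d. central d \<and> kap z * d = 1)"

lemma central_kap: "central (kap z)"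
  unfolding kap_def by (intro central_intros central_a central_1)

lemma linear_kap: "linear kap"
  by (auto intro!: linearI simp: kap_def algebra_simps)

lemmas kap_add = linear_add[OF linear_kap]
  and kap_diff = linear_diff[OF linear_kap]
  and kap_scaleR = linear_cmul[OF linear_kap]

lemma kap_basis [simp]: "kap (1, 0) = 1" "kap (0, 1) = a"
  by (simp_all add: kap_def)

text \<open>For \<open>snd z\<close> nonzero, a nonzero vector killed by \<open>kap z\<close> would
  be an eigenvector of \<open>a\<close> for the real number \<open>- fst z / snd z\<close>.\<close>

lemma kap_mult_eq_0:
  assumes "kap z * w = 0" "z \<noteq> 0"
  shows "w = 0"
proof (cases "snd z = 0")
  case True
  then have "fst z *\<^sub>R w = 0" "fst z \<noteq> 0" using assms by (auto simp: kap_def prod_eq_iff)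
  then show ?thesis by simp
next
  case False
  have "snd z *\<^sub>R (a * w) = snd z *\<^sub>R ((- fst z / snd z) *\<^sub>R w)"
    using assms(1) False by (simp add: kap_def algebra_simps add_eq_0_iff)
  then have "a * w = (- fst z / snd z) *\<^sub>R w" using False by (simp only: scaleR_cancel_left) simp
  then show ?thesis using elliptic unfolding elliptic_def by blast
qed

lemma ikap:
  assumes "z \<noteq> 0"
  shows central_ikap: "central (ikap z)" and kap_ikap: "kap z * ikap z = 1"
    and ikap_kap: "ikap z * kap z = 1"
proof -
  have "\<exists>d. central d \<and> kap z * d = 1"
    using central_inverse_ex[OF central_kap] kap_mult_eq_0 assms by metis
  then have *: "central (ikap z) \<and> kap z * ikap z = 1" unfolding ikap_def by (rule someI_ex)
  then show "central (ikap z)" "kap z * ikap z = 1" by auto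
  then show "ikap z * kap z = 1" by (simp add: centralD[OF central_kap])
qed

lemma kap_ikap_mult: "z \<noteq> 0 \<Longrightarrow> kap z * (ikap z * w) = w"
  by (simp add: kap_ikap flip: mult.assoc)

lemma ikap_kap_mult: "z \<noteq> 0 \<Longrightarrow> ikap z * (kap z * w) = w"
  by (simp add: ikap_kap flip: mult.assoc)

lemma ikap_uminus:
  assumes "z \<noteq> 0" shows "ikap (- z) = - ikap z"
proof -
  have "kap (- z) = - kap z" using kap_scaleR[of "-1" z] by simp
  then have "kap (- z) * (- ikap z) = 1" using kap_ikap[OF assms] by simp
  then show ?thesis using ikap_kap_mult[of "- z" "- ikap z"] assms by simp
qed

lemma continuous_on_kap [continuous_intros]:
  "continuous_on S f \<Longrightarrow> continuous_on S (\<lambda>x. kap (f x))"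
  unfolding kap_def by (intro continuous_intros)

text \<open>By homogeneity in both arguments it suffices to minimise over a product of two unit
  spheres, where \<open>kap z * w\<close> never vanishes.\<close>

lemma kap_lower_bound:
  obtains m where "m > 0" "\<And>z w. m * norm z * norm w \<le> norm (kap z * w)"
proof -
  let ?S = "sphere (0::real \<times> real) 1 \<times> sphere (0::'a) 1"
  have "continuous_on ?S (\<lambda>u. norm (kap (fst u) * snd u))"
    by (intro continuous_intros mult.continuous_on)
  moreover have "compact ?S" by (intro compact_Times compact_sphere)
  moreover have "?S \<noteq> {}"
  proof -
    have "((1, 0), (1 /\<^sub>R norm (1::'a))) \<in> ?S" by simp
    then show ?thesis by blast
  qed
  ultimately obtain u where u: "u \<in> ?S" "\<And>v. v \<in> ?S \<Longrightarrow> norm (kap (fst u) * snd u) \<le> norm (kap (fst v) * snd v)"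
    using continuous_attains_inf by (metis (no_types, lifting))
  define m where "m = norm (kap (fst u) * snd u)"
  have "fst u \<noteq> 0" "snd u \<noteq> 0" using u(1) by auto
  then have m: "m > 0"
    unfolding m_def zero_less_norm_iff using kap_mult_eq_0[of "fst u" "snd u"] by blast
  have "m * norm z * norm w \<le> norm (kap z * w)" for z w
  proof (cases "z = 0 \<or> w = 0")
    case True then show ?thesis by auto
  next
    case False
    then have "(z /\<^sub>R norm z, w /\<^sub>R norm w) \<in> ?S" by (simp del: scaleR_Pair)
    from u(2)[OF this] have "m \<le> norm (kap (z /\<^sub>R norm z) * (w /\<^sub>R norm w))" by (simp add: m_def)
    also have "\<dots> = norm (kap z * w) / (norm z * norm w)"
      by (simp only: kap_scaleR mult_scaleR_left mult_scaleR_right norm_scaleR) (simp add: field_simps)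
    finally show ?thesis using False by (simp add: field_simps)
  qed
  with m that show ?thesis by blast
qed

lemma ikap_bound:
  obtains M where "M > 0" "\<And>z w. z \<noteq> 0 \<Longrightarrow> norm (ikap z * w) \<le> M * norm w / norm z"
proof -
  obtain m where m: "m > 0" "\<And>z w. m * norm z * norm w \<le> norm (kap z * w)"
    using kap_lower_bound by blast
  have "norm (ikap z * w) \<le> (1 / m) * norm w / norm z" if "z \<noteq> 0" for z w
    using m(2)[of z "ikap z * w"] m(1) that by (simp add: kap_ikap_mult field_simps)
  then show ?thesis using that[of "1 / m"] m(1) by simp
qed

text \<open>The resolvent identity; it yields both the continuity and the derivative of the
  kernel.\<close>

lemma ikap_diff:
  assumes "z \<noteq> 0" "y \<noteq> 0"
  shows "ikap y - ikap z = - (ikap y * (ikap z * kap (y - z)))"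
proof -
  have "ikap z * kap y * ikap y = ikap z" "ikap y * (ikap z * kap z) = ikap y"
    using assms by (simp_all add: kap_ikap ikap_kap mult.assoc)
  moreover have "ikap z * kap y * ikap y = ikap y * (ikap z * kap y)"
    using assms central_ikap centralD by metis
  ultimately show ?thesis by (simp add: kap_diff right_diff_distrib)
qed

lemma isCont_ikap:
  assumes "z \<noteq> 0" shows "isCont ikap z"
proof -
  obtain M where M: "M > 0" "\<And>z w. z \<noteq> 0 \<Longrightarrow> norm (ikap z * w) \<le> M * norm w / norm z"
    using ikap_bound by blast
  have "((\<lambda>y. ikap y - ikap z) \<longlongrightarrow> 0) (at z)"
  proof (rule Lim_null_comparison)
    show "\<forall>\<^sub>F y in at z. norm (ikap y - ikap z) \<le> M * norm (ikap z * kap (y - z)) / norm y"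
    proof (rule eventually_mono[OF eventually_at_ball[of "norm z" z UNIV]])
      fix y assume "y \<in> ball z (norm z) \<and> y \<in> UNIV"
      then have "y \<noteq> 0" by auto
      then show "norm (ikap y - ikap z) \<le> M * norm (ikap z * kap (y - z)) / norm y"
        using ikap_diff[OF assms] M(2) by simp
    qed (use assms in auto)
    have "isCont (\<lambda>y. M * norm (ikap z * kap (y - z)) / norm y) z"
      unfolding kap_def using assms by (intro continuous_intros mult.continuous) auto
    then have "((\<lambda>y. M * norm (ikap z * kap (y - z)) / norm y) \<longlongrightarrow>
        M * norm (ikap z * kap (z - z)) / norm z) (at z)" by (simp add: isCont_def)
    then show "((\<lambda>y. M * norm (ikap z * kap (y - z)) / norm y) \<longlongrightarrow> 0) (at z)"
      by (simp add: kap_def)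
  qed
  then show ?thesis by (simp add: isCont_def LIM_zero_iff)
qed

lemma continuous_on_ikap [continuous_intros]:
  assumes "continuous_on S f" "\<And>x. x \<in> S \<Longrightarrow> f x \<noteq> 0"
  shows "continuous_on S (\<lambda>x. ikap (f x))"
proof (rule continuous_on_compose2[OF _ assms(1)])
  show "continuous_on (- {0}) ikap"
    by (intro continuous_at_imp_continuous_on ballI isCont_ikap) simp
qed (use assms(2) in auto)

text \<open>By the resolvent identity the error of the linear approximation is
  \<open>(ikap z - ikap y) * (ikap z * kap (y - z))\<close>, a factor tending to 0 times one of the
  order of \<open>y - z\<close>.\<close>

lemma has_derivative_ikap:
  assumes z: "z \<noteq> 0"
  shows "(ikap has_derivative (\<lambda>h. - (ikap z * (ikap z * kap h)))) (at z)"
  unfolding has_derivative_def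
proof
  show "bounded_linear (\<lambda>h. - (ikap z * (ikap z * kap h)))"
    unfolding linear_conv_bounded_linear[symmetric]
    by (intro linearI) (simp_all add: kap_add kap_scaleR distrib_left)
  obtain C where C: "C > 0" "\<And>x y. norm (x * y) \<le> norm x * norm (y :: 'a) * C"
    using mult.pos_bounded by blast
  obtain K where K: "K > 0" "\<And>h. norm (kap h) \<le> norm h * K"
    using linear_kap bounded_linear.pos_bounded linear_conv_bounded_linear by blast
  define c where "c = C * C * K * norm (ikap z)"
  have "((\<lambda>y. norm (ikap z - ikap y) * c) \<longlongrightarrow> norm (ikap z - ikap z) * c) (at z)"
    using isCont_ikap[OF z] unfolding isCont_def by (intro tendsto_intros)
  then have lim: "((\<lambda>y. norm (ikap z - ikap y) * c) \<longlongrightarrow> 0) (at z)" by simp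
  show "((\<lambda>y. ((ikap y - ikap (Lim (at z) (\<lambda>x. x))) - - (ikap z * (ikap z * kap (y - Lim (at z) (\<lambda>x. x))))) /\<^sub>R
      norm (y - Lim (at z) (\<lambda>x. x))) \<longlongrightarrow> 0) (at z)"
    unfolding Lim_ident_at[OF trivial_limit_at]
  proof (rule Lim_null_comparison[OF _ lim])
    show "\<forall>\<^sub>F y in at z. norm (((ikap y - ikap z) - - (ikap z * (ikap z * kap (y - z)))) /\<^sub>R norm (y - z))
        \<le> norm (ikap z - ikap y) * c"
    proof (rule eventually_at_ball'[of "norm z" z UNIV, THEN eventually_mono])
      fix y assume "y \<in> ball z (norm z) \<and> y \<noteq> z \<and> y \<in> UNIV"
      then have y: "y \<noteq> 0" "y \<noteq> z" by auto
      have "(ikap y - ikap z) - - (ikap z * (ikap z * kap (y - z))) = (ikap z - ikap y) * (ikap z * kap (y - z))"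
        using ikap_diff[OF z y(1)] by (simp add: algebra_simps)
      also have "norm \<dots> \<le> norm (ikap z - ikap y) * (norm (ikap z) * (norm (y - z) * K) * C) * C"
        by (intro order_trans[OF C(2)] mult_right_mono mult_left_mono K(2)) (use C(1) in auto)
      also have "\<dots> = norm (ikap z - ikap y) * c * norm (y - z)" by (simp add: c_def)
      finally show "norm (((ikap y - ikap z) - - (ikap z * (ikap z * kap (y - z)))) /\<^sub>R norm (y - z))
          \<le> norm (ikap z - ikap y) * c"
        unfolding norm_scaleR using y(2)
        by (simp add: pos_divide_le_eq flip: divide_inverse_commute)
    qed (use z in auto)
  qed
qed

subsection \<open>Solutions in the plane\<close>

text \<open>The counterpart of complex differentiability at a point: linearity and the equation give
  \<open>u' h = kap h * u' (1, 0)\<close>. As in Goursat's theorem, no continuity of the derivative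
  is built in.\<close>

definition planar :: "(real \<times> real \<Rightarrow> 'a) \<Rightarrow> real \<times> real \<Rightarrow> bool" where
  "planar u z \<longleftrightarrow> (\<exists>u'. (u has_derivative u') (at z) \<and> u' (0, 1) = a * u' (1, 0))"

lemma planar_isCont: "planar u z \<Longrightarrow> isCont u z"
  using has_derivative_continuous by (auto simp: planar_def)

lemma planar_const: "planar (\<lambda>_. c) z"
  unfolding planar_def by (rule exI[of _ "\<lambda>_. 0"]) simp

lemma planar_kap: "planar kap z"
  unfolding planar_def
  by (rule exI[of _ kap])
    (use linear_kap linear_imp_has_derivative in auto)

lemma planar_ikap: "z \<noteq> 0 \<Longrightarrow> planar ikap z"
  unfolding planar_def
  by (rule exI, rule conjI, rule has_derivative_ikap)
    (auto simp: central_left_commute[OF central_a] centralD[OF central_a] mult.assoc)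

lemma planar_diff: "planar u z \<Longrightarrow> planar v z \<Longrightarrow> planar (\<lambda>z. u z - v z) z"
  unfolding planar_def by (fastforce intro!: has_derivative_diff simp: right_diff_distrib)

text \<open>The Leibniz rule preserves the equation because \<open>a\<close> is central and can be
  moved past \<open>u z\<close>.\<close>

lemma planar_mult:
  assumes "planar u z" "planar v z"
  shows "planar (\<lambda>z. u z * v z) z"
proof -
  obtain u' v' where u: "(u has_derivative u') (at z)" "u' (0, 1) = a * u' (1, 0)"
    and v: "(v has_derivative v') (at z)" "v' (0, 1) = a * v' (1, 0)"
    using assms by (auto simp: planar_def)
  show ?thesis
    unfolding planar_def
    by (rule exI, rule conjI, rule mult.FDERIV[OF u(1) v(1)])
      (simp add: u v central_left_commute[OF central_a] algebra_simps)
qed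

lemma planar_power: "planar u z \<Longrightarrow> planar (\<lambda>z. u z ^ n) z"
  by (induction n) (auto intro: planar_const planar_mult)

lemma planar_shift:
  assumes "planar u (w + z)"
  shows "planar (\<lambda>z. u (w + z)) z"
proof -
  obtain u' where u: "(u has_derivative u') (at (w + z))" "u' (0, 1) = a * u' (1, 0)"
    using assms by (auto simp: planar_def)
  have "((\<lambda>z. u (w + z)) has_derivative (\<lambda>h. u' h)) (at z)"
    using has_derivative_compose[of "\<lambda>z. w + z" "\<lambda>h. h" z UNIV u u'] u(1)
      has_derivative_add[OF has_derivative_const[of w] has_derivative_ident[of "at z"]] by simp
  with u(2) show ?thesis by (auto simp: planar_def)
qed

lemma planar_transform:
  assumes "planar u z" "open S" "z \<in> S" "\<And>y. y \<in> S \<Longrightarrow> u y = v y"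
  shows "planar v z"
  using assms unfolding planar_def by (blast intro: has_derivative_transform_within_open)

end

lemma integral_UNIV_eq_cbox:
  fixes \<phi> :: "'n::euclidean_space \<Rightarrow> 'b::euclidean_space"
  assumes "\<And>z. z \<notin> S \<Longrightarrow> \<phi> z = 0"
  shows "integral UNIV \<phi> = integral S \<phi>"
proof -
  have "(\<lambda>z. if z \<in> S then \<phi> z else 0) = \<phi>" using assms by auto
  then show ?thesis using integral_restrict_UNIV[of S \<phi>] by simp
qed

lemma compact_subset_square:
  fixes C :: "(real \<times> real) set"
  assumes "compact C"
  obtains R where "R > 0" "\<And>x y. (x, y) \<in> C \<Longrightarrow> \<bar>x\<bar> < R \<and> \<bar>y\<bar> < R"
proof -
  obtain B where B: "B > 0" "\<And>z. z \<in> C \<Longrightarrow> norm z \<le> B"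
    using compact_imp_bounded[OF assms] bounded_pos by metis
  have "\<bar>x\<bar> < B + 1 \<and> \<bar>y\<bar> < B + 1" if "(x, y) \<in> C" for x y
  proof -
    have "\<bar>x\<bar> \<le> norm (x, y)" "\<bar>y\<bar> \<le> norm (x, y)"
      using norm_fst_le[of x y] norm_snd_le[of y x] by auto
    then show ?thesis using B(2)[OF that] by auto
  qed
  then show ?thesis using that[of "B + 1"] B(1) by simp
qed

text \<open>The large square is cut into the central square, where \<open>\<phi>\<close> vanishes,
  and four rectangles avoiding the origin. The outer edges contribute nothing, so only the inner
  boundary remains, with the opposite sign.\<close>

lemma integral_square_annulus:
  fixes T :: "'b::euclidean_space \<Rightarrow> 'b" and g \<phi> :: "real \<times> real \<Rightarrow> 'b"
  assumes T: "linear T" and \<delta>: "0 < \<delta>" "\<delta> < R"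
    and g: "\<And>z. z \<noteq> 0 \<Longrightarrow> (g has_derivative g' z) (at z)"
    and \<phi>: "\<And>z. z \<noteq> 0 \<Longrightarrow> \<phi> z = g' z (0, 1) - T (g' z (1, 0))"
    and c\<phi>: "continuous_on UNIV \<phi>"
    and g0: "\<And>x y. R \<le> \<bar>x\<bar> \<or> R \<le> \<bar>y\<bar> \<Longrightarrow> g (x, y) = 0"
    and \<phi>0: "\<And>z. z \<in> cbox (- \<delta>, - \<delta>) (\<delta>, \<delta>) \<Longrightarrow> \<phi> z = 0"
  shows "integral (cbox (- R, - R) (R, R)) \<phi> = - boundary_integral T g (- \<delta>) (- \<delta>) \<delta> \<delta>"
proof -
  have c: "continuous_on S \<phi>" for S using c\<phi> continuous_on_subset by blast
  have st: "integral (cbox (x0, y0) (x1, y1)) \<phi> = boundary_integral T g x0 y0 x1 y1"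
    if "x0 \<le> x1" "y0 \<le> y1" "0 \<notin> {x0..x1} \<times> {y0..y1}" for x0 y0 x1 y1
  proof (rule stokes_rectangle[OF T that(1,2) _ _ c])
    fix z assume "z \<in> cbox (x0, y0) (x1, y1)"
    then have "z \<in> {x0..x1} \<times> {y0..y1}" by (simp add: cbox_Pair_eq)
    then have "z \<noteq> 0" using that(3) by metis
    then show "(g has_derivative g' z) (at z within cbox (x0, y0) (x1, y1))"
      by (rule has_derivative_at_withinI[OF g])
    show "\<phi> z = g' z (0, 1) - T (g' z (1, 0))"
      by (rule \<phi>) fact
  qed
  have cg: "continuous_on (- {0}) g"
    using has_derivative_continuous[OF g] by (auto intro!: continuous_at_imp_continuous_on)
  have ig: "(\<lambda>y. g (x, y)) integrable_on {l..r}" if "x \<noteq> 0" for x l r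
    by (intro integrable_continuous_interval continuous_on_compose2[OF cg] continuous_intros)
      (use that in \<open>auto simp: prod_eq_iff\<close>)
  have sp: "integral {- R..R} (\<lambda>y. g (x, y)) = integral {- R..- \<delta>} (\<lambda>y. g (x, y)) +
      integral {- \<delta>..\<delta>} (\<lambda>y. g (x, y)) + integral {\<delta>..R} (\<lambda>y. g (x, y))" if "x \<noteq> 0" for x
  proof -
    note comb = Henstock_Kurzweil_Integration.integral_combine[OF _ _ ig[OF that], symmetric]
    show ?thesis using comb[of "- R" "- \<delta>" R] comb[of "- \<delta>" \<delta> R] \<delta> by (simp add: add.assoc)
  qed
  have z: "integral {l..r} (\<lambda>x. g (x, R)) = 0" "integral {l..r} (\<lambda>x. g (x, - R)) = 0"
    "integral {l..r} (\<lambda>x. g (R, x)) = 0" "integral {l..r} (\<lambda>x. g (- R, x)) = 0" for l r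
  proof -
    have "g (x, R) = 0" "g (x, - R) = 0" "g (R, x) = 0" "g (- R, x) = 0" for x
      by (auto intro!: g0)
    then show "integral {l..r} (\<lambda>x. g (x, R)) = 0" "integral {l..r} (\<lambda>x. g (x, - R)) = 0"
      "integral {l..r} (\<lambda>x. g (R, x)) = 0" "integral {l..r} (\<lambda>x. g (- R, x)) = 0" by simp_all
  qed
  have "integral (cbox (- R, - R) (R, R)) \<phi> = integral (cbox (- R, - R) (- \<delta>, R)) \<phi> +
      integral (cbox (- \<delta>, - R) (\<delta>, R)) \<phi> + integral (cbox (\<delta>, - R) (R, R)) \<phi>"
    using integral_split_fst[OF c, of "- R" "- \<delta>" R "- R" R] integral_split_fst[OF c, of "- \<delta>" \<delta> R "- R" R] \<delta>
    by simp
  also have "integral (cbox (- \<delta>, - R) (\<delta>, R)) \<phi> = integral (cbox (- \<delta>, - R) (\<delta>, - \<delta>)) \<phi> +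
      integral (cbox (- \<delta>, - \<delta>) (\<delta>, \<delta>)) \<phi> + integral (cbox (- \<delta>, \<delta>) (\<delta>, R)) \<phi>"
    using integral_split_snd[OF c, of "- R" "- \<delta>" R "- \<delta>" \<delta>] integral_split_snd[OF c, of "- \<delta>" \<delta> R "- \<delta>" \<delta>] \<delta>
    by simp
  also have "integral (cbox (- \<delta>, - \<delta>) (\<delta>, \<delta>)) \<phi> = 0"
    using integral_cong[of "cbox (- \<delta>, - \<delta>) (\<delta>, \<delta>)" \<phi> "\<lambda>_. 0"] \<phi>0 by simp
  finally show ?thesis
    using \<delta> by (simp add: st boundary_integral_def z sp linear_add[OF T] linear_diff[OF T] linear_neg[OF T] zero_prod_def)
qed

context elliptic_plane
begin

text \<open>The Cauchy-Riemann operator, \<open>y\<close>-derivative minus \<open>a\<close> times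
  \<open>x\<close>-derivative, applied to the scalar function with derivative
  \<open>\<psi>'\<close>.\<close>

definition dbar :: "(real \<times> real \<Rightarrow> real \<times> real \<Rightarrow> real) \<Rightarrow> real \<times> real \<Rightarrow> 'a" where
  "dbar \<psi>' z = \<psi>' z (0, 1) *\<^sub>R 1 - \<psi>' z (1, 0) *\<^sub>R a"

lemma central_dbar: "central (dbar \<psi>' z)"
  unfolding dbar_def by (intro central_intros central_a central_1)

lemma continuous_on_dbar: "C1_function \<psi> \<psi>' \<Longrightarrow> continuous_on S (dbar \<psi>')"
  unfolding dbar_def by (intro continuous_intros C1_functionD)

lemma dbar_locally_const:
  assumes "C1_function \<psi> \<psi>'" "open G" "z \<in> G" "\<And>y. y \<in> G \<Longrightarrow> \<psi> y = c"
  shows "dbar \<psi>' z = 0"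
  using C1_function_derivative_locally_const[OF assms] by (simp add: dbar_def)

text \<open>\<open>u\<close> may be singular at the origin and arbitrary off \<open>C\<close>: near
  such points \<open>\<psi>\<close> is constant, so the density vanishes there.\<close>

lemma isCont_dbar_mult:
  assumes \<psi>: "C1_function \<psi> \<psi>'" and C: "compact C" "\<And>z. z \<notin> C \<Longrightarrow> \<psi> z = 0"
    and \<delta>: "\<delta> > 0" "\<And>z. z \<in> ball 0 \<delta> \<Longrightarrow> \<psi> z = c"
    and u: "\<And>z. z \<in> C \<Longrightarrow> z \<noteq> 0 \<Longrightarrow> isCont u z"
  shows "isCont (\<lambda>z. dbar \<psi>' z * u z) z"
proof -
  have loc: "isCont (\<lambda>z. dbar \<psi>' z * u z) z"
    if G: "open G" "z \<in> G" "\<And>y. y \<in> G \<Longrightarrow> \<psi> y = b" for G b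
  proof -
    have "dbar \<psi>' y * u y = 0" if "y \<in> G" for y
      using dbar_locally_const[OF \<psi> G(1) that G(3)] by simp
    then have "\<forall>\<^sub>F y in nhds z. dbar \<psi>' y * u y = 0"
      unfolding eventually_nhds using G(1,2) by blast
    then show ?thesis by (subst isCont_cong[where g = "\<lambda>_. 0"]) auto
  qed
  consider "z \<notin> C" | "z = 0" | "z \<in> C" "z \<noteq> 0" by blast
  then show ?thesis
  proof cases
    case 1 then show ?thesis by (intro loc[of "- C"]) (use C in \<open>auto simp: compact_imp_closed\<close>)
  next
    case 2 then show ?thesis by (intro loc[of "ball 0 \<delta>"]) (use \<delta> in auto)
  next
    case 3
    have "isCont (dbar \<psi>') z"
      using continuous_on_dbar[OF \<psi>, of UNIV] continuous_on_eq_continuous_at[OF open_UNIV] by blast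
    then show ?thesis using u[OF 3] by (rule mult.continuous)
  qed
qed

text \<open>As \<open>u\<close> solves the equation, the Cauchy-Riemann operator maps
  \<open>\<psi> u\<close> to \<open>dbar \<psi>' * u\<close>. Stokes' formula outside a small
  square, on which \<open>\<psi>\<close> is constant, leaves only the boundary of that
  square.\<close>

lemma integral_dbar_eq_boundary_integral:
  assumes \<psi>: "C1_function \<psi> \<psi>'" and C: "compact C" "\<And>z. z \<notin> C \<Longrightarrow> \<psi> z = 0"
    and \<delta>: "\<delta> > 0" "\<And>z. z \<in> ball 0 \<delta> \<Longrightarrow> \<psi> z = c"
    and u: "\<And>z. z \<in> C \<Longrightarrow> z \<noteq> 0 \<Longrightarrow> planar u z"
    and d: "0 < d" "2 * d < \<delta>"
  shows "integral UNIV (\<lambda>z. dbar \<psi>' z * u z) =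
    - boundary_integral ((*) a) (\<lambda>z. \<psi> z *\<^sub>R u z) (- d) (- d) d d"
proof -
  define u' where "u' z = (SOME D. (u has_derivative D) (at z) \<and> D (0, 1) = a * D (1, 0))" for z
  have u': "(u has_derivative u' z) (at z)" "u' z (0, 1) = a * u' z (1, 0)" if "z \<in> C" "z \<noteq> 0" for z
    using someI_ex[OF u[OF that, unfolded planar_def]] by (auto simp: u'_def)
  define g where "g z = \<psi> z *\<^sub>R u z" for z
  \<comment> \<open>Off \<open>C\<close> nothing is known about \<open>u\<close>, but the product is
    locally 0 there, so its derivative is set to 0.\<close>
  define g' where "g' z = (if z \<in> C then (\<lambda>h. \<psi> z *\<^sub>R u' z h + \<psi>' z h *\<^sub>R u z) else (\<lambda>_. 0))" for z
  define \<phi> where "\<phi> z = dbar \<psi>' z * u z" for z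
  have oC: "open (- C)" using C(1) compact_imp_closed by auto
  have dbar0: "dbar \<psi>' z = 0" if "z \<notin> C" for z
    by (rule dbar_locally_const[OF \<psi> oC]) (use that C in auto)
  obtain R0 where R0: "R0 > 0" "\<And>x y. (x, y) \<in> C \<Longrightarrow> \<bar>x\<bar> < R0 \<and> \<bar>y\<bar> < R0"
    using compact_subset_square[OF C(1)] by blast
  define R where "R = max R0 (2 * d)"
  have R: "d < R" "\<And>x y. (x, y) \<in> C \<Longrightarrow> \<bar>x\<bar> < R \<and> \<bar>y\<bar> < R"
    using R0 d by (force simp: R_def)+
  have lin: "linear ((*) a)" by (simp add: mult.bounded_linear_right bounded_linear.linear)
  have "integral (cbox (- R, - R) (R, R)) \<phi> = - boundary_integral ((*) a) g (- d) (- d) d d"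
  proof (rule integral_square_annulus[OF lin d(1) R(1), where g' = g'])
    fix z :: "real \<times> real" assume z: "z \<noteq> 0"
    show "(g has_derivative g' z) (at z)"
    proof (cases "z \<in> C")
      case True
      show ?thesis
        unfolding g_def[abs_def] g'_def if_P[OF True]
        by (rule has_derivative_scaleR[OF C1_functionD(1)[OF \<psi>] u'(1)[OF True z]])
    next
      case False
      have "((\<lambda>_. 0) has_derivative (\<lambda>_. 0)) (at z)" by simp
      then show ?thesis
        unfolding g'_def if_not_P[OF False]
        by (rule has_derivative_transform_within_open[OF _ oC]) (use False C in \<open>auto simp: g_def\<close>)
    qed
    show "\<phi> z = g' z (0, 1) - a * g' z (1, 0)"
    proof (cases "z \<in> C")
      case True then show ?thesis using u'(2)[OF True z]
        by (simp add: \<phi>_def g'_def dbar_def algebra_simps)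
    next
      case False then show ?thesis using dbar0 by (simp add: \<phi>_def g'_def)
    qed
  next
    show "continuous_on UNIV \<phi>"
      unfolding \<phi>_def
      by (intro continuous_at_imp_continuous_on ballI isCont_dbar_mult[OF \<psi> C \<delta>] planar_isCont u)
    show "g (x, y) = 0" if "R \<le> \<bar>x\<bar> \<or> R \<le> \<bar>y\<bar>" for x y
      using R(2)[of x y] that C(2)[of "(x, y)"] by (force simp: g_def)
    fix z :: "real \<times> real" assume z: "z \<in> cbox (- d, - d) (d, d)"
    have "norm z \<le> norm (fst z) + norm (snd z)" using norm_Pair_le[of "fst z" "snd z"] by simp
    also have "\<dots> \<le> d + d" using z by (intro add_mono) (auto simp: cbox_Pair_eq mem_Times_iff)
    finally have "z \<in> ball 0 \<delta>" using d by simp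
    then have "dbar \<psi>' z = 0" by (rule dbar_locally_const[OF \<psi> open_ball _ \<delta>(2)])
    then show "\<phi> z = 0" by (simp add: \<phi>_def)
  qed
  moreover have "integral UNIV \<phi> = integral (cbox (- R, - R) (R, R)) \<phi>"
  proof (rule integral_UNIV_eq_cbox)
    fix z assume "z \<notin> cbox (- R, - R) (R, R)"
    then have "z \<notin> C" using R(2)[of "fst z" "snd z"] by (auto simp: cbox_Pair_eq mem_Times_iff)
    then show "\<phi> z = 0" by (simp add: \<phi>_def dbar0)
  qed
  ultimately show ?thesis unfolding \<phi>_def g_def by simp
qed

text \<open>Cauchy's theorem with a removable singularity: the boundary of a square of side
  \<open>2 * d\<close> has length proportional to \<open>d\<close>, while the integrand on it is
  small compared to \<open>1 / d\<close>.\<close>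

lemma integral_dbar_eq_0:
  assumes \<psi>: "C1_function \<psi> \<psi>'" and C: "compact C" "\<And>z. z \<notin> C \<Longrightarrow> \<psi> z = 0"
    and \<delta>: "\<delta> > 0" "\<And>z. z \<in> ball 0 \<delta> \<Longrightarrow> \<psi> z = c"
    and u: "\<And>z. z \<in> C \<Longrightarrow> z \<noteq> 0 \<Longrightarrow> planar u z"
    and lim: "((\<lambda>z. norm z *\<^sub>R (\<psi> z *\<^sub>R u z)) \<longlongrightarrow> 0) (at 0)"
  shows "integral UNIV (\<lambda>z. dbar \<psi>' z * u z) = 0"
proof -
  define I where "I = integral UNIV (\<lambda>z. dbar \<psi>' z * u z)"
  obtain K where K: "K > 0" "\<And>v. norm (a * v) \<le> norm v * K"
    using mult.bounded_linear_right bounded_linear.pos_bounded by blast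
  have "norm I \<le> 0 + \<epsilon>" if \<epsilon>: "\<epsilon> > 0" for \<epsilon>
  proof -
    \<comment> \<open>The boundary estimate with bound \<open>\<eta> / d\<close> and side sum
      \<open>4 * d\<close> gives \<open>8 * (1 + K) * \<eta>\<close>.\<close>
    define \<eta> where "\<eta> = \<epsilon> / (8 * (1 + K))"
    have \<eta>: "\<eta> > 0" using \<epsilon> K by (simp add: \<eta>_def)
    obtain d0 where d0: "d0 > 0" "\<And>z. z \<noteq> 0 \<Longrightarrow> norm z < d0 \<Longrightarrow> norm (norm z *\<^sub>R (\<psi> z *\<^sub>R u z)) < \<eta>"
      using lim \<eta> unfolding Lim_at by (metis dist_0_norm dist_commute zero_less_dist_iff)
    define d where "d = min (\<delta> / 3) (d0 / 3)"
    have d: "0 < d" "2 * d < \<delta>" "2 * d < d0" using \<delta>(1) d0(1) by (auto simp: d_def min_def)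
    define S where "S = {- d..d} \<times> {- d, d} \<union> {- d, d} \<times> {- d..d}"
    have S: "d \<le> norm z" "norm z \<le> 2 * d" if "z \<in> S" for z
    proof -
      have "\<bar>fst z\<bar> \<le> d" "\<bar>snd z\<bar> \<le> d" "\<bar>fst z\<bar> = d \<or> \<bar>snd z\<bar> = d" using that d by (auto simp: S_def)
      then show "d \<le> norm z" "norm z \<le> 2 * d"
        using norm_Pair_le[of "fst z" "snd z"] norm_fst_le[of "fst z" "snd z"] norm_snd_le[of "snd z" "fst z"]
        by auto
    qed
    have S0: "z \<noteq> 0" if "z \<in> S" for z using S(1)[OF that] d(1) by auto
    have cont: "isCont (\<lambda>z. \<psi> z *\<^sub>R u z) z" if "z \<noteq> 0" for z
    proof (cases "z \<in> C")
      case True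
      then show ?thesis
        by (intro continuous_intros planar_isCont u that has_derivative_continuous[OF C1_functionD(1)[OF \<psi>]])
    next
      case False
      have "open (- C)" using C(1) compact_imp_closed by auto
      then have "\<forall>\<^sub>F y in nhds z. \<psi> y *\<^sub>R u y = 0"
        unfolding eventually_nhds using False C(2) by (intro exI[of _ "- C"]) auto
      then show ?thesis by (subst isCont_cong[where g = "\<lambda>_. 0"]) auto
    qed
    have "I = - boundary_integral ((*) a) (\<lambda>z. \<psi> z *\<^sub>R u z) (- d) (- d) d d"
      unfolding I_def by (rule integral_dbar_eq_boundary_integral[OF \<psi> C \<delta> u d(1,2)])
    then have "norm I = norm (boundary_integral ((*) a) (\<lambda>z. \<psi> z *\<^sub>R u z) (- d) (- d) d d)" by simp
    also have "\<dots> \<le> 2 * (1 + K) * (\<eta> / d) * ((d - - d) + (d - - d))"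
    proof (rule boundary_integral_bound[where S = S])
      show "continuous_on S (\<lambda>z. \<psi> z *\<^sub>R u z)"
        by (intro continuous_at_imp_continuous_on ballI cont S0)
      show "norm (\<psi> z *\<^sub>R u z) \<le> \<eta> / d" if "z \<in> S" for z
      proof -
        have "d * norm (\<psi> z *\<^sub>R u z) \<le> norm z * norm (\<psi> z *\<^sub>R u z)"
          by (intro mult_right_mono S that) simp
        also have "\<dots> \<le> \<eta>" using d0(2)[of z] S0[OF that] S(2)[OF that] d by (simp add: abs_mult mult.assoc)
        finally show ?thesis using d(1) by (simp add: field_simps)
      qed
    qed (use K d in \<open>auto simp: S_def mult.commute\<close>)
    also have "\<dots> = 8 * (1 + K) * \<eta>" using d by (simp add: field_simps)
    also have "\<dots> = 0 + \<epsilon>" using K by (simp add: \<eta>_def)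
    finally show ?thesis .
  qed
  then have "norm I \<le> 0" by (rule field_le_epsilon)
  then show ?thesis by (simp add: I_def)
qed

end

subsection \<open>The period of the kernel is invertible\<close>

definition exp_term :: "nat \<Rightarrow> 'a::{euclidean_space,real_algebra_1} \<Rightarrow> 'a" where
  "exp_term n x = (1 / fact n) *\<^sub>R x ^ n"

lemma exp_term_0 [simp]: "exp_term 0 x = 1"
  by (simp add: exp_term_def)

lemma exp_term_Suc: "exp_term (Suc n) x = (1 / real (Suc n)) *\<^sub>R (x * exp_term n x)"
  by (simp add: exp_term_def field_simps)

lemma central_exp_term: "central x \<Longrightarrow> central (exp_term n x)"
  unfolding exp_term_def by (intro central_intros)

text \<open>\<open>B\<close> bounds the operator norm of multiplication by \<open>x\<close> and
  takes the place of \<open>norm x\<close>.\<close>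

lemma norm_exp_term_le:
  assumes "\<And>y. norm (x * y) \<le> B * norm y" "0 \<le> B"
  shows "norm (exp_term n x * y) \<le> B ^ n / fact n * norm y"
proof -
  have "norm (x ^ n * y) \<le> B ^ n * norm y"
  proof (induction n)
    case (Suc n)
    have "norm (x ^ Suc n * y) = norm (x * (x ^ n * y))" by (simp add: mult.assoc)
    also have "\<dots> \<le> B * (B ^ n * norm y)"
      by (intro order_trans[OF assms(1)] mult_left_mono Suc.IH assms(2))
    finally show ?case by simp
  qed simp
  then show ?thesis by (simp add: exp_term_def divide_right_mono)
qed

lemma has_vector_derivative_exp_term:
  assumes l: "(l has_vector_derivative l') (at t within S)" and cen: "\<And>t. central (l t)"
  shows "((\<lambda>t. exp_term (Suc n) (l t)) has_vector_derivative l' * exp_term n (l t)) (at t within S)"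
proof (induction n)
  case 0
  show ?case using l by (simp add: exp_term_Suc)
next
  case (Suc n)
  have "((\<lambda>t. l t * exp_term (Suc n) (l t)) has_vector_derivative
      l t * (l' * exp_term n (l t)) + l' * exp_term (Suc n) (l t)) (at t within S)"
    by (rule mult.has_vector_derivative[OF l Suc])
  also have "l t * (l' * exp_term n (l t)) = real (Suc n) *\<^sub>R (l' * exp_term (Suc n) (l t))"
    using central_left_commute[OF cen, of l' t "exp_term n (l t)"] by (simp add: exp_term_Suc)
  also have "\<dots> + l' * exp_term (Suc n) (l t) = real (Suc (Suc n)) *\<^sub>R (l' * exp_term (Suc n) (l t))"
    by (simp only: of_nat_Suc[of "Suc n"] scaleR_add_left scaleR_one add.commute)
  finally have "((\<lambda>t. (1 / real (Suc (Suc n))) *\<^sub>R (l t * exp_term (Suc n) (l t))) has_vector_derivative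
      (1 / real (Suc (Suc n))) *\<^sub>R (real (Suc (Suc n)) *\<^sub>R (l' * exp_term (Suc n) (l t)))) (at t within S)"
    by (rule bounded_linear.has_vector_derivative[OF bounded_linear_scaleR_right])
  then show ?case by (simp add: exp_term_Suc[of "Suc n"] del: of_nat_Suc)
qed

context elliptic_plane
begin

text \<open>
  If \<open>l\<close> is a logarithm of \<open>kap\<close> along a segment, then \<open>exp l / kap\<close> is constant there. The exponential
  series is only used through its partial sums, because the norm need not be submultiplicative.
\<close>
lemma exp_log_over_kap_const:
  assumes pq: "p \<le> q" and nz: "\<And>t. t \<in> {p..q} \<Longrightarrow> z0 + t *\<^sub>R v \<noteq> 0"
    and cen: "\<And>t. central (l t)"
    and l: "\<And>t. t \<in> {p..q} \<Longrightarrow> (l has_vector_derivative kap v * ikap (z0 + t *\<^sub>R v)) (at t within {p..q})"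
  shows "(\<lambda>n. (\<Sum>j\<le>n. exp_term j (l q) * (ikap (z0 + q *\<^sub>R v) * w)) -
      (\<Sum>j\<le>n. exp_term j (l p) * (ikap (z0 + p *\<^sub>R v) * w))) \<longlonglongrightarrow> 0"
proof -
  define Z where "Z t = z0 + t *\<^sub>R v" for t
  define l' where "l' t = kap v * ikap (Z t)" for t
  define u where "u t = ikap (Z t) * w" for t
  define Y where "Y n t = (\<Sum>j\<le>n. exp_term j (l t) * u t)" for n t
  have Z: "Z t \<noteq> 0" if "t \<in> {p..q}" for t using nz[OF that] by (simp add: Z_def)
  have Z': "(Z has_vector_derivative v) (at t within S)" for t S
    unfolding Z_def has_vector_derivative_def by (auto intro!: derivative_eq_intros)
  have u': "(u has_vector_derivative - (l' t * u t)) (at t within {p..q})" if t: "t \<in> {p..q}" for t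
  proof -
    have "((\<lambda>t. ikap (Z t)) has_derivative (\<lambda>h. - (ikap (Z t) * (ikap (Z t) * kap (h *\<^sub>R v))))) (at t within {p..q})"
      using has_derivative_compose[OF Z'[unfolded has_vector_derivative_def] has_derivative_ikap[OF Z[OF t]]] .
    then have "((\<lambda>t. ikap (Z t)) has_vector_derivative - (ikap (Z t) * (ikap (Z t) * kap v))) (at t within {p..q})"
      unfolding has_vector_derivative_def by (simp add: kap_scaleR)
    then have "(u has_vector_derivative - (ikap (Z t) * (ikap (Z t) * kap v)) * w) (at t within {p..q})"
      unfolding u_def by (rule bounded_linear.has_vector_derivative[OF mult.bounded_linear_left])
    also have "- (ikap (Z t) * (ikap (Z t) * kap v)) * w = - (l' t * u t)"
      using centralD[OF central_kap, of v] central_left_commute[OF central_kap, of _ v]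
      by (simp add: l'_def u_def mult.assoc)
    finally show ?thesis .
  qed
  \<comment> \<open>The product rule makes the sum telescope: the derivative of the
    \<open>n\<close>-th partial sum retains only the term of order \<open>n\<close>, which the
    factorial drives to 0.\<close>
  have Y': "(Y n has_vector_derivative - (l' t * (exp_term n (l t) * u t))) (at t within {p..q})"
    if t: "t \<in> {p..q}" for n t
  proof (induction n)
    case 0
    show ?case using u'[OF t] by (simp add: Y_def[abs_def])
  next
    case (Suc n)
    have lt: "(l has_vector_derivative l' t) (at t within {p..q})" using l[OF t] by (simp add: l'_def Z_def)
    have "((\<lambda>t. exp_term (Suc n) (l t) * u t) has_vector_derivative
        exp_term (Suc n) (l t) * - (l' t * u t) + l' t * exp_term n (l t) * u t) (at t within {p..q})"
      by (rule mult.has_vector_derivative[OF has_vector_derivative_exp_term[OF lt cen] u'[OF t]])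
    from has_vector_derivative_add[OF Suc this]
    have "(Y (Suc n) has_vector_derivative - (l' t * (exp_term n (l t) * u t)) +
        (exp_term (Suc n) (l t) * - (l' t * u t) + l' t * exp_term n (l t) * u t)) (at t within {p..q})"
      by (simp add: Y_def[abs_def])
    also have "- (l' t * (exp_term n (l t) * u t)) +
        (exp_term (Suc n) (l t) * - (l' t * u t) + l' t * exp_term n (l t) * u t) =
        - (l' t * (exp_term (Suc n) (l t) * u t))"
      using central_left_commute[OF central_exp_term[OF cen], of "l' t" "Suc n" t "u t"] by (simp add: mult.assoc)
    finally show ?case .
  qed
  have contZ: "continuous_on {p..q} Z" unfolding Z_def by (intro continuous_intros)
  have contl': "continuous_on {p..q} l'" and contu: "continuous_on {p..q} u"
    unfolding l'_def u_def by (intro mult.continuous_on continuous_intros contZ Z, assumption)+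
  have contl: "continuous_on {p..q} l"
    by (rule continuous_on_vector_derivative[OF l])
  have bdd: "\<exists>B>0. \<forall>t\<in>{p..q}. norm (f t) \<le> B" if "continuous_on {p..q} f" for f :: "real \<Rightarrow> 'a"
    using compact_imp_bounded[OF compact_continuous_image[OF that compact_Icc]]
    unfolding bounded_pos by auto
  obtain C where C: "C > 0" "\<And>x y. norm (x * y) \<le> norm x * norm (y :: 'a) * C"
    using mult.pos_bounded by blast
  obtain B1 B2 B3 where B1: "B1 > 0" "\<And>t. t \<in> {p..q} \<Longrightarrow> norm (l' t) \<le> B1"
    and B2: "B2 > 0" "\<And>t. t \<in> {p..q} \<Longrightarrow> norm (u t) \<le> B2"
    and B3: "B3 > 0" "\<And>t. t \<in> {p..q} \<Longrightarrow> norm (l t) \<le> B3"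
    using bdd[OF contl'] bdd[OF contu] bdd[OF contl] by metis
  have bound: "norm (Y n q - Y n p) \<le> B1 * ((B3 * C) ^ n / fact n * B2) * C * (q - p)" for n
  proof -
    have ft: "((\<lambda>t. - (l' t * (exp_term n (l t) * u t))) has_integral Y n q - Y n p) {p..q}"
      by (rule fundamental_theorem_of_calculus[OF pq Y'])
    have "norm (- (l' t * (exp_term n (l t) * u t))) \<le> B1 * ((B3 * C) ^ n / fact n * B2) * C"
      if t: "t \<in> {p..q}" for t
    proof -
      have "norm (l t * y) \<le> B3 * C * norm y" for y
      proof -
        have "norm (l t * y) \<le> norm (l t) * norm y * C" by (rule C)
        also have "\<dots> \<le> B3 * norm y * C"
          by (intro mult_right_mono B3 t) (use C in auto)
        finally show ?thesis by (simp add: mult_ac)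
      qed
      then have "norm (exp_term n (l t) * u t) \<le> (B3 * C) ^ n / fact n * norm (u t)"
        using B3 C by (intro norm_exp_term_le) auto
      also have "\<dots> \<le> (B3 * C) ^ n / fact n * B2"
        by (intro mult_left_mono B2 t) (use B3 C in auto)
      finally have E: "norm (exp_term n (l t) * u t) \<le> (B3 * C) ^ n / fact n * B2" .
      have "norm (- (l' t * (exp_term n (l t) * u t))) \<le> norm (l' t) * norm (exp_term n (l t) * u t) * C"
        by (simp add: C)
      also have "\<dots> \<le> B1 * ((B3 * C) ^ n / fact n * B2) * C"
        by (intro mult_right_mono mult_mono B1 t E) (use C B1 in auto)
      finally show ?thesis .
    qed
    then have "norm (Y n q - Y n p) \<le> B1 * ((B3 * C) ^ n / fact n * B2) * C * measure lborel (cbox p q)"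
      by (intro has_integral_bound[OF _ ft[unfolded box_real(2)[symmetric]]]) (use B1 B2 B3 C in auto)
    then show ?thesis using pq by simp
  qed
  have "(\<lambda>n. (B3 * C) ^ n / fact n) \<longlonglongrightarrow> 0"
    using summable_LIMSEQ_zero[OF summable_exp_generic[of "B3 * C"]] by (simp add: divide_inverse mult.commute)
  then have "(\<lambda>n. B1 * ((B3 * C) ^ n / fact n * B2) * C * (q - p)) \<longlonglongrightarrow> B1 * (0 * B2) * C * (q - p)"
    by (intro tendsto_intros)
  then have "(\<lambda>n. B1 * ((B3 * C) ^ n / fact n * B2) * C * (q - p)) \<longlonglongrightarrow> 0" by simp
  then have "(\<lambda>n. Y n q - Y n p) \<longlonglongrightarrow> 0"
    by (rule Lim_null_comparison[OF always_eventually[OF allI[OF bound]]])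
  then show ?thesis by (simp add: Y_def u_def Z_def)
qed

lemma integral_mult_right_slice:
  fixes \<phi> :: "real \<Rightarrow> 'a"
  assumes "\<phi> integrable_on S"
  shows "integral S (\<lambda>t. \<phi> t * w) = integral S \<phi> * w"
  using integral_linear[OF assms mult.bounded_linear_left[of w]] by (simp add: o_def)

text \<open>
  Half of the period of \<open>1/kap\<close> around the square is a logarithm of \<open>-1\<close>, so it cannot kill \<open>w\<close>.
\<close>
lemma boundary_integral_ikap_eq_0:
  assumes \<delta>: "\<delta> > 0" and zero: "boundary_integral ((*) a) (\<lambda>z. ikap z * w) (- \<delta>) (- \<delta>) \<delta> \<delta> = 0"
  shows "w = 0"
proof -
  let ?I = "{- \<delta>..\<delta>}"
  have nz: "(x, \<delta>) \<noteq> 0" "(x, - \<delta>) \<noteq> 0" "(\<delta>, x) \<noteq> 0" "(- \<delta>, x) \<noteq> 0" "(- x, \<delta>) \<noteq> 0" for x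
    using \<delta> by (auto simp: zero_prod_def)
  have c1: "continuous_on S (\<lambda>s. ikap (\<delta>, s))" and c2: "continuous_on S (\<lambda>s. ikap (s, \<delta>))"
    and c3: "continuous_on S (\<lambda>s. ikap (- s, \<delta>))" for S
    by (intro continuous_intros nz)+
  \<comment> \<open>Integrals of the kernel over the right and the top edge. The kernel is odd, so
    the left and bottom edges give the negatives, and half the period is \<open>a * A - B\<close> up
    to sign.\<close>
  define A B where "A = integral ?I (\<lambda>s. ikap (\<delta>, s))" and "B = integral ?I (\<lambda>s. ikap (s, \<delta>))"
  have iA: "integral ?I (\<lambda>y. ikap (\<delta>, y) * w) = A * w"
    and iB: "integral ?I (\<lambda>x. ikap (x, \<delta>) * w) = B * w"
    unfolding A_def B_def by (intro integral_mult_right_slice integrable_continuous_interval c1 c2)+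
  have iA': "integral ?I (\<lambda>y. ikap (- \<delta>, y) * w) = - (A * w)"
  proof -
    have "integral ?I (\<lambda>y. ikap (- \<delta>, y) * w) = integral ?I (\<lambda>y. ikap (- \<delta>, - y) * w)"
      using Henstock_Kurzweil_Integration.integral_reflect_real[of \<delta> "- \<delta>" "\<lambda>y. ikap (- \<delta>, y) * w"] by simp
    also have "\<dots> = integral ?I (\<lambda>y. - (ikap (\<delta>, y) * w))"
      using ikap_uminus[OF nz(3)] by simp
    finally show ?thesis using iA by simp
  qed
  have iB': "integral ?I (\<lambda>x. ikap (x, - \<delta>) * w) = - (B * w)"
  proof -
    have "integral ?I (\<lambda>x. ikap (x, - \<delta>) * w) = integral ?I (\<lambda>x. ikap (- x, - \<delta>) * w)"
      using Henstock_Kurzweil_Integration.integral_reflect_real[of \<delta> "- \<delta>" "\<lambda>x. ikap (x, - \<delta>) * w"] by simp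
    also have "\<dots> = integral ?I (\<lambda>x. - (ikap (x, \<delta>) * w))"
      using ikap_uminus[OF nz(1)] by simp
    finally show ?thesis using iB by simp
  qed
  have "2 *\<^sub>R ((a * A - B) * w) = 0"
    using zero unfolding boundary_integral_def iA iB iA' iB'
    by (simp add: algebra_simps scaleR_2 mult.assoc)
  then have Lw: "(a * A - B) * w = 0" by simp
  \<comment> \<open>\<open>l1\<close> integrates the logarithmic derivative of \<open>kap\<close> up
    the right edge, starting from 0 at the lower right corner; \<open>l2\<close> continues along the
    top edge to the opposite corner, where it equals \<open>a * A - B\<close>.\<close>
  define l1 where "l1 t = a * integral {- \<delta>..t} (\<lambda>s. ikap (\<delta>, s))" for t
  define l2 where "l2 t = a * A - integral {- \<delta>..t} (\<lambda>s. ikap (- s, \<delta>))" for t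
  have cen1: "central (l1 t)" and cen2: "central (l2 t)" for t
    unfolding l1_def l2_def A_def
    by (intro central_intros central_integral central_ikap central_a nz)+
  have l1': "(l1 has_vector_derivative kap (0, 1) * ikap ((\<delta>, 0) + t *\<^sub>R (0, 1))) (at t within ?I)"
    if "t \<in> ?I" for t
    unfolding l1_def
    using bounded_linear.has_vector_derivative[OF mult.bounded_linear_right integral_has_vector_derivative[OF c1 that], of a]
    by simp
  have l2': "(l2 has_vector_derivative kap (- 1, 0) * ikap ((0, \<delta>) + t *\<^sub>R (- 1, 0))) (at t within ?I)"
    if "t \<in> ?I" for t
    unfolding l2_def
    using has_vector_derivative_diff[OF has_vector_derivative_const integral_has_vector_derivative[OF c3 that], of "a * A"]
    by (simp add: kap_def)
  have n1: "(\<delta>, 0::real) + t *\<^sub>R (0, 1) \<noteq> 0" and n2: "(0::real, \<delta>) + t *\<^sub>R (- 1, 0) \<noteq> 0" for t :: real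
    using nz(3)[of t] nz(5)[of t] by simp_all
  have e1: "(\<lambda>n. (\<Sum>j\<le>n. exp_term j (l1 \<delta>) * (ikap (\<delta>, \<delta>) * w)) -
      (\<Sum>j\<le>n. exp_term j (l1 (- \<delta>)) * (ikap (\<delta>, - \<delta>) * w))) \<longlonglongrightarrow> 0"
    using exp_log_over_kap_const[of "- \<delta>" \<delta> "(\<delta>, 0)" "(0, 1)" l1 w, OF _ n1 cen1 l1'] \<delta> by simp
  have e2: "(\<lambda>n. (\<Sum>j\<le>n. exp_term j (l2 \<delta>) * (ikap (- \<delta>, \<delta>) * w)) -
      (\<Sum>j\<le>n. exp_term j (l2 (- \<delta>)) * (ikap (\<delta>, \<delta>) * w))) \<longlonglongrightarrow> 0"
    using exp_log_over_kap_const[of "- \<delta>" \<delta> "(0, \<delta>)" "(- 1, 0)" l2 w, OF _ n2 cen2 l2'] \<delta> by simp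
  have s0: "(\<Sum>j\<le>n. exp_term j x * y) = y" if "x * y = 0" for n and x y :: 'a
  proof (induction n)
    case (Suc n)
    have "x ^ Suc n * y = 0" using that by (simp add: power_Suc2 mult.assoc del: power_Suc)
    then show ?case using Suc by (simp add: exp_term_def)
  qed simp
  have "l1 (- \<delta>) = 0" by (simp add: l1_def)
  then have f1: "(\<Sum>j\<le>n. exp_term j (l1 (- \<delta>)) * (ikap (\<delta>, - \<delta>) * w)) = ikap (\<delta>, - \<delta>) * w" for n
    by (intro s0) simp
  have "l2 (- \<delta>) = l1 \<delta>" by (simp add: l1_def l2_def A_def)
  have "integral ?I (\<lambda>s. ikap (- s, \<delta>)) = B"
    unfolding B_def using Henstock_Kurzweil_Integration.integral_reflect_real[of \<delta> "- \<delta>" "\<lambda>x. ikap (x, \<delta>)"] by simp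
  then have l2d: "l2 \<delta> = a * A - B" by (simp add: l2_def)
  have f2: "(\<Sum>j\<le>n. exp_term j (l2 \<delta>) * (ikap (- \<delta>, \<delta>) * w)) = ikap (- \<delta>, \<delta>) * w" for n
  proof (rule s0)
    have "l2 \<delta> * (ikap (- \<delta>, \<delta>) * w) = ikap (- \<delta>, \<delta>) * (l2 \<delta> * w)"
      using central_left_commute[OF central_ikap[OF nz(4)]] by simp
    then show "l2 \<delta> * (ikap (- \<delta>, \<delta>) * w) = 0" using Lw l2d by simp
  qed
  have "ikap (- (\<delta>, - \<delta>)) = - ikap (\<delta>, - \<delta>)" by (rule ikap_uminus[OF nz(3)])
  then have f3: "ikap (- \<delta>, \<delta>) = - ikap (\<delta>, - \<delta>)" by simp
  \<comment> \<open>At the start the logarithm is 0, at the end it kills the vector, so every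
    partial sum of the exponential acts as the identity at both corners. The kernel would then agree
    on \<open>w\<close> at antipodal points, although it is odd.\<close>
  from tendsto_add[OF e1 e2] have "(\<lambda>n::nat. ikap (- \<delta>, \<delta>) * w - ikap (\<delta>, - \<delta>) * w) \<longlonglongrightarrow> 0"
    unfolding f1 f2 \<open>l2 (- \<delta>) = l1 \<delta>\<close> by simp
  then have "- (ikap (\<delta>, - \<delta>) * w) = ikap (\<delta>, - \<delta>) * w"
    unfolding f3 LIMSEQ_const_iff by simp
  then have "2 *\<^sub>R (ikap (\<delta>, - \<delta>) * w) = 0" by (metis scaleR_2 right_minus)
  then have "ikap (\<delta>, - \<delta>) * w = 0" by simp
  then show ?thesis using kap_ikap_mult[OF nz(3), of "- \<delta>" w] by simp
qed

end

subsection \<open>Cauchy formulas\<close>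

lemma integrable_continuous_compact_support:
  fixes \<phi> :: "'n::euclidean_space \<Rightarrow> 'b::euclidean_space"
  assumes c: "continuous_on UNIV \<phi>" and C: "compact C" "\<And>z. z \<notin> C \<Longrightarrow> \<phi> z = 0"
  shows "\<phi> integrable_on UNIV"
proof -
  obtain l r where lr: "C \<subseteq> cbox l r"
    using bounded_subset_cbox_symmetric[OF compact_imp_bounded[OF C(1)]] by blast
  have "\<phi> integrable_on cbox l r"
    by (intro integrable_continuous continuous_on_subset[OF c]) auto
  then show ?thesis
    using has_integral_on_superset[of \<phi> _ "cbox l r" UNIV] C(2) lr
    by (metis (no_types, lifting) integrable_on_def subset_UNIV subsetD)
qed

lemma integral_UNIV_eq_superset:
  fixes \<phi> :: "'n::euclidean_space \<Rightarrow> 'b::euclidean_space"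
  assumes "\<And>z. z \<notin> C \<Longrightarrow> \<phi> z = 0" "C \<subseteq> S"
  shows "integral UNIV \<phi> = integral S \<phi>"
  by (rule integral_UNIV_eq_cbox) (use assms in blast)

lemma continuous_on_compact_norm_bound:
  assumes "continuous_on S f" "compact S"
  obtains B :: real where "B > 0" "\<And>x. x \<in> S \<Longrightarrow> norm (f x) \<le> B"
proof -
  have "bounded (f ` S)" by (intro compact_imp_bounded compact_continuous_image assms)
  then obtain B where "B > 0" "\<forall>y\<in>f ` S. norm y \<le> B" unfolding bounded_pos by blast
  then show ?thesis using that[of B] by simp
qed

lemma boundary_integral_cong:
  assumes "\<And>x. x \<in> {x0..x1} \<Longrightarrow> g (x, y0) = h (x, y0) \<and> g (x, y1) = h (x, y1)"
    and "\<And>y. y \<in> {y0..y1} \<Longrightarrow> g (x0, y) = h (x0, y) \<and> g (x1, y) = h (x1, y)"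
  shows "boundary_integral T g x0 y0 x1 y1 = boundary_integral T h x0 y0 x1 y1"
  unfolding boundary_integral_def
  by (intro arg_cong2[where f = minus] arg_cong[where f = T] integral_cong) (use assms in auto)

context elliptic_plane
begin

lemma dbar_near_0:
  assumes "C1_function \<psi> \<psi>'" "\<And>z. z \<in> ball 0 \<delta> \<Longrightarrow> \<psi> z = c" "norm z < \<delta>"
  shows "dbar \<psi>' z = 0"
proof -
  have "z \<in> ball 0 \<delta>" using assms(3) by simp
  then show ?thesis by (rule dbar_locally_const[OF assms(1) open_ball _ assms(2)])
qed

lemma integrable_dbar_mult:
  assumes \<psi>: "C1_function \<psi> \<psi>'" and C: "compact C" "\<And>z. z \<notin> C \<Longrightarrow> \<psi> z = 0"
    and \<delta>: "\<delta> > 0" "\<And>z. z \<in> ball 0 \<delta> \<Longrightarrow> \<psi> z = c"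
    and u: "\<And>z. z \<in> C \<Longrightarrow> z \<noteq> 0 \<Longrightarrow> planar u z"
  shows "(\<lambda>z. dbar \<psi>' z * u z) integrable_on UNIV"
proof (rule integrable_continuous_compact_support[OF _ C(1)])
  show "continuous_on UNIV (\<lambda>z. dbar \<psi>' z * u z)"
    by (intro continuous_at_imp_continuous_on ballI isCont_dbar_mult[OF \<psi> C \<delta>] planar_isCont u)
  have "open (- C)" using C(1) compact_imp_closed by auto
  then show "dbar \<psi>' z * u z = 0" if "z \<notin> C" for z
    using dbar_locally_const[OF \<psi>, of "- C" z 0] that C(2) by simp
qed

text \<open>Multiplication by the period is injective: after Stokes' formula, a vector killed by the
  period has vanishing boundary integral against the kernel and is 0. A central element that acts
  injectively is invertible.\<close>

lemma period_invertible:
  assumes \<psi>: "C1_function \<psi> \<psi>'" and C: "compact C" "\<And>z. z \<notin> C \<Longrightarrow> \<psi> z = 0"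
    and \<delta>: "\<delta> > 0" "\<And>z. z \<in> ball 0 \<delta> \<Longrightarrow> \<psi> z = 1"
  obtains d where "central d" "d * integral UNIV (\<lambda>z. dbar \<psi>' z * ikap z) = 1"
proof -
  define N where "N = integral UNIV (\<lambda>z. dbar \<psi>' z * ikap z)"
  have "central (dbar \<psi>' z * ikap z)" for z
  proof (cases "z = 0")
    case True
    then have "dbar \<psi>' z = 0" using dbar_near_0[OF \<psi> \<delta>(2)] \<delta>(1) by simp
    then show ?thesis by simp
  qed (intro central_mult central_dbar central_ikap)
  then have N: "central N" unfolding N_def by (intro central_integral) auto
  have "w = 0" if "N * w = 0" for w
  proof (rule boundary_integral_ikap_eq_0)
    show "0 < \<delta> / 3" using \<delta> by simp
    have "N * w = integral UNIV (\<lambda>z. dbar \<psi>' z * ikap z * w)"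
      using integral_linear[OF integrable_dbar_mult[OF \<psi> C \<delta> planar_ikap] mult.bounded_linear_left[of w]]
      by (simp add: N_def o_def)
    also have "\<dots> = integral UNIV (\<lambda>z. dbar \<psi>' z * (ikap z * w))" by (simp add: mult.assoc)
    also have "\<dots> = - boundary_integral ((*) a) (\<lambda>z. \<psi> z *\<^sub>R (ikap z * w)) (- (\<delta> / 3)) (- (\<delta> / 3)) (\<delta> / 3) (\<delta> / 3)"
      by (rule integral_dbar_eq_boundary_integral[OF \<psi> C \<delta>])
        (use \<delta> in \<open>auto intro: planar_mult planar_ikap planar_const\<close>)
    also have "boundary_integral ((*) a) (\<lambda>z. \<psi> z *\<^sub>R (ikap z * w)) (- (\<delta> / 3)) (- (\<delta> / 3)) (\<delta> / 3) (\<delta> / 3) =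
        boundary_integral ((*) a) (\<lambda>z. ikap z * w) (- (\<delta> / 3)) (- (\<delta> / 3)) (\<delta> / 3) (\<delta> / 3)"
    proof -
      have "\<psi> (x, y) = 1" if "\<bar>x\<bar> \<le> \<delta> / 3" "\<bar>y\<bar> \<le> \<delta> / 3" for x y
        using norm_Pair_le[of x y] that \<delta>(1) by (intro \<delta>(2)) simp
      then show ?thesis by (intro boundary_integral_cong) (use \<delta> in auto)
    qed
    finally show "boundary_integral ((*) a) (\<lambda>z. ikap z * w) (- (\<delta> / 3)) (- (\<delta> / 3)) (\<delta> / 3) (\<delta> / 3) = 0"
      using that by simp
  qed
  then obtain d where d: "central d" "N * d = 1" using central_inverse_ex[OF N] by metis
  then show ?thesis using that[of d] centralD[OF d(1)] by (simp add: N_def)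
qed

lemma cutoff_at_0_in_support:
  fixes \<psi> :: "real \<times> real \<Rightarrow> real"
  assumes "\<And>z. z \<notin> C \<Longrightarrow> \<psi> z = 0" "\<delta> > 0" "\<And>z. z \<in> ball 0 \<delta> \<Longrightarrow> \<psi> z = 1"
  shows "0 \<in> C"
  using assms(1)[of 0] assms(3)[of 0] assms(2) by fastforce

text \<open>After subtracting \<open>u 0\<close> the singularity of the kernel is removable by
  continuity of \<open>u\<close>; the constant part produces the period.\<close>

lemma cauchy_formula:
  assumes \<psi>: "C1_function \<psi> \<psi>'" and C: "compact C" "\<And>z. z \<notin> C \<Longrightarrow> \<psi> z = 0"
    and \<delta>: "\<delta> > 0" "\<And>z. z \<in> ball 0 \<delta> \<Longrightarrow> \<psi> z = 1"
    and u: "\<And>z. z \<in> C \<Longrightarrow> planar u z"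
  shows "integral UNIV (\<lambda>z. dbar \<psi>' z * (ikap z * u z)) =
    integral UNIV (\<lambda>z. dbar \<psi>' z * ikap z) * u 0"
proof -
  obtain M where M: "M > 0" "\<And>z w. z \<noteq> 0 \<Longrightarrow> norm (ikap z * w) \<le> M * norm w / norm z"
    using ikap_bound by blast
  have "isCont u 0" by (intro planar_isCont u cutoff_at_0_in_support[OF C(2) \<delta>])
  then have "((\<lambda>z. M * norm (u z - u 0)) \<longlongrightarrow> M * norm (u 0 - u 0)) (at 0)"
    unfolding isCont_def by (intro tendsto_intros)
  then have lim0: "((\<lambda>z. M * norm (u z - u 0)) \<longlongrightarrow> 0) (at 0)" by simp
  have "((\<lambda>z. norm z *\<^sub>R (\<psi> z *\<^sub>R (ikap z * (u z - u 0)))) \<longlongrightarrow> 0) (at 0)"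
  proof (rule Lim_null_comparison[OF eventually_mono[OF eventually_at_ball'[OF \<delta>(1), of 0 UNIV]] lim0])
    fix z :: "real \<times> real" assume z: "z \<in> ball 0 \<delta> \<and> z \<noteq> 0 \<and> z \<in> UNIV"
    then show "norm (norm z *\<^sub>R (\<psi> z *\<^sub>R (ikap z * (u z - u 0)))) \<le> M * norm (u z - u 0)"
      using M(2)[of z "u z - u 0"] \<delta>(2)[of z] by (simp add: pos_le_divide_eq mult.commute)
  qed
  then have "integral UNIV (\<lambda>z. dbar \<psi>' z * (ikap z * (u z - u 0))) = 0"
    by (intro integral_dbar_eq_0[OF \<psi> C \<delta>] planar_mult planar_ikap planar_diff u planar_const)
  also have "(\<lambda>z. dbar \<psi>' z * (ikap z * (u z - u 0))) =
      (\<lambda>z. dbar \<psi>' z * (ikap z * u z) - dbar \<psi>' z * ikap z * u 0)"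
    by (simp add: right_diff_distrib mult.assoc)
  also have "integral UNIV \<dots> = integral UNIV (\<lambda>z. dbar \<psi>' z * (ikap z * u z)) -
      integral UNIV (\<lambda>z. dbar \<psi>' z * ikap z * u 0)"
  proof (rule Henstock_Kurzweil_Integration.integral_diff)
    show "(\<lambda>z. dbar \<psi>' z * (ikap z * u z)) integrable_on UNIV"
      by (intro integrable_dbar_mult[OF \<psi> C \<delta>] planar_mult planar_ikap u)
    have "(\<lambda>z. dbar \<psi>' z * (ikap z * u 0)) integrable_on UNIV"
      by (intro integrable_dbar_mult[OF \<psi> C \<delta>] planar_mult planar_ikap planar_const)
    then show "(\<lambda>z. dbar \<psi>' z * ikap z * u 0) integrable_on UNIV" by (simp add: mult.assoc)
  qed
  also have "integral UNIV (\<lambda>z. dbar \<psi>' z * ikap z * u 0) = integral UNIV (\<lambda>z. dbar \<psi>' z * ikap z) * u 0"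
    using integral_linear[OF integrable_dbar_mult[OF \<psi> C \<delta> planar_ikap] mult.bounded_linear_left[of "u 0"]]
    by (simp add: o_def)
  finally show ?thesis by simp
qed

text \<open>Subtracting the first-order Taylor polynomial, which by the equation is
  \<open>u 0 + kap z * u' (1, 0)\<close>, makes even the squared kernel removable. The derivative at
  the centre is thereby expressed through values of \<open>u\<close> alone.\<close>

lemma cauchy_formula_derivative:
  assumes \<psi>: "C1_function \<psi> \<psi>'" and C: "compact C" "\<And>z. z \<notin> C \<Longrightarrow> \<psi> z = 0"
    and \<delta>: "\<delta> > 0" "\<And>z. z \<in> ball 0 \<delta> \<Longrightarrow> \<psi> z = 1"
    and u: "\<And>z. z \<in> C \<Longrightarrow> planar u z"
    and u': "(u has_derivative u') (at 0)" "u' (0, 1) = a * u' (1, 0)"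
  shows "integral UNIV (\<lambda>z. dbar \<psi>' z * (ikap z * (ikap z * u z))) =
    integral UNIV (\<lambda>z. dbar \<psi>' z * (ikap z * ikap z)) * u 0 +
    integral UNIV (\<lambda>z. dbar \<psi>' z * ikap z) * u' (1, 0)"
proof -
  obtain M where M: "M > 0" "\<And>z w. z \<noteq> 0 \<Longrightarrow> norm (ikap z * w) \<le> M * norm w / norm z"
    using ikap_bound by blast
  have lin: "linear u'" using u'(1) has_derivative_linear by blast
  have u'_eq: "u' z = kap z * u' (1, 0)" for z
  proof -
    have "u' z = u' (fst z *\<^sub>R (1, 0) + snd z *\<^sub>R (0, 1))" by simp
    also have "\<dots> = kap z * u' (1, 0)"
      unfolding linear_add[OF lin] linear_cmul[OF lin] u'(2) by (simp add: kap_def algebra_simps)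
    finally show ?thesis .
  qed
  define v where "v z = u z - u 0 - kap z * u' (1, 0)" for z
  have vlim: "((\<lambda>z. v z /\<^sub>R norm z) \<longlongrightarrow> 0) (at 0)"
    using u'(1) unfolding has_derivative_def v_def by (simp add: Lim_ident_at flip: u'_eq)
  have "((\<lambda>z. M * M * norm (v z /\<^sub>R norm z)) \<longlongrightarrow> M * M * norm (0::'a)) (at 0)"
    by (intro tendsto_intros vlim)
  then have lim0: "((\<lambda>z. M * M * norm (v z /\<^sub>R norm z)) \<longlongrightarrow> 0) (at 0)" by simp
  have "((\<lambda>z. norm z *\<^sub>R (\<psi> z *\<^sub>R (ikap z * (ikap z * v z)))) \<longlongrightarrow> 0) (at 0)"
  proof (rule Lim_null_comparison[OF eventually_mono[OF eventually_at_ball'[OF \<delta>(1), of 0 UNIV]] lim0])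
    fix z :: "real \<times> real" assume z: "z \<in> ball 0 \<delta> \<and> z \<noteq> 0 \<and> z \<in> UNIV"
    have "norm (ikap z * (ikap z * v z)) \<le> M * norm (ikap z * v z) / norm z" using M(2) z by blast
    also have "\<dots> \<le> M * (M * norm (v z) / norm z) / norm z"
      using M z by (intro divide_right_mono mult_left_mono) auto
    finally show "norm (norm z *\<^sub>R (\<psi> z *\<^sub>R (ikap z * (ikap z * v z)))) \<le> M * M * norm (v z /\<^sub>R norm z)"
      using \<delta>(2)[of z] z by (simp add: field_simps)
  qed
  then have "integral UNIV (\<lambda>z. dbar \<psi>' z * (ikap z * (ikap z * v z))) = 0"
    unfolding v_def
    by (intro integral_dbar_eq_0[OF \<psi> C \<delta>] planar_mult planar_ikap planar_diff u planar_const planar_kap)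
  also have "integral UNIV (\<lambda>z. dbar \<psi>' z * (ikap z * (ikap z * v z))) =
      integral UNIV (\<lambda>z. dbar \<psi>' z * (ikap z * (ikap z * u z)) -
        dbar \<psi>' z * (ikap z * ikap z) * u 0 - dbar \<psi>' z * ikap z * u' (1, 0))"
  proof (rule integral_cong)
    fix z :: "real \<times> real"
    show "dbar \<psi>' z * (ikap z * (ikap z * v z)) = dbar \<psi>' z * (ikap z * (ikap z * u z)) -
        dbar \<psi>' z * (ikap z * ikap z) * u 0 - dbar \<psi>' z * ikap z * u' (1, 0)"
    proof (cases "z = 0")
      case True
      then have "dbar \<psi>' z = 0" using dbar_near_0[OF \<psi> \<delta>(2)] \<delta>(1) by simp
      then show ?thesis by simp
    next
      case False
      then show ?thesis by (simp add: v_def right_diff_distrib ikap_kap_mult mult.assoc)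
    qed
  qed
  also have "\<dots> = integral UNIV (\<lambda>z. dbar \<psi>' z * (ikap z * (ikap z * u z))) -
      integral UNIV (\<lambda>z. dbar \<psi>' z * (ikap z * ikap z) * u 0) -
      integral UNIV (\<lambda>z. dbar \<psi>' z * ikap z * u' (1, 0))"
  proof -
    have "(\<lambda>z. dbar \<psi>' z * (ikap z * (ikap z * u z))) integrable_on UNIV"
      "(\<lambda>z. dbar \<psi>' z * (ikap z * (ikap z * u 0))) integrable_on UNIV"
      "(\<lambda>z. dbar \<psi>' z * (ikap z * u' (1, 0))) integrable_on UNIV"
      by (intro integrable_dbar_mult[OF \<psi> C \<delta>] planar_mult planar_ikap u planar_const; assumption)+
    then show ?thesis
      by (simp add: Henstock_Kurzweil_Integration.integral_diff integrable_diff mult.assoc)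
  qed
  also have "integral UNIV (\<lambda>z. dbar \<psi>' z * ikap z * u' (1, 0)) = integral UNIV (\<lambda>z. dbar \<psi>' z * ikap z) * u' (1, 0)"
    using integral_linear[OF integrable_dbar_mult[OF \<psi> C \<delta> planar_ikap] mult.bounded_linear_left[of "u' (1, 0)"]]
    by (simp add: o_def)
  also have "integral UNIV (\<lambda>z. dbar \<psi>' z * (ikap z * ikap z) * u 0) =
      integral UNIV (\<lambda>z. dbar \<psi>' z * (ikap z * ikap z)) * u 0"
    using integral_linear[OF integrable_dbar_mult[OF \<psi> C \<delta> planar_mult[OF planar_ikap planar_ikap]]
        mult.bounded_linear_left[of "u 0"]]
    by (simp add: o_def)
  finally show ?thesis by (simp add: algebra_simps)
qed

text \<open>
  Apply the Cauchy formula with centre \<open>w\<close> to \<open>h / kap^n\<close>: where the cutoff varies, \<open>kap\<close> is large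
  compared to \<open>kap w\<close>, so letting \<open>n\<close> tend to infinity forces \<open>h w = 0\<close>.
\<close>
lemma planar_identity:
  obtains c where "c > 0"
    "\<And>h R \<rho> w. \<lbrakk>\<And>z. z \<in> ball 0 R \<Longrightarrow> planar h z; \<rho> > 0; \<And>z. z \<in> ball 0 \<rho> \<Longrightarrow> h z = 0; norm w < c * R\<rbrakk>
      \<Longrightarrow> h w = 0"
proof -
  obtain M where M: "M > 0" "\<And>z w. z \<noteq> 0 \<Longrightarrow> norm (ikap z * w) \<le> M * norm w / norm z"
    using ikap_bound by blast
  obtain L where L: "L > 0" "\<And>z. norm (kap z) \<le> norm z * L"
    using linear_kap bounded_linear.pos_bounded linear_conv_bounded_linear by blast
  obtain B where B: "B > 0" "\<And>x y. norm (x * y) \<le> norm x * norm (y :: 'a) * B"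
    using mult.pos_bounded by blast
  \<comment> \<open>The bound 1/8 keeps \<open>w\<close> plus the support of the cutoff well inside
    the ball of radius \<open>R\<close>; the second bound makes the ratio \<open>s * q\<close> of
    the final geometric estimate smaller than 1.\<close>
  define c where "c = min (1 / 8) (1 / (4 * L * B * M))"
  have c: "c > 0" using L M B by (simp add: c_def)
  have "h w = 0" if h: "\<And>z. z \<in> ball 0 R \<Longrightarrow> planar h z" and \<rho>: "\<rho> > 0" "\<And>z. z \<in> ball 0 \<rho> \<Longrightarrow> h z = 0"
    and w: "norm w < c * R" for h R \<rho> w
  proof (cases "w = 0")
    case True
    then show ?thesis using \<rho> by simp
  next
    case False
    have "0 < c * R" using w norm_ge_zero[of w] by linarith
    then have R: "R > 0" using c by (simp add: zero_less_mult_iff)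
    have "c * R \<le> R / 8" using R by (simp add: c_def min_def mult_right_mono[of _ "1/8"] field_simps)
    then have w8: "norm w < R / 8" using w by linarith
    obtain \<psi> \<psi>' G1 C where \<psi>: "C1_function \<psi> \<psi>'" and G1: "cball 0 (R / 2) \<subseteq> G1" "\<And>z. z \<in> G1 \<Longrightarrow> \<psi> z = 1"
      and C: "compact C" "C \<subseteq> ball 0 (3 * R / 4)" "\<And>z::real \<times> real. z \<notin> C \<Longrightarrow> \<psi> z = 0"
      by (rule C1_cutoff_exists[of "cball (0::real \<times> real) (R / 2)" "ball 0 (3 * R / 4)"]) (use R in auto)
    have "ball 0 (R / 2) \<subseteq> G1" using G1(1) ball_subset_cball by blast
    then have \<delta>: "R / 2 > 0" "\<And>z. z \<in> ball 0 (R / 2) \<Longrightarrow> \<psi> z = 1" using R by (simp, blast intro: G1(2))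
    have wC: "norm (w + z) < R" "norm (w + z) \<le> 7 * R / 8" if "z \<in> C" for z
      using that C(2) norm_triangle_ineq[of w z] w8 R by auto
    \<comment> \<open>The pole of \<open>ikap (w + z)\<close> lies where \<open>h\<close> vanishes
      identically, so the value 0 there extends the quotient to a solution.\<close>
    define f where "f n z = (if w + z = 0 then 0 else ikap (w + z) ^ n * h (w + z))" for n z
    have fpl: "planar (f n) z" if z: "z \<in> C" for n z
    proof (cases "w + z = 0")
      case True
      have *: "0 = f n y" if "y \<in> ball z \<rho>" for y
      proof -
        have "w + y = y - z" using True by (simp add: add_eq_0_iff)
        then have "h (w + y) = 0" using that by (intro \<rho>(2)) (simp add: dist_norm norm_minus_commute)
        then show ?thesis by (simp add: f_def)
      qed
      show ?thesis
        by (rule planar_transform[where u = "\<lambda>_. 0" and S = "ball z \<rho>"],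
            rule planar_const, rule open_ball, simp add: \<rho>(1), rule *)
    next
      case False
      have "planar (\<lambda>z. ikap z ^ n * h z) (w + z)"
        by (intro planar_mult planar_power planar_ikap False h) (use wC[OF z] in simp)
      then have "planar (\<lambda>z. ikap (w + z) ^ n * h (w + z)) z"
        by (rule planar_shift[of "\<lambda>z. ikap z ^ n * h z"])
      moreover have "open {y. w + y \<noteq> 0}"
        by (intro open_Collect_neq continuous_intros)
      ultimately show ?thesis
        by (rule planar_transform) (simp_all add: False f_def)
    qed
    define N where "N = integral UNIV (\<lambda>z. dbar \<psi>' z * ikap z)"
    obtain d where d: "central d" "d * N = 1"
      using period_invertible[OF \<psi> C(1,3) \<delta>] unfolding N_def by metis
    have cf: "integral UNIV (\<lambda>z. dbar \<psi>' z * (ikap z * f n z)) = N * (ikap w ^ n * h w)" for n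
      using cauchy_formula[OF \<psi> C(1,3) \<delta> fpl] False by (simp add: N_def f_def)
    have "continuous_on (cball 0 (7 * R / 8)) h"
      using R by (intro continuous_at_imp_continuous_on ballI planar_isCont h) auto
    then obtain H where H: "H > 0" "\<And>z. z \<in> cball 0 (7 * R / 8) \<Longrightarrow> norm (h z) \<le> H"
      using continuous_on_compact_norm_bound[OF _ compact_cball] by blast
    obtain D where D: "D > 0" "\<And>z. z \<in> C \<Longrightarrow> norm (dbar \<psi>' z) \<le> D"
      using continuous_on_compact_norm_bound[OF continuous_on_dbar[OF \<psi>] C(1)] by blast
    obtain l r where lr: "C \<subseteq> cbox l r"
      using bounded_subset_cbox_symmetric[OF compact_imp_bounded[OF C(1)]] by blast
    have "open (- C)" using C(1) compact_imp_closed by auto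
    then have dbarC: "dbar \<psi>' z = 0" if "z \<notin> C" for z
      using dbar_locally_const[OF \<psi>, of "- C" z 0] that C(3) by simp
    have dbarB: "dbar \<psi>' z = 0" if "z \<in> ball 0 (R / 2)" for z
      by (rule dbar_locally_const[OF \<psi> open_ball that \<delta>(2)])
    define A where "A = D * (M * H / (R / 2)) * B"
    have A: "A \<ge> 0" using D M H R B by (simp add: A_def)
    define q where "q = 4 * M / R"
    have q: "q \<ge> 0" using M R by (simp add: q_def)
    have fb: "norm (f n z) \<le> q ^ n * H" if z: "z \<in> C" "R / 2 \<le> norm z" for n z
    proof -
      have "R / 4 \<le> norm (w + z)" using norm_triangle_ineq2[of z "- w"] z w8 R by (simp add: add.commute)
      then have wz: "w + z \<noteq> 0" "R / 4 \<le> norm (w + z)" using R by auto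
      have ik: "norm (ikap (w + z) * y) \<le> q * norm y" for y
      proof -
        have "norm (ikap (w + z) * y) \<le> M * norm y / norm (w + z)" by (rule M(2)[OF wz(1)])
        also have "\<dots> \<le> M * norm y / (R / 4)"
          using wz M(1) R by (intro divide_left_mono mult_nonneg_nonneg mult_pos_pos) auto
        finally show ?thesis by (simp add: q_def mult_ac)
      qed
      have "norm (ikap (w + z) ^ n * y) \<le> q ^ n * norm y" for y
      proof (induction n)
        case (Suc n)
        have "norm (ikap (w + z) ^ Suc n * y) = norm (ikap (w + z) * (ikap (w + z) ^ n * y))"
          by (simp add: mult.assoc)
        also have "\<dots> \<le> q * (q ^ n * norm y)"
          by (intro order_trans[OF ik] mult_left_mono Suc.IH q)
        finally show ?case by simp
      qed simp
      then have "norm (ikap (w + z) ^ n * h (w + z)) \<le> q ^ n * norm (h (w + z))" .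
      also have "\<dots> \<le> q ^ n * H"
        by (intro mult_left_mono H(2)) (use wC(2)[OF z(1)] q in auto)
      finally show ?thesis using wz by (simp add: f_def)
    qed
    have ib: "norm (dbar \<psi>' z * (ikap z * f n z)) \<le> A * q ^ n" for n z
    proof (cases "z \<in> C \<and> R / 2 \<le> norm z")
      case True
      then have z: "z \<noteq> 0" using R by auto
      have "norm (dbar \<psi>' z * (ikap z * f n z)) \<le> norm (dbar \<psi>' z) * norm (ikap z * f n z) * B" by (rule B)
      also have "\<dots> \<le> D * (M * (q ^ n * H) / (R / 2)) * B"
      proof (intro mult_right_mono mult_mono)
        have "norm (ikap z * f n z) \<le> M * norm (f n z) / norm z" by (rule M(2)[OF z])
        also have "\<dots> \<le> M * (q ^ n * H) / (R / 2)"
          using True fb[of z n] M R H q by (intro frac_le mult_left_mono mult_nonneg_nonneg) auto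
        finally show "norm (ikap z * f n z) \<le> M * (q ^ n * H) / (R / 2)" .
      qed (use True D B in auto)
      also have "\<dots> = A * q ^ n" by (simp add: A_def field_simps)
      finally show ?thesis .
    next
      case False
      then have "dbar \<psi>' z = 0" using dbarC[of z] dbarB[of z] by (auto simp: not_le)
      then show ?thesis using A q by simp
    qed
    define V where "V = measure lborel (cbox l r)"
    have V: "V \<ge> 0" by (simp add: V_def)
    have Ib: "norm (integral UNIV (\<lambda>z. dbar \<psi>' z * (ikap z * f n z))) \<le> A * q ^ n * V" for n
    proof -
      have eq: "integral UNIV (\<lambda>z. dbar \<psi>' z * (ikap z * f n z)) =
          integral (cbox l r) (\<lambda>z. dbar \<psi>' z * (ikap z * f n z))"
        by (rule integral_UNIV_eq_superset[OF _ lr]) (simp add: dbarC)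
      have "(\<lambda>z. dbar \<psi>' z * (ikap z * f n z)) integrable_on UNIV"
        by (intro integrable_dbar_mult[OF \<psi> C(1,3) \<delta>] planar_mult planar_ikap fpl)
      then have "(\<lambda>z. dbar \<psi>' z * (ikap z * f n z)) integrable_on cbox l r"
        using integrable_on_subcbox by blast
      then show ?thesis unfolding eq V_def using A q ib by (intro integrable_bound) auto
    qed
    define s where "s = norm w * L * B"
    have kb: "norm (kap w ^ n * y) \<le> s ^ n * norm y" for n y
    proof (induction n)
      case (Suc n)
      have "norm (kap w ^ Suc n * y) = norm (kap w * (kap w ^ n * y))" by (simp add: mult.assoc)
      also have "\<dots> \<le> norm (kap w) * norm (kap w ^ n * y) * B" by (rule B)
      also have "\<dots> \<le> (norm w * L) * (s ^ n * norm y) * B"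
        by (intro mult_right_mono mult_mono L Suc.IH) (use L B in auto)
      finally show ?case by (simp add: s_def mult_ac)
    qed simp
    have inv: "kap w ^ n * (ikap w ^ n * y) = y" for n y
    proof (induction n arbitrary: y)
      case (Suc n)
      have "kap w ^ Suc n * (ikap w ^ Suc n * y) = kap w * (kap w ^ n * (ikap w ^ n * (ikap w * y)))"
        by (simp only: power_Suc[of "kap w"] power_Suc2[of "ikap w"] mult.assoc)
      then show ?case using Suc.IH kap_ikap_mult[OF False] by simp
    qed simp
    \<comment> \<open>Multiplying the Cauchy formula by \<open>kap w ^ n\<close> and by the inverse
      \<open>d\<close> of the period isolates \<open>h w\<close>. Powers of \<open>kap w\<close> are
      bounded by \<open>s ^ n\<close>, those of the kernel on the varying part of the cutoff by
      \<open>q ^ n\<close>.\<close>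
    have "norm (h w) \<le> norm d * (A * V) * B * (s * q) ^ n" for n
    proof -
      have "h w = kap w ^ n * (d * (N * (ikap w ^ n * h w)))"
        using d(2) inv[of n "h w"] by (simp flip: mult.assoc[of d])
      also have "norm \<dots> \<le> s ^ n * norm (d * (N * (ikap w ^ n * h w)))" by (rule kb)
      also have "\<dots> \<le> s ^ n * (norm d * (A * q ^ n * V) * B)"
      proof (rule mult_left_mono)
        have "norm (d * (N * (ikap w ^ n * h w))) \<le> norm d * norm (N * (ikap w ^ n * h w)) * B" by (rule B)
        also have "\<dots> \<le> norm d * (A * q ^ n * V) * B"
          using Ib[of n] B(1) by (intro mult_right_mono mult_left_mono) (simp_all add: cf)
        finally show "norm (d * (N * (ikap w ^ n * h w))) \<le> norm d * (A * q ^ n * V) * B" .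
      qed (use L B in \<open>simp add: s_def\<close>)
      finally show ?thesis by (simp add: power_mult_distrib mult_ac)
    qed
    moreover have "(\<lambda>n. norm d * (A * V) * B * (s * q) ^ n) \<longlonglongrightarrow> norm d * (A * V) * B * 0"
    proof (intro tendsto_intros LIMSEQ_power_zero)
      have "norm w < 1 / (4 * L * B * M) * R"
        using w R by (simp add: c_def min_mult_distrib_right)
      then have "s * q < 1" using R L B M by (simp add: s_def q_def field_simps)
      moreover have "0 \<le> s * q" using q L B by (simp add: s_def)
      ultimately show "norm (s * q) < 1" by simp
    qed
    ultimately have "norm (h w) \<le> norm d * (A * V) * B * 0"
      by (intro LIMSEQ_le_const) auto
    then show ?thesis by simp
  qed
  with c that show ?thesis by blast
qed

end

section \<open>Linear systems with elliptic planes\<close>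

text \<open>
  A triple \<open>(u, v, c)\<close> stands for the equation \<open>\<partial>\<^sub>v f = c * \<partial>\<^sub>u f\<close>.
\<close>
definition solves ::
  "('x::euclidean_space \<times> 'x \<times> 'a::{euclidean_space,real_algebra_1}) set \<Rightarrow> ('x \<Rightarrow> 'a) \<Rightarrow> 'x set \<Rightarrow> bool" where
  "solves R f S \<longleftrightarrow>
     (\<forall>x\<in>S. \<exists>f'. (f has_derivative f') (at x) \<and> (\<forall>(u, v, c)\<in>R. f' v = c * f' u))"

definition plane_map :: "'x::euclidean_space \<Rightarrow> 'x \<Rightarrow> real \<times> real \<Rightarrow> 'x" where
  "plane_map u v z = fst z *\<^sub>R u + snd z *\<^sub>R v"

lemma linear_plane_map: "linear (plane_map u v)"
  by (auto intro!: linearI simp: plane_map_def algebra_simps)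

lemma continuous_on_plane_map [continuous_intros]:
  "continuous_on S f \<Longrightarrow> continuous_on S (\<lambda>x. plane_map u v (f x))"
  unfolding plane_map_def by (intro continuous_intros)

lemma norm_plane_map_le: "norm (plane_map u v z) \<le> (norm u + norm v) * norm z"
proof -
  have "norm (plane_map u v z) \<le> \<bar>fst z\<bar> * norm u + \<bar>snd z\<bar> * norm v"
    unfolding plane_map_def by (rule order_trans[OF norm_triangle_ineq]) simp
  also have "\<dots> \<le> norm z * norm u + norm z * norm v"
    using norm_fst_le[of "fst z" "snd z"] norm_snd_le[of "snd z" "fst z"]
    by (intro add_mono mult_right_mono) auto
  finally show ?thesis by (simp add: algebra_simps)
qed

lemma solves_subset: "solves R f S \<Longrightarrow> T \<subseteq> S \<Longrightarrow> solves R f T"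
  by (auto simp: solves_def)

lemma solves_isCont: "solves R f S \<Longrightarrow> x \<in> S \<Longrightarrow> isCont f x"
  using has_derivative_continuous by (fastforce simp: solves_def)

lemma solves_transform:
  assumes "solves R f S" "open S" "\<And>x. x \<in> S \<Longrightarrow> f x = g x"
  shows "solves R g S"
  unfolding solves_def
proof
  fix x assume x: "x \<in> S"
  then obtain f' where f': "(f has_derivative f') (at x)" "\<forall>(u, v, c)\<in>R. f' v = c * f' u"
    using assms(1) by (auto simp: solves_def)
  then have "(g has_derivative f') (at x)"
    using has_derivative_transform_within_open[OF f'(1) assms(2) x assms(3)] by blast
  with f'(2) show "\<exists>f'. (g has_derivative f') (at x) \<and> (\<forall>(u, v, c)\<in>R. f' v = c * f' u)" by blast
qed

lemma solves_locally:
  assumes "\<And>x. x \<in> S \<Longrightarrow> \<exists>T. x \<in> T \<and> solves R f T"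
  shows "solves R f S"
  using assms unfolding solves_def by blast

lemma solves_mult_central:
  assumes "solves R f S" "central d"
  shows "solves R (\<lambda>x. d * f x) S"
  unfolding solves_def
proof
  fix x assume "x \<in> S"
  then obtain f' where f': "(f has_derivative f') (at x)" "\<forall>(u, v, c)\<in>R. f' v = c * f' u"
    using assms(1) by (auto simp: solves_def)
  have "((\<lambda>x. d * f x) has_derivative (\<lambda>h. d * f' h)) (at x)"
    by (rule bounded_linear.has_derivative[OF mult.bounded_linear_right f'(1)])
  moreover have "\<forall>(u, v, c)\<in>R. d * f' v = c * (d * f' u)"
    using f'(2) central_left_commute[OF assms(2)] by auto
  ultimately show "\<exists>g'. ((\<lambda>x. d * f x) has_derivative g') (at x) \<and> (\<forall>(u, v, c)\<in>R. g' v = c * g' u)"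
    by (intro exI[of _ "\<lambda>h. d * f' h"]) simp
qed

lemma solves_plane_has_derivative:
  assumes "(f has_derivative f') (at (x + plane_map u v z))"
  shows "((\<lambda>z. f (x + plane_map u v z)) has_derivative (\<lambda>h. f' (plane_map u v h))) (at z)"
proof -
  have "(plane_map u v has_derivative plane_map u v) (at z)"
    using linear_plane_map linear_imp_has_derivative by blast
  from has_derivative_add[OF has_derivative_const[of x] this]
  have "((\<lambda>z. x + plane_map u v z) has_derivative plane_map u v) (at z)" by simp
  from has_derivative_compose[OF this, of f f'] assms show ?thesis by blast
qed

lemma solves_planar:
  assumes f: "solves R f S" and R: "(u, v, a) \<in> R" "elliptic a" and x: "x + plane_map u v z \<in> S"
  shows "elliptic_plane.planar a (\<lambda>z. f (x + plane_map u v z)) z"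
proof -
  interpret elliptic_plane a by (unfold_locales) (rule R(2))
  obtain f' where f': "(f has_derivative f') (at (x + plane_map u v z))" "\<forall>(u, v, c)\<in>R. f' v = c * f' u"
    using f x by (auto simp: solves_def)
  have "f' v = a * f' u" using f'(2) R(1) by auto
  then show ?thesis
    unfolding planar_def
    by (intro exI[of _ "\<lambda>h. f' (plane_map u v h)"] conjI solves_plane_has_derivative[OF f'(1)])
      (simp add: plane_map_def)
qed

section \<open>Averages of translates along a plane\<close>

lemma continuous_on_slice:
  assumes "continuous_on (S \<times> T) (\<lambda>(x, z). F x z)" "x \<in> S" "T' \<subseteq> T"
  shows "continuous_on T' (F x)"
proof -
  have "continuous_on T' (\<lambda>z. (\<lambda>(x, z). F x z) (x, z))"
    by (rule continuous_on_compose2[OF assms(1)]) (use assms(2,3) in \<open>auto intro!: continuous_intros\<close>)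
  then show ?thesis by simp
qed

text \<open>\<open>g\<close> is controlled only where \<open>x + plane_map u v z\<close> lies in
  \<open>G\<close>. Otherwise \<open>z\<close> is outside \<open>C\<close>, where the integrand
  vanishes; so two open sets with continuous restrictions cover the domain.\<close>

lemma kernel_param_continuous:
  fixes k :: "real \<times> real \<Rightarrow> 'a::{euclidean_space,real_algebra_1}" and g :: "'x::euclidean_space \<Rightarrow> 'a"
  assumes k: "continuous_on UNIV k" and C: "compact C" "\<And>z. z \<notin> C \<Longrightarrow> k z = 0"
    and g: "continuous_on G g" "open G" and S: "open S" "\<And>x z. x \<in> S \<Longrightarrow> z \<in> C \<Longrightarrow> x + plane_map u v z \<in> G"
  shows "continuous_on (S \<times> UNIV) (\<lambda>(x, z). k z * g (x + plane_map u v z))"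
proof -
  let ?F = "\<lambda>w. k (snd w) * g (fst w + plane_map u v (snd w))"
  define T1 where "T1 = S \<times> (- C)"
  define T2 where "T2 = (\<lambda>w. fst w + plane_map u v (snd w)) -` G"
  have "open T1" unfolding T1_def using S(1) C(1) compact_imp_closed by (intro open_Times) auto
  moreover have "open T2" unfolding T2_def by (intro open_vimage g(2) continuous_intros)
  moreover have "continuous_on T1 ?F"
    by (rule continuous_on_eq[OF continuous_on_const[of _ 0]]) (auto simp: T1_def C(2))
  moreover have "continuous_on T2 ?F"
    by (intro mult.continuous_on continuous_on_compose2[OF k] continuous_on_compose2[OF g(1)] continuous_intros)
      (auto simp: T2_def)
  ultimately have "continuous_on (T1 \<union> T2) ?F" by (rule continuous_on_open_Un)
  moreover have "S \<times> UNIV \<subseteq> T1 \<union> T2" using S(2) by (auto simp: T1_def T2_def)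
  ultimately show ?thesis unfolding case_prod_beta by (rule continuous_on_subset)
qed

lemma kernel_integral_continuous:
  fixes k :: "real \<times> real \<Rightarrow> 'a::{euclidean_space,real_algebra_1}" and g :: "'x::euclidean_space \<Rightarrow> 'a"
  assumes k: "continuous_on UNIV k" and C: "compact C" "\<And>z. z \<notin> C \<Longrightarrow> k z = 0"
    and g: "continuous_on G g" "open G" and S: "open S" "\<And>x z. x \<in> S \<Longrightarrow> z \<in> C \<Longrightarrow> x + plane_map u v z \<in> G"
  shows "continuous_on S (\<lambda>x. integral UNIV (\<lambda>z. k z * g (x + plane_map u v z)))"
proof -
  obtain l r where lr: "C \<subseteq> cbox l r"
    using bounded_subset_cbox_symmetric[OF compact_imp_bounded[OF C(1)]] by blast
  have "integral UNIV (\<lambda>z. k z * g (x + plane_map u v z)) =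
      integral (cbox l r) (\<lambda>z. k z * g (x + plane_map u v z))" for x
    by (rule integral_UNIV_eq_superset[OF _ lr]) (simp add: C(2))
  moreover have "continuous_on S (\<lambda>x. integral (cbox l r) (\<lambda>z. k z * g (x + plane_map u v z)))"
    by (rule integral_continuous_on_param)
      (rule continuous_on_subset[OF kernel_param_continuous[OF assms]], auto)
  ultimately show ?thesis by simp
qed

text \<open>The spanning directions are those along which regularity and unique continuation are
  proved: both directions of an elliptic equation, and directions \<open>v\<close> with coefficient
  0, along which solutions are locally constant.\<close>

locale linear_system =
  fixes R :: "('x::euclidean_space \<times> 'x \<times> 'a::{euclidean_space,real_algebra_1}) set"
  assumes central_R: "(u, v, c) \<in> R \<Longrightarrow> central c"
    and span_R: "span ({u. \<exists>v c. (u, v, c) \<in> R \<and> elliptic c} \<union>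
      {v. \<exists>u c. (u, v, c) \<in> R \<and> (elliptic c \<or> c = 0)}) = UNIV"
begin

text \<open>The Cauchy formula for the derivative writes \<open>D x u\<close> through
  \<open>f x\<close> and an integral of \<open>f\<close> over a piece of the plane through
  \<open>x\<close>, and both depend continuously on \<open>x\<close>.\<close>

lemma continuous_elliptic_derivative:
  assumes f: "open G" "\<And>x. x \<in> G \<Longrightarrow> (f has_derivative D x) (at x)"
    "\<And>x u v c. x \<in> G \<Longrightarrow> (u, v, c) \<in> R \<Longrightarrow> D x v = c * D x u"
    and R: "(u, v, a) \<in> R" "elliptic a"
  shows "continuous_on G (\<lambda>x. D x u)"
proof -
  interpret elliptic_plane a by unfold_locales (rule R(2))
  have sf: "solves R f G" using f by (fastforce simp: solves_def)
  have cf: "continuous_on G f"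
    using has_derivative_continuous[OF f(2)] by (intro continuous_at_imp_continuous_on) auto
  have "isCont (\<lambda>x. D x u) x0" if x0: "x0 \<in> G" for x0
  proof -
    obtain \<rho> where \<rho>: "\<rho> > 0" "ball x0 \<rho> \<subseteq> G" using f(1) x0 openE by blast
    define K where "K = norm u + norm v + 1"
    have K: "K > 0" by (simp add: K_def add_nonneg_pos)
    \<comment> \<open>\<open>K\<close> bounds the plane map, so the support of the cutoff moves
      points by at most \<open>\<rho> / 2\<close>.\<close>
    define r where "r = \<rho> / (2 * K)"
    have r: "r > 0" using \<rho> K by (simp add: r_def)
    obtain \<psi> \<psi>' G1 C where \<psi>: "C1_function \<psi> \<psi>'" and G1: "cball 0 (r / 2) \<subseteq> G1" "\<And>z. z \<in> G1 \<Longrightarrow> \<psi> z = 1"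
      and C: "compact C" "C \<subseteq> ball 0 r" "\<And>z::real \<times> real. z \<notin> C \<Longrightarrow> \<psi> z = 0"
      by (rule C1_cutoff_exists[of "cball (0::real \<times> real) (r / 2)" "ball 0 r"]) (use r in auto)
    have "ball 0 (r / 2) \<subseteq> G1" using G1(1) ball_subset_cball by blast
    then have \<delta>: "r / 2 > 0" "\<And>z. z \<in> ball 0 (r / 2) \<Longrightarrow> \<psi> z = 1" using r by (simp, blast intro: G1(2))
    have inG: "x + plane_map u v z \<in> G" if "x \<in> ball x0 (\<rho> / 2)" "z \<in> C" for x z
    proof -
      have "norm (plane_map u v z) \<le> (norm u + norm v) * norm z" by (rule norm_plane_map_le)
      also have "\<dots> \<le> K * r" using that(2) C(2) r by (intro mult_mono) (auto simp: K_def)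
      also have "\<dots> = \<rho> / 2" using K by (simp add: r_def)
      finally have "dist x0 (x + plane_map u v z) < \<rho>"
        using that(1) norm_triangle_ineq4[of "x0 - x" "plane_map u v z"] by (simp add: dist_norm diff_diff_eq)
      then show ?thesis using \<rho>(2) by auto
    qed
    define N where "N = integral UNIV (\<lambda>z. dbar \<psi>' z * ikap z)"
    define P where "P = integral UNIV (\<lambda>z. dbar \<psi>' z * (ikap z * ikap z))"
    define J where "J x = integral UNIV (\<lambda>z. dbar \<psi>' z * (ikap z * ikap z) * f (x + plane_map u v z))" for x
    obtain d where d: "central d" "d * N = 1"
      using period_invertible[OF \<psi> C(1,3) \<delta>] unfolding N_def by metis
    have eq: "D x u = d * (J x - P * f x)" if x: "x \<in> ball x0 (\<rho> / 2)" for x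
    proof -
      have xG: "x \<in> G" using x \<rho> by auto
      have "((\<lambda>z. f (x + plane_map u v z)) has_derivative (\<lambda>h. D x (plane_map u v h))) (at 0)"
        by (rule solves_plane_has_derivative) (use f(2)[OF xG] in \<open>simp add: plane_map_def\<close>)
      then have "J x = P * f x + N * D x u"
        using cauchy_formula_derivative[OF \<psi> C(1,3) \<delta> solves_planar[OF sf R inG[OF x]],
            of "\<lambda>h. D x (plane_map u v h)"] f(3)[OF xG R(1)]
        by (simp add: J_def P_def N_def plane_map_def mult.assoc)
      then show ?thesis using d(2) by (simp flip: mult.assoc)
    qed
    have "continuous_on (ball x0 (\<rho> / 2)) J"
      unfolding J_def
    proof (rule kernel_integral_continuous[OF _ C(1) _ cf f(1) open_ball inG])
      show "continuous_on UNIV (\<lambda>z. dbar \<psi>' z * (ikap z * ikap z))"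
        by (intro continuous_at_imp_continuous_on ballI isCont_dbar_mult[OF \<psi> C(1,3) \<delta>]
            planar_isCont planar_mult planar_ikap)
      have "open (- C)" using C(1) compact_imp_closed by auto
      then show "dbar \<psi>' z * (ikap z * ikap z) = 0" if "z \<notin> C" for z
        using dbar_locally_const[OF \<psi>, of "- C" z 0] that C(3) by simp
    qed
    then have "continuous_on (ball x0 (\<rho> / 2)) (\<lambda>x. d * (J x - P * f x))"
      by (intro mult.continuous_on continuous_intros continuous_on_subset[OF cf]) (use \<rho> in auto)
    then have "continuous_on (ball x0 (\<rho> / 2)) (\<lambda>x. D x u)"
      by (rule continuous_on_eq) (simp add: eq)
    then show ?thesis using \<rho>(1) by (simp add: continuous_on_eq_continuous_at)
  qed
  then show ?thesis by (intro continuous_at_imp_continuous_on) auto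
qed

text \<open>Continuity passes from the spanning directions to all of them by linearity of
  \<open>D x\<close>. It is what the Leibniz rule for kernel integrals requires.\<close>

lemma solves_C1:
  assumes "solves R f G" "open G"
  obtains D where "\<And>x. x \<in> G \<Longrightarrow> (f has_derivative D x) (at x)"
    "\<And>x u v c. x \<in> G \<Longrightarrow> (u, v, c) \<in> R \<Longrightarrow> D x v = c * D x u"
    "\<And>h. continuous_on G (\<lambda>x. D x h)"
proof -
  have "\<forall>x\<in>G. \<exists>f'. (f has_derivative f') (at x) \<and> (\<forall>(u, v, c)\<in>R. f' v = c * f' u)"
    using assms(1) by (simp add: solves_def)
  then obtain D where D: "\<And>x. x \<in> G \<Longrightarrow> (f has_derivative D x) (at x) \<and> (\<forall>(u, v, c)\<in>R. D x v = c * D x u)"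
    by metis
  then have D1: "\<And>x. x \<in> G \<Longrightarrow> (f has_derivative D x) (at x)"
    and D2: "\<And>x u v c. x \<in> G \<Longrightarrow> (u, v, c) \<in> R \<Longrightarrow> D x v = c * D x u" by blast+
  have "continuous_on G (\<lambda>x. D x h)" for h
  proof -
    have "h \<in> span ({u. \<exists>v c. (u, v, c) \<in> R \<and> elliptic c} \<union>
      {v. \<exists>u c. (u, v, c) \<in> R \<and> (elliptic c \<or> c = 0)})" by (simp add: span_R)
    then show ?thesis
    proof (induction rule: span_induct_alt)
      case base
      show ?case
        by (rule continuous_on_eq[OF continuous_on_const[of _ 0]])
          (use D1 has_derivative_linear linear_0 in metis)
    next
      case (step s b h)
      have b: "continuous_on G (\<lambda>x. D x b)"
      proof -
        consider v c where "(b, v, c) \<in> R" "elliptic c" | u c where "(u, b, c) \<in> R" "elliptic c"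
          | u where "(u, b, 0) \<in> R" using step.hyps by blast
        then show ?thesis
        proof cases
          case 1 then show ?thesis using continuous_elliptic_derivative[OF assms(2) D1 D2] by blast
        next
          case 2
          have "continuous_on G (\<lambda>x. c * D x u)"
            by (intro mult.continuous_on continuous_intros continuous_elliptic_derivative[OF assms(2) D1 D2 2])
          then show ?thesis by (rule continuous_on_eq) (use D2 2 in auto)
        next
          case 3
          show ?thesis
            by (rule continuous_on_eq[OF continuous_on_const[of _ 0]]) (use D2[OF _ 3] in auto)
        qed
      qed
      have "continuous_on G (\<lambda>x. s *\<^sub>R D x b + D x h)" by (intro continuous_intros b step.IH)
      then show ?case
        by (rule continuous_on_eq)
          (use D1 has_derivative_linear linear_add linear_cmul in metis)
    qed
  qed
  with D1 D2 that show ?thesis by blast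
qed

text \<open>Differentiation under the integral turns the derivative of the average into the average
  of the derivatives; a coefficient \<open>c\<close> moves past the kernel because the kernel is
  central.\<close>

lemma kernel_integral_solves:
  assumes k: "continuous_on UNIV k" "\<And>z. central (k z)" and C: "compact C" "\<And>z. z \<notin> C \<Longrightarrow> k z = 0"
    and f: "solves R f G" "open G"
    and S: "\<And>x z. x \<in> ball x0 \<rho> \<Longrightarrow> z \<in> C \<Longrightarrow> x + plane_map u v z \<in> G"
  shows "solves R (\<lambda>x. integral UNIV (\<lambda>z. k z * f (x + plane_map u v z))) (ball x0 \<rho>)"
proof -
  let ?S = "ball x0 \<rho>"
  obtain D where D: "\<And>x. x \<in> G \<Longrightarrow> (f has_derivative D x) (at x)"
    "\<And>x u v c. x \<in> G \<Longrightarrow> (u, v, c) \<in> R \<Longrightarrow> D x v = c * D x u"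
    "\<And>h. continuous_on G (\<lambda>x. D x h)"
    using solves_C1[OF f] by blast
  have cf: "continuous_on G f"
    using solves_isCont[OF f(1)] by (intro continuous_at_imp_continuous_on) auto
  obtain l r where lr: "C \<subseteq> cbox l r"
    using bounded_subset_cbox_symmetric[OF compact_imp_bounded[OF C(1)]] by blast
  have toC: "integral UNIV (\<lambda>z. k z * g z) = integral (cbox l r) (\<lambda>z. k z * g z)" for g
    by (rule integral_UNIV_eq_superset[OF _ lr]) (simp add: C(2))
  \<comment> \<open>\<open>D\<close> is known only on \<open>G\<close>. For \<open>z\<close> outside
    \<open>C\<close> the translate may leave \<open>G\<close>, but the kernel factor is 0, so the
    derivative is set to 0.\<close>
  define E where "E x z h = (if z \<in> C then k z * D (x + plane_map u v z) h else 0)" for x z h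
  have E: "E x z h = k z * D (x + plane_map u v z) h" for x z h using C(2) by (simp add: E_def)
  have blE: "bounded_linear (E x z)" if "x \<in> ?S" for x z
  proof (cases "z \<in> C")
    case True
    have "bounded_linear (D (x + plane_map u v z))"
      using D(1)[OF S[OF that True]] has_derivative_bounded_linear by blast
    then show ?thesis
      using True bounded_linear_compose[OF mult.bounded_linear_right] by (simp add: E_def[abs_def])
  qed (simp add: E_def[abs_def])
  \<comment> \<open>The Leibniz rule asks for continuity as a map into bounded linear operators; in
    finite dimension it follows from continuity on each basis vector.\<close>
  define B where "B x z = Blinfun (E x z)" for x z
  have B: "blinfun_apply (B x z) = E x z" if "x \<in> ?S" for x z
    by (simp add: B_def bounded_linear_Blinfun_apply[OF blE[OF that]])
  have cE: "continuous_on (?S \<times> cbox l r) (\<lambda>(x, z). k z * D (x + plane_map u v z) h)" for h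
    using continuous_on_subset[OF kernel_param_continuous[OF k(1) C D(3) f(2) open_ball S]] by blast
  have cB: "continuous_on (?S \<times> cbox l r) (\<lambda>(x, z). B x z)"
    unfolding case_prod_beta
  proof (rule continuous_on_blinfun_componentwise)
    fix h :: 'x assume "h \<in> Basis"
    show "continuous_on (?S \<times> cbox l r) (\<lambda>w. blinfun_apply (B (fst w) (snd w)) h)"
      by (rule continuous_on_eq[OF cE[of h, unfolded case_prod_beta]]) (auto simp: B E)
  qed
  have "((\<lambda>x. k z * f (x + plane_map u v z)) has_derivative blinfun_apply (B x z)) (at x within ?S)"
    if x: "x \<in> ?S" for x z
  proof (cases "z \<in> C")
    case True
    have "((\<lambda>x. x + plane_map u v z) has_derivative (\<lambda>h. h)) (at x within ?S)"
      using has_derivative_add[OF has_derivative_ident has_derivative_const[of "plane_map u v z"]] by simp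
    from has_derivative_compose[OF this D(1)[OF S[OF x True]]]
    have "((\<lambda>x. f (x + plane_map u v z)) has_derivative D (x + plane_map u v z)) (at x within ?S)" .
    from bounded_linear.has_derivative[OF mult.bounded_linear_right this, of "k z"]
    show ?thesis using E by (simp add: B[OF x] E_def[abs_def] True)
  next
    case False
    then show ?thesis by (simp add: B[OF x] C(2) E_def[abs_def])
  qed
  moreover have "(\<lambda>z. k z * f (x + plane_map u v z)) integrable_on cbox l r" if "x \<in> ?S" for x
    by (rule integrable_continuous[OF continuous_on_slice[OF kernel_param_continuous[OF k(1) C cf f(2) open_ball S] that]]) auto
  ultimately have L: "((\<lambda>x. integral (cbox l r) (\<lambda>z. k z * f (x + plane_map u v z))) has_derivative
      blinfun_apply (integral (cbox l r) (B x))) (at x within ?S)" if "x \<in> ?S" for x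
    using that cB by (intro leibniz_rule) auto
  have int: "blinfun_apply (integral (cbox l r) (B x)) h = integral (cbox l r) (\<lambda>z. k z * D (x + plane_map u v z) h)"
    if x: "x \<in> ?S" for x h
  proof -
    have "continuous_on (cbox l r) (B x)"
      by (rule continuous_on_slice[OF cB x subset_refl])
    then have "B x integrable_on cbox l r" by (rule integrable_continuous)
    then show ?thesis
      using blinfun_apply_integral[of "B x" "cbox l r" h] by (simp add: B[OF x] E)
  qed
  show ?thesis
    unfolding solves_def
  proof
    fix x assume x: "x \<in> ?S"
    let ?D = "blinfun_apply (integral (cbox l r) (B x))"
    have "((\<lambda>x. integral UNIV (\<lambda>z. k z * f (x + plane_map u v z))) has_derivative ?D) (at x)"
      using L[OF x] unfolding toC at_within_open[OF x open_ball] .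
    moreover have "?D v' = c * ?D u'" if R: "(u', v', c) \<in> R" for u' v' c
    proof -
      have "integral (cbox l r) (\<lambda>z. k z * D (x + plane_map u v z) v') =
          integral (cbox l r) (\<lambda>z. c * (k z * D (x + plane_map u v z) u'))"
      proof (rule integral_cong)
        fix z
        show "k z * D (x + plane_map u v z) v' = c * (k z * D (x + plane_map u v z) u')"
        proof (cases "z \<in> C")
          case True
          then show ?thesis using D(2)[OF S[OF x True] R] central_left_commute[OF k(2)] by simp
        qed (simp add: C(2))
      qed
      also have "\<dots> = c * integral (cbox l r) (\<lambda>z. k z * D (x + plane_map u v z) u')"
      proof -
        have "(\<lambda>z. k z * D (x + plane_map u v z) u') integrable_on cbox l r"
          by (rule integrable_continuous[OF continuous_on_slice[OF cE x subset_refl]])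
        from integral_linear[OF this mult.bounded_linear_right[of c]] show ?thesis by (simp add: o_def)
      qed
      finally show ?thesis by (simp add: int[OF x])
    qed
    ultimately show "\<exists>f'. ((\<lambda>x. integral UNIV (\<lambda>z. k z * f (x + plane_map u v z))) has_derivative f') (at x) \<and>
        (\<forall>(u, v, c)\<in>R. f' v = c * f' u)" by blast
  qed
qed

end

context linear_system
begin

subsection \<open>Unique continuation\<close>

definition zero_near :: "('x \<Rightarrow> 'a) \<Rightarrow> 'x \<Rightarrow> bool" where
  "zero_near f x \<longleftrightarrow> (\<exists>\<sigma>>0. \<forall>y\<in>ball x \<sigma>. f y = 0)"

text \<open>\<open>c\<close> is chosen before the point and the radius. This uniformity makes the
  directions closed under addition and the zero set closed in \<open>G\<close>.\<close>

definition propagates :: "('x \<Rightarrow> 'a) \<Rightarrow> 'x set \<Rightarrow> 'x \<Rightarrow> bool" where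
  "propagates f G h \<longleftrightarrow> (\<exists>c>0. \<forall>\<rho>>0. \<forall>x t. zero_near f x \<longrightarrow> ball x \<rho> \<subseteq> G \<longrightarrow> \<bar>t\<bar> < c * \<rho> \<longrightarrow>
     zero_near f (x + t *\<^sub>R h))"

lemma propagatesE:
  assumes "propagates f G h"
  obtains c where "c > 0"
    "\<And>\<rho> x t. \<rho> > 0 \<Longrightarrow> zero_near f x \<Longrightarrow> ball x \<rho> \<subseteq> G \<Longrightarrow> \<bar>t\<bar> < c * \<rho> \<Longrightarrow> zero_near f (x + t *\<^sub>R h)"
proof -
  obtain c where c: "c > 0" and *: "\<forall>\<rho>>0. \<forall>x t. zero_near f x \<longrightarrow> ball x \<rho> \<subseteq> G \<longrightarrow> \<bar>t\<bar> < c * \<rho> \<longrightarrow>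
      zero_near f (x + t *\<^sub>R h)"
    using assms unfolding propagates_def by (elim exE conjE)
  show ?thesis by (rule that[OF c]) (use * in simp)
qed

lemma propagatesI:
  assumes "c > 0"
    "\<And>\<rho> x t. \<rho> > 0 \<Longrightarrow> zero_near f x \<Longrightarrow> ball x \<rho> \<subseteq> G \<Longrightarrow> \<bar>t\<bar> < c * \<rho> \<Longrightarrow> zero_near f (x + t *\<^sub>R h)"
  shows "propagates f G h"
  unfolding propagates_def using assms by (intro exI[of _ c] conjI allI impI)

lemma propagates_subspace: "subspace {h. propagates f G h}"
  unfolding subspace_def mem_Collect_eq
proof (intro conjI allI ballI)
  show "propagates f G 0" unfolding propagates_def by (intro exI[of _ 1]) simp
next
  fix h k assume "h \<in> {h. propagates f G h}" "k \<in> {h. propagates f G h}"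
  then have "propagates f G h" "propagates f G k" by auto
  from this(1) obtain c where c: "c > 0"
    "\<And>\<rho> x t. \<rho> > 0 \<Longrightarrow> zero_near f x \<Longrightarrow> ball x \<rho> \<subseteq> G \<Longrightarrow> \<bar>t\<bar> < c * \<rho> \<Longrightarrow> zero_near f (x + t *\<^sub>R h)"
    using propagatesE by metis
  from \<open>propagates f G k\<close> obtain d where d: "d > 0"
    "\<And>\<rho> x t. \<rho> > 0 \<Longrightarrow> zero_near f x \<Longrightarrow> ball x \<rho> \<subseteq> G \<Longrightarrow> \<bar>t\<bar> < d * \<rho> \<Longrightarrow> zero_near f (x + t *\<^sub>R k)"
    using propagatesE by metis
  \<comment> \<open>The first move, along \<open>h\<close>, uses the full ball. The bound with
    \<open>norm h + 1\<close> keeps the ball of radius \<open>\<rho> / 2\<close> about the new point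
    inside it, and \<open>d / 2\<close> allows the second move there.\<close>
  define b where "b = min c (min (d / 2) (1 / (2 * (norm h + 1))))"
  have h1: "norm h + 1 > 0" by (simp add: add_nonneg_pos)
  have b: "b > 0" using c d h1 by (simp add: b_def)
  have "zero_near f (x + t *\<^sub>R (h + k))" if \<rho>: "\<rho> > 0" and x: "zero_near f x" "ball x \<rho> \<subseteq> G" and t: "\<bar>t\<bar> < b * \<rho>"
    for \<rho> x t
  proof -
    have "b * \<rho> \<le> c * \<rho>" "b * \<rho> \<le> (d / 2) * \<rho>" "b * \<rho> \<le> 1 / (2 * (norm h + 1)) * \<rho>"
      using \<rho> by (intro mult_right_mono; simp add: b_def)+
    then have t': "\<bar>t\<bar> < c * \<rho>" "\<bar>t\<bar> < d * (\<rho> / 2)" "\<bar>t\<bar> < \<rho> / (2 * (norm h + 1))" using t by auto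
    have "\<bar>t\<bar> * norm h \<le> \<bar>t\<bar> * (norm h + 1)" by (intro mult_left_mono) auto
    also have "\<dots> < \<rho> / 2" using t'(3) h1 by (simp add: field_simps)
    finally have "ball (x + t *\<^sub>R h) (\<rho> / 2) \<subseteq> ball x \<rho>"
      by (intro ball_subset_ball_iff[THEN iffD2]) (simp add: dist_norm)
    then have "zero_near f (x + t *\<^sub>R h + t *\<^sub>R k)"
      using \<rho> x t' by (intro d(2)[of "\<rho> / 2"] c(2)[of \<rho>]) auto
    then show ?thesis by (simp add: algebra_simps)
  qed
  note * = this
  show "propagates f G (h + k)" by (rule propagatesI[OF b]) (rule *)
next
  fix s :: real and h assume "h \<in> {h. propagates f G h}"
  then have "propagates f G h" by simp
  then obtain c where c: "c > 0"
    "\<And>\<rho> x t. \<rho> > 0 \<Longrightarrow> zero_near f x \<Longrightarrow> ball x \<rho> \<subseteq> G \<Longrightarrow> \<bar>t\<bar> < c * \<rho> \<Longrightarrow> zero_near f (x + t *\<^sub>R h)"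
    using propagatesE by metis
  have s1: "\<bar>s\<bar> + 1 > 0" by simp
  have *: "zero_near f (x + t *\<^sub>R (s *\<^sub>R h))" if "\<rho> > 0" "zero_near f x" "ball x \<rho> \<subseteq> G" "\<bar>t\<bar> < c / (\<bar>s\<bar> + 1) * \<rho>"
    for \<rho> x t
  proof -
    have "\<bar>t * s\<bar> \<le> \<bar>t\<bar> * (\<bar>s\<bar> + 1)" by (simp add: abs_mult mult_left_mono)
    also have "\<dots> < c * \<rho>" using that(4) s1 by (simp add: field_simps)
    finally have "zero_near f (x + (t * s) *\<^sub>R h)" by (rule c(2)[OF that(1-3)])
    then show ?thesis by simp
  qed
  have "c / (\<bar>s\<bar> + 1) > 0" using c(1) s1 by simp
  then show "propagates f G (s *\<^sub>R h)" by (rule propagatesI) (rule *)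
qed

text \<open>The planar identity theorem is applied in the plane through each \<open>y\<close> close
  to \<open>x\<close>. Its reach is governed by the radius \<open>\<rho>\<close> of existence and
  not by the size of the initial zero set, hence a uniform speed.\<close>

lemma propagates_plane:
  assumes f: "solves R f G" and R: "(u, v, a) \<in> R" "elliptic a"
  shows "propagates f G (plane_map u v w)"
proof -
  interpret elliptic_plane a by unfold_locales (rule R(2))
  obtain c where c: "c > 0" "\<And>h \<rho> \<sigma> w. \<lbrakk>\<And>z. z \<in> ball 0 \<rho> \<Longrightarrow> planar h z; \<sigma> > 0; \<And>z. z \<in> ball 0 \<sigma> \<Longrightarrow> h z = 0;
      norm w < c * \<rho>\<rbrakk> \<Longrightarrow> h w = 0"
    using planar_identity by blast
  define K where "K = norm u + norm v + 1"
  have K: "K > 0" by (simp add: K_def add_nonneg_pos)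
  have pK: "norm (plane_map u v z) \<le> K * norm z" for z
    using norm_plane_map_le[of u v z] mult_right_mono[of "norm u + norm v" K "norm z"] by (simp add: K_def)
  define W where "W = norm w + 1"
  define b where "b = c / (2 * K * W)"
  have w1: "W > 0" by (simp add: W_def add_nonneg_pos)
  have b: "b > 0" using c K w1 by (simp add: b_def)
  have "zero_near f (x + t *\<^sub>R plane_map u v w)"
    if \<rho>: "\<rho> > 0" and x: "zero_near f x" "ball x \<rho> \<subseteq> G" and t: "\<bar>t\<bar> < b * \<rho>" for \<rho> x t
  proof -
    obtain \<sigma>0 where \<sigma>0: "\<sigma>0 > 0" "\<And>y. y \<in> ball x \<sigma>0 \<Longrightarrow> f y = 0" using x(1) by (auto simp: zero_near_def)
    define \<sigma> where "\<sigma> = min \<sigma>0 \<rho>"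
    have \<sigma>: "\<sigma> > 0" "\<sigma> \<le> \<rho>" "\<And>y. y \<in> ball x \<sigma> \<Longrightarrow> f y = 0" using \<sigma>0 \<rho> by (auto simp: \<sigma>_def)
    have "f (y + t *\<^sub>R plane_map u v w) = 0" if y: "y \<in> ball x (\<sigma> / 2)" for y
    proof -
      have near: "y + plane_map u v z \<in> ball x \<tau>" if "norm z < \<tau> / (2 * K)" "\<sigma> \<le> \<tau>" for z \<tau>
      proof -
        have "K * norm z < \<tau> / 2" using that(1) K by (simp add: field_simps)
        then have "norm (plane_map u v z) < \<tau> / 2" using pK[of z] by linarith
        moreover have "dist x (y + plane_map u v z) \<le> dist x y + norm (plane_map u v z)"
          using dist_triangle[of x "y + plane_map u v z" y] by (simp add: dist_norm)
        ultimately show ?thesis using y that(2) by simp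
      qed
      have "(\<lambda>z. f (y + plane_map u v z)) (t *\<^sub>R w) = 0"
      proof (rule c(2)[of "\<rho> / (2 * K)" _ "\<sigma> / (2 * K)"])
        show "planar (\<lambda>z. f (y + plane_map u v z)) z" if "z \<in> ball 0 (\<rho> / (2 * K))" for z
          by (rule solves_planar[OF f R]) (use near[of z \<rho>] that \<sigma>(2) x(2) in auto)
        show "\<sigma> / (2 * K) > 0" using \<sigma>(1) K by simp
        show "f (y + plane_map u v z) = 0" if "z \<in> ball 0 (\<sigma> / (2 * K))" for z
          by (rule \<sigma>(3), rule near) (use that in auto)
        have "\<bar>t\<bar> * norm w \<le> \<bar>t\<bar> * W" by (intro mult_left_mono) (auto simp: W_def)
        also have "\<dots> < b * \<rho> * W" using t w1 by (intro mult_strict_right_mono)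
        also have "\<dots> = c * (\<rho> / (2 * K))" using w1 K by (simp add: b_def field_simps)
        finally show "norm (t *\<^sub>R w) < c * (\<rho> / (2 * K))" by simp
      qed
      then show ?thesis by (simp add: linear_cmul[OF linear_plane_map])
    qed
    then have "\<forall>y\<in>ball (x + t *\<^sub>R plane_map u v w) (\<sigma> / 2). f y = 0"
    proof (intro ballI)
      fix y assume *: "\<And>y. y \<in> ball x (\<sigma> / 2) \<Longrightarrow> f (y + t *\<^sub>R plane_map u v w) = 0"
        and "y \<in> ball (x + t *\<^sub>R plane_map u v w) (\<sigma> / 2)"
      then have "y - t *\<^sub>R plane_map u v w \<in> ball x (\<sigma> / 2)" by (simp add: dist_norm algebra_simps)
      from *[OF this] show "f y = 0" by simp
    qed
    then show ?thesis unfolding zero_near_def using \<sigma>(1) half_gt_zero by blast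
  qed
  note * = this
  show ?thesis by (rule propagatesI[OF b]) (rule *)
qed

text \<open>With coefficient 0 the derivative along \<open>v\<close> vanishes, so \<open>f\<close>
  is constant on segments in \<open>G\<close> parallel to \<open>v\<close>.\<close>

lemma propagates_constant:
  assumes f: "solves R f G" and R: "(u, v, 0) \<in> R"
  shows "propagates f G v"
proof -
  define b where "b = 1 / (2 * (norm v + 1))"
  have v1: "norm v + 1 > 0" by (simp add: add_nonneg_pos)
  have b: "b > 0" using v1 by (simp add: b_def)
  have "zero_near f (x + t *\<^sub>R v)"
    if \<rho>: "\<rho> > 0" and x: "zero_near f x" "ball x \<rho> \<subseteq> G" and t: "\<bar>t\<bar> < b * \<rho>" for \<rho> x t
  proof -
    obtain \<sigma>0 where \<sigma>0: "\<sigma>0 > 0" "\<And>y. y \<in> ball x \<sigma>0 \<Longrightarrow> f y = 0" using x(1) by (auto simp: zero_near_def)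
    define \<sigma> where "\<sigma> = min \<sigma>0 (\<rho> / 2)"
    have \<sigma>: "\<sigma> > 0" "\<sigma> \<le> \<rho> / 2" "\<And>y. y \<in> ball x \<sigma> \<Longrightarrow> f y = 0" using \<sigma>0 \<rho> by (auto simp: \<sigma>_def)
    have "f y = 0" if y: "y \<in> ball (x + t *\<^sub>R v) \<sigma>" for y
    proof -
      have "\<bar>t\<bar> * norm v \<le> \<bar>t\<bar> * (norm v + 1)" by (intro mult_left_mono) auto
      also have "\<dots> < \<rho> / 2" using t v1 by (simp add: b_def field_simps)
      finally have tv: "norm (t *\<^sub>R v) < \<rho> / 2" by simp
      have y0: "y - t *\<^sub>R v \<in> ball x \<sigma>" using y by (simp add: dist_norm algebra_simps)
      define q where "q s = (y - t *\<^sub>R v) + s *\<^sub>R (t *\<^sub>R v)" for s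
      have qG: "q s \<in> G" if s: "s \<in> {0..1}" for s
      proof -
        have "norm (s *\<^sub>R (t *\<^sub>R v)) \<le> 1 * norm (t *\<^sub>R v)"
          unfolding norm_scaleR[of s] using s by (intro mult_right_mono) auto
        moreover have "dist x (q s) \<le> dist x (y - t *\<^sub>R v) + norm (s *\<^sub>R (t *\<^sub>R v))"
          using dist_triangle[of x "q s" "y - t *\<^sub>R v"] by (simp add: dist_norm q_def)
        ultimately have "dist x (q s) < \<rho>" using y0 \<sigma>(2) tv by simp
        then show ?thesis using x(2) by auto
      qed
      have "((\<lambda>s. f (q s)) has_derivative (\<lambda>h. 0)) (at s within {0..1})" if s: "s \<in> {0..1}" for s
      proof -
        obtain f' where f': "(f has_derivative f') (at (q s))" "\<forall>(u, v, c)\<in>R. f' v = c * f' u"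
          using f qG[OF s] by (auto simp: solves_def)
        have lin: "linear f'" using f'(1) has_derivative_linear by blast
        have "f' v = 0" using f'(2) R by auto
        then have z: "f' (h *\<^sub>R (t *\<^sub>R v)) = 0" for h by (simp add: linear_cmul[OF lin])
        have "(q has_derivative (\<lambda>h. h *\<^sub>R (t *\<^sub>R v))) (at s within {0..1})"
          unfolding q_def by (auto intro!: derivative_eq_intros)
        from has_derivative_compose[OF this f'(1)] show ?thesis unfolding z .
      qed
      then obtain c where "\<And>s. s \<in> {0..1} \<Longrightarrow> f (q s) = c"
        using has_derivative_zero_constant[of "{0..1::real}" "\<lambda>s. f (q s)"] by auto
      then have "f (q 1) = f (q 0)" by simp
      then show ?thesis using \<sigma>(3)[OF y0] by (simp add: q_def)
    qed
    then show ?thesis using \<sigma>(1) by (auto simp: zero_near_def)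
  qed
  note * = this
  show ?thesis by (rule propagatesI[OF b]) (rule *)
qed

lemma propagates_all:
  assumes f: "solves R f G"
  shows "propagates f G h"
proof -
  let ?B = "{u. \<exists>v c. (u, v, c) \<in> R \<and> elliptic c} \<union> {v. \<exists>u c. (u, v, c) \<in> R \<and> (elliptic c \<or> c = 0)}"
  have "?B \<subseteq> {h. propagates f G h}"
  proof
    fix b assume "b \<in> ?B"
    then consider v c where "(b, v, c) \<in> R" "elliptic c" | u c where "(u, b, c) \<in> R" "elliptic c"
      | u where "(u, b, 0) \<in> R" by blast
    then show "b \<in> {h. propagates f G h}"
    proof cases
      case 1
      from propagates_plane[OF f 1, of "(1, 0)"] show ?thesis by (simp add: plane_map_def)
    next
      case 2
      from propagates_plane[OF f 2, of "(0, 1)"] show ?thesis by (simp add: plane_map_def)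
    next
      case 3
      from propagates_constant[OF f 3] show ?thesis by simp
    qed
  qed
  then have "span ?B \<subseteq> {h. propagates f G h}" by (rule span_minimal[OF _ propagates_subspace])
  then show ?thesis using span_R by blast
qed

lemma open_zero_near: "open {x. zero_near f x}"
  unfolding open_contains_ball
proof
  fix x assume "x \<in> {x. zero_near f x}"
  then obtain \<sigma> where \<sigma>: "\<sigma> > 0" "\<forall>y\<in>ball x \<sigma>. f y = 0" by (auto simp: zero_near_def)
  have "y \<in> {x. zero_near f x}" if y: "y \<in> ball x \<sigma>" for y
  proof -
    obtain e where "e > 0" "ball y e \<subseteq> ball x \<sigma>" using openE[OF open_ball y] by metis
    then show ?thesis using \<sigma>(2) by (auto simp: zero_near_def)
  qed
  then show "\<exists>e>0. ball x e \<subseteq> {x. zero_near f x}" using \<sigma>(1) by blast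
qed

text \<open>The points near which \<open>f\<close> vanishes form an open set. It is closed in
  \<open>G\<close>: from a nearby zero point, one move along each coordinate axis reaches
  \<open>y\<close>, because the speeds are uniform.\<close>

theorem unique_continuation:
  assumes f: "solves R f G" and G: "open G" and C: "connected C" "C \<subseteq> G"
    and x0: "x0 \<in> C" "zero_near f x0" and x: "x \<in> C"
  shows "zero_near f x"
proof -
  define Z where "Z = {x. zero_near f x}"
  have oZ: "open Z" unfolding Z_def by (rule open_zero_near)
  have clZ: "y \<in> Z" if y: "y \<in> G" "y \<in> closure Z" for y
  proof -
    obtain \<rho>2 where \<rho>2: "\<rho>2 > 0" "ball y \<rho>2 \<subseteq> G" using G y(1) openE by blast
    define \<rho> where "\<rho> = \<rho>2 / 2"
    have \<rho>: "\<rho> > 0" "ball y (2 * \<rho>) \<subseteq> G" using \<rho>2 by (auto simp: \<rho>_def)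
    have "\<forall>e\<in>Basis. \<exists>c>0. \<forall>\<rho>>0. \<forall>x t. zero_near f x \<longrightarrow> ball x \<rho> \<subseteq> G \<longrightarrow> \<bar>t\<bar> < c * \<rho> \<longrightarrow>
        zero_near f (x + t *\<^sub>R e)"
      using propagates_all[OF f] unfolding propagates_def by blast
    then obtain c where c: "\<And>e. e \<in> Basis \<Longrightarrow> c e > 0"
      "\<And>e \<rho> x t. e \<in> Basis \<Longrightarrow> \<rho> > 0 \<Longrightarrow> zero_near f x \<Longrightarrow> ball x \<rho> \<subseteq> G \<Longrightarrow> \<bar>t\<bar> < c e * \<rho> \<Longrightarrow>
        zero_near f (x + t *\<^sub>R e)" by metis
    define m where "m = Min (insert 1 (c ` Basis))"
    have m: "m > 0" using c(1) by (simp add: m_def)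
    have mc: "m \<le> c e" if "e \<in> Basis" for e unfolding m_def using that by (intro Min_le) auto
    define n where "n = real DIM('x) + 1"
    have n: "n > 0" by (simp add: n_def)
    \<comment> \<open>\<open>m * \<rho>\<close> makes every coordinate step admissible;
      \<open>\<rho> / n\<close> keeps all intermediate points within \<open>\<rho>\<close> of
      \<open>y\<close>, as the initial error and at most \<open>n - 1\<close> steps add up.\<close>
    define \<tau> where "\<tau> = min (m * \<rho>) (\<rho> / n)"
    have \<tau>: "\<tau> > 0" using m \<rho> n by (simp add: \<tau>_def)
    obtain x' where x': "x' \<in> Z" "dist x' y < \<tau>" using y(2) \<tau> closure_approachable by blast
    define t where "t e = (y - x') \<bullet> e" for e
    have t: "\<bar>t e\<bar> < \<tau>" if "e \<in> Basis" for e
      using Basis_le_norm[OF that, of "y - x'"] x'(2) by (simp add: t_def dist_norm norm_minus_commute)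
    have "x' + (\<Sum>e\<in>F. t e *\<^sub>R e) \<in> Z" if "finite F" "F \<subseteq> Basis" for F
      using that
    proof (induction F)
      case empty
      then show ?case using x'(1) by simp
    next
      case (insert e F)
      let ?p = "x' + (\<Sum>e\<in>F. t e *\<^sub>R e)"
      have e: "e \<in> Basis" and F: "F \<subseteq> Basis" using insert.prems by auto
      have "norm (\<Sum>e\<in>F. t e *\<^sub>R e) \<le> (\<Sum>e\<in>F. \<tau>)"
        by (intro sum_norm_le) (use F t in \<open>auto simp: subset_iff less_imp_le\<close>)
      also have "\<dots> \<le> real DIM('x) * \<tau>"
        using card_mono[OF finite_Basis F] \<tau> by (simp add: mult_right_mono)
      finally have "dist y ?p < \<tau> + real DIM('x) * \<tau>"
        using x'(2) dist_triangle[of y ?p x'] by (simp add: dist_norm norm_minus_commute)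
      also have "\<dots> = n * \<tau>" by (simp add: n_def algebra_simps)
      also have "\<dots> \<le> \<rho>"
      proof -
        have "\<tau> \<le> \<rho> / n" by (simp add: \<tau>_def)
        then show ?thesis using n by (simp add: pos_le_divide_eq mult.commute)
      qed
      finally have "ball ?p \<rho> \<subseteq> ball y (2 * \<rho>)"
        by (intro ball_subset_ball_iff[THEN iffD2]) (simp add: dist_commute)
      moreover have "\<bar>t e\<bar> < c e * \<rho>"
      proof -
        have "m * \<rho> \<le> c e * \<rho>" using mc[OF e] \<rho>(1) by (intro mult_right_mono) auto
        then show ?thesis using t[OF e] by (simp add: \<tau>_def)
      qed
      ultimately have "zero_near f (?p + t e *\<^sub>R e)"
        using insert.IH[OF F] \<rho> by (intro c(2)[OF e, of \<rho>]) (auto simp: Z_def)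
      then show ?case using insert.hyps by (simp add: Z_def algebra_simps)
    qed
    from this[OF finite_Basis subset_refl]
    show ?thesis by (simp add: t_def euclidean_representation)
  qed
  have "C \<inter> Z = C \<inter> closure Z" using clZ C(2) closure_subset by blast
  then have "closedin (top_of_set C) (C \<inter> Z)" by (simp add: closedin_closed_Int)
  moreover have "openin (top_of_set C) (C \<inter> Z)" using oZ by (rule openin_open_Int)
  ultimately have "C \<inter> Z = {} \<or> C \<inter> Z = C" using C(1) unfolding connected_clopen by blast
  then show ?thesis using x0 x by (auto simp: Z_def)
qed

end

subsection \<open>Splitting a solution on a collar\<close>

lemma open_plane_slice: "open G \<Longrightarrow> open {z. x + plane_map u v z \<in> G}"
  using open_vimage[of G "\<lambda>z. x + plane_map u v z"] by (simp add: vimage_def continuous_intros)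

lemma closed_plane_slice: "closed K \<Longrightarrow> closed {z. x + plane_map u v z \<in> K}"
  using closed_vimage[of K "\<lambda>z. x + plane_map u v z"] by (simp add: vimage_def continuous_intros)

text \<open>The set consists of the differences between points of \<open>K\<close> and points of a
  compact set. Its open complement is what keeps a cutoff admissible under small shifts of the base
  point.\<close>

lemma closed_plane_projection:
  assumes "compact C" "closed K"
  shows "closed {x. \<exists>z\<in>C. x + plane_map u v z \<in> K}"
proof -
  have "compact (plane_map u v ` C)"
    by (intro compact_continuous_image continuous_intros assms(1))
  from closed_compact_differences[OF assms(2) this]
  have "closed (\<Union>x\<in>K. \<Union>y\<in>plane_map u v ` C. {x - y})" .
  also have "(\<Union>x\<in>K. \<Union>y\<in>plane_map u v ` C. {x - y}) = {x. \<exists>z\<in>C. x + plane_map u v z \<in> K}"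
    by (force simp: algebra_simps)
  finally show ?thesis .
qed

lemma (in elliptic_plane) dbar_diff:
  "dbar (\<lambda>z h. \<psi>' z h - \<phi>' z h) z = dbar \<psi>' z - dbar \<phi>' z"
  by (simp add: dbar_def algebra_simps)

lemma (in elliptic_plane) dbar_add:
  "dbar (\<lambda>z h. \<psi>' z h + \<phi>' z h) z = dbar \<psi>' z + dbar \<phi>' z"
  by (simp add: dbar_def algebra_simps)

text \<open>The difference of the two cutoffs vanishes near the origin, so the pole of the kernel is
  not seen and Cauchy's theorem applies.\<close>

lemma (in elliptic_plane) period_unique:
  assumes \<psi>: "C1_function \<psi> \<psi>'" "compact C" "\<And>z. z \<notin> C \<Longrightarrow> \<psi> z = 0"
    "\<delta> > 0" "\<And>z. z \<in> ball 0 \<delta> \<Longrightarrow> \<psi> z = 1"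
    and \<phi>: "C1_function \<phi> \<phi>'" "compact B" "\<And>z. z \<notin> B \<Longrightarrow> \<phi> z = 0"
    "\<epsilon> > 0" "\<And>z. z \<in> ball 0 \<epsilon> \<Longrightarrow> \<phi> z = 1"
  shows "integral UNIV (\<lambda>z. dbar \<psi>' z * ikap z) = integral UNIV (\<lambda>z. dbar \<phi>' z * ikap z)"
proof -
  have "integral UNIV (\<lambda>z. dbar (\<lambda>z h. \<psi>' z h - \<phi>' z h) z * ikap z) = 0"
  proof (rule integral_dbar_eq_0[OF C1_function_diff[OF \<psi>(1) \<phi>(1)] compact_Un[OF \<psi>(2) \<phi>(2)]])
    show "0 < min \<delta> \<epsilon>" using \<psi>(4) \<phi>(4) by simp
    show d0: "\<psi> z - \<phi> z = 0" if "z \<in> ball 0 (min \<delta> \<epsilon>)" for z using that \<psi>(5) \<phi>(5) by simp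
    have "\<forall>\<^sub>F z in at 0. norm z *\<^sub>R ((\<psi> z - \<phi> z) *\<^sub>R ikap z) = 0"
      using eventually_at_ball[OF \<open>0 < min \<delta> \<epsilon>\<close>, of 0 UNIV] by (rule eventually_mono) (use d0 in simp)
    then show "((\<lambda>z. norm z *\<^sub>R ((\<psi> z - \<phi> z) *\<^sub>R ikap z)) \<longlongrightarrow> 0) (at 0)" by (rule tendsto_eventually)
  qed (use \<psi>(3) \<phi>(3) planar_ikap in auto)
  then show ?thesis
    using integrable_dbar_mult[OF \<psi> planar_ikap] integrable_dbar_mult[OF \<phi> planar_ikap]
    by (simp add: dbar_diff left_diff_distrib Henstock_Kurzweil_Integration.integral_diff)
qed

text \<open>The uniform bound on slices takes the place of compactness of \<open>K\<close>: in the
  application \<open>K\<close> is a cylinder over a compact set, met by the planes in compact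
  pieces.\<close>

locale collar = linear_system R + elliptic_plane a
  for R :: "('x::euclidean_space \<times> 'x \<times> 'a::{euclidean_space,real_algebra_1}) set" and a :: 'a +
  fixes u v :: 'x and \<Omega> K :: "'x set" and f :: "'x \<Rightarrow> 'a"
  assumes plane: "(u, v, a) \<in> R" and open_\<Omega>: "open \<Omega>" and closed_K: "closed K" and K_sub: "K \<subseteq> \<Omega>"
    and f: "solves R f (\<Omega> - K)"
    and slices: "bounded X \<Longrightarrow> bounded {z. \<exists>x\<in>X. x + plane_map u v z \<in> K}"
begin

lemma open_collar: "open (\<Omega> - K)"
  using open_\<Omega> closed_K by (rule open_Diff)

text \<open>
  \<open>\<psi>\<close> cuts off the slice of \<open>K\<close> by the plane through \<open>x\<close> inside \<open>\<Omega>\<close>, and is constantly \<open>b\<close> near the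
  point \<open>x\<close> itself, which is the origin of the plane.
\<close>
definition adm :: "real \<Rightarrow> 'x \<Rightarrow> (real \<times> real \<Rightarrow> real) \<Rightarrow> (real \<times> real \<Rightarrow> real \<times> real \<Rightarrow> real) \<Rightarrow>
    (real \<times> real) set \<Rightarrow> (real \<times> real) set \<Rightarrow> real \<Rightarrow> bool" where
  "adm b x \<psi> \<psi>' H C \<delta> \<longleftrightarrow> C1_function \<psi> \<psi>' \<and>
     open H \<and> (\<forall>z\<in>H. \<psi> z = 1) \<and> (\<forall>z. x + plane_map u v z \<in> K \<longrightarrow> z \<in> H) \<and>
     compact C \<and> (\<forall>z. z \<notin> C \<longrightarrow> \<psi> z = 0) \<and> (\<forall>z\<in>C. x + plane_map u v z \<in> \<Omega>) \<and>
     \<delta> > 0 \<and> (\<forall>z\<in>ball 0 \<delta>. \<psi> z = b)"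

lemma admD:
  assumes "adm b x \<psi> \<psi>' H C \<delta>"
  shows "C1_function \<psi> \<psi>'" "open H" "\<And>z. z \<in> H \<Longrightarrow> \<psi> z = 1" "\<And>z. x + plane_map u v z \<in> K \<Longrightarrow> z \<in> H"
    "compact C" "\<And>z. z \<notin> C \<Longrightarrow> \<psi> z = 0" "\<And>z. z \<in> C \<Longrightarrow> x + plane_map u v z \<in> \<Omega>"
    "\<delta> > 0" "\<And>z. z \<in> ball 0 \<delta> \<Longrightarrow> \<psi> z = b"
  using assms unfolding adm_def by blast+

lemma compact_slice: "compact {z. x + plane_map u v z \<in> K}"
  using slices[of "{x}"] closed_plane_slice[OF closed_K, of x u v] by (simp add: compact_eq_bounded_closed)

lemma adm_exists_1:
  assumes "x \<in> \<Omega>"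
  shows "\<exists>\<psi> \<psi>' H C \<delta>. adm 1 x \<psi> \<psi>' H C \<delta>"
proof -
  have "{z. x + plane_map u v z \<in> K} \<union> {0} \<subseteq> {z. x + plane_map u v z \<in> \<Omega>}"
    using K_sub assms by (auto simp: plane_map_def)
  then obtain \<psi> \<psi>' H C where \<psi>: "C1_function \<psi> \<psi>'" "open H" "{z. x + plane_map u v z \<in> K} \<union> {0} \<subseteq> H"
    "\<And>z. z \<in> H \<Longrightarrow> \<psi> z = 1" "compact C" "C \<subseteq> {z. x + plane_map u v z \<in> \<Omega>}" "\<And>z. z \<notin> C \<Longrightarrow> \<psi> z = 0"
    using C1_cutoff_exists[OF compact_Un[OF compact_slice compact_sing] open_plane_slice[OF open_\<Omega>]] by metis
  then obtain \<delta> where \<delta>: "\<delta> > 0" "ball 0 \<delta> \<subseteq> H" by (metis Un_insert_right insert_subset openE sup_bot_right)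
  have "adm 1 x \<psi> \<psi>' H C \<delta>" unfolding adm_def using \<psi> \<delta> by blast
  then show ?thesis by blast
qed

text \<open>Outside \<open>K\<close> the origin can be excluded from the support. The point
  \<open>x\<close> may lie outside \<open>\<Omega>\<close>, so these cutoffs reach beyond
  it.\<close>

lemma adm_exists_0:
  assumes "x \<notin> K"
  shows "\<exists>\<psi> \<psi>' H C \<delta>. adm 0 x \<psi> \<psi>' H C \<delta>"
proof -
  have "x + plane_map u v 0 \<notin> K" using assms by (simp add: plane_map_def)
  then have "{z. x + plane_map u v z \<in> K} \<subseteq> {z. x + plane_map u v z \<in> \<Omega>} - {0}"
    using K_sub by auto
  then obtain \<psi> \<psi>' H C where \<psi>: "C1_function \<psi> \<psi>'" "open H" "{z. x + plane_map u v z \<in> K} \<subseteq> H"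
    "\<And>z. z \<in> H \<Longrightarrow> \<psi> z = 1" "compact C" "C \<subseteq> {z. x + plane_map u v z \<in> \<Omega>} - {0}" "\<And>z. z \<notin> C \<Longrightarrow> \<psi> z = 0"
    using C1_cutoff_exists[OF compact_slice open_Diff[OF open_plane_slice[OF open_\<Omega>] closed_singleton]] by metis
  have "open (- C)" using \<psi>(5) compact_imp_closed by auto
  moreover have "0 \<in> - C" using \<psi>(6) by blast
  ultimately obtain \<delta> where \<delta>: "\<delta> > 0" "ball 0 \<delta> \<subseteq> - C" by (metis openE)
  have "adm 0 x \<psi> \<psi>' H C \<delta>" unfolding adm_def using \<psi> \<delta> by blast
  then show ?thesis by blast
qed

text \<open>Both ways in which the cutoff can fail define closed sets of base points: a point of
  \<open>C\<close> leaves \<open>\<Omega>\<close>, or the slice of \<open>K\<close> leaves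
  \<open>H\<close>. For the second, the bound on slices confines \<open>z\<close> to a compact
  ball.\<close>

lemma adm_locally:
  assumes "adm b x \<psi> \<psi>' H C \<delta>"
  obtains \<rho> where "\<rho> > 0" "\<And>y. y \<in> ball x \<rho> \<Longrightarrow> adm b y \<psi> \<psi>' H C \<delta>"
proof -
  note A = admD[OF assms]
  define S1 where "S1 = {y. \<exists>z\<in>C. y + plane_map u v z \<in> - \<Omega>}"
  have S1: "closed S1" "x \<notin> S1"
    unfolding S1_def using closed_plane_projection[OF A(5), of "- \<Omega>"] open_\<Omega> A(7) by auto
  have "bounded {z. \<exists>y\<in>cball x 1. y + plane_map u v z \<in> K}" by (rule slices[OF bounded_cball])
  then obtain B where B: "\<And>z y. y \<in> cball x 1 \<Longrightarrow> y + plane_map u v z \<in> K \<Longrightarrow> norm z \<le> B"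
    unfolding bounded_iff by blast
  define S2 where "S2 = {y. \<exists>z\<in>cball 0 B - H. y + plane_map u v z \<in> K}"
  have S2: "closed S2" "x \<notin> S2"
    unfolding S2_def using closed_plane_projection[OF compact_diff[OF compact_cball A(2)] closed_K] A(4) by auto
  have "open (- (S1 \<union> S2))" "x \<in> - (S1 \<union> S2)" using S1 S2 by auto
  then obtain r where r: "r > 0" "ball x r \<subseteq> - (S1 \<union> S2)" by (metis openE)
  show ?thesis
  proof (rule that[of "min r 1"])
    show "min r 1 > 0" using r by simp
    fix y assume y: "y \<in> ball x (min r 1)"
    then have ny: "y \<notin> S1" "y \<notin> S2" using r by auto
    have "y + plane_map u v z \<in> \<Omega>" if "z \<in> C" for z using ny(1) that by (auto simp: S1_def)
    moreover have "z \<in> H" if "y + plane_map u v z \<in> K" for z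
    proof (rule ccontr)
      assume "z \<notin> H"
      moreover have "norm z \<le> B" using B[of y z] y that by auto
      ultimately have "y \<in> S2" unfolding S2_def using that by auto
      then show False using ny by simp
    qed
    ultimately show "adm b y \<psi> \<psi>' H C \<delta>" using A unfolding adm_def by blast
  qed
qed

text \<open>The density vanishes wherever \<open>\<psi>\<close> is locally constant, which leaves
  \<open>C - H - ball 0 \<delta>\<close>. These points map into \<open>\<Omega> - K\<close>, the
  region where \<open>f\<close> is known to be a solution.\<close>

lemma adm_kernel:
  assumes "adm b x \<psi> \<psi>' H C \<delta>"
  shows "continuous_on UNIV (\<lambda>z. dbar \<psi>' z * ikap z)" "central (dbar \<psi>' z * ikap z)"
    "compact (C - H - ball 0 \<delta>)" "z \<notin> C - H - ball 0 \<delta> \<Longrightarrow> dbar \<psi>' z * ikap z = 0"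
    "z \<in> C - H - ball 0 \<delta> \<Longrightarrow> x + plane_map u v z \<in> \<Omega> - K"
proof -
  note A = admD[OF assms]
  show "continuous_on UNIV (\<lambda>z. dbar \<psi>' z * ikap z)"
    by (intro continuous_at_imp_continuous_on ballI isCont_dbar_mult[OF A(1,5,6,8,9)] isCont_ikap)
  show *: "dbar \<psi>' z * ikap z = 0" if "z \<notin> C - H - ball 0 \<delta>" for z
  proof -
    have oC: "open (- C)" using A(5) compact_imp_closed by auto
    consider "z \<notin> C" | "z \<in> H" | "z \<in> ball 0 \<delta>" using \<open>z \<notin> C - H - ball 0 \<delta>\<close> by blast
    then have "dbar \<psi>' z = 0"
    proof cases
      case 1 then show ?thesis using dbar_locally_const[OF A(1) oC, of z 0] A(6) by simp
    next
      case 2 then show ?thesis using dbar_locally_const[OF A(1,2), of z 1] A(3) by simp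
    next
      case 3 then show ?thesis by (rule dbar_locally_const[OF A(1) open_ball _ A(9)])
    qed
    then show ?thesis by simp
  qed
  show "central (dbar \<psi>' z * ikap z)"
  proof (cases "z = 0")
    case True
    then show ?thesis using *[of z] A(8) by simp
  qed (intro central_mult central_dbar central_ikap)
  show "compact (C - H - ball 0 \<delta>)" by (intro compact_diff A(2,5) open_ball)
  show "x + plane_map u v z \<in> \<Omega> - K" if "z \<in> C - H - ball 0 \<delta>"
    using that A(4,7) by blast
qed

text \<open>Only the derivative of the cutoff enters; for an admissible cutoff, values of
  \<open>f\<close> outside \<open>\<Omega> - K\<close> are multiplied by 0.\<close>

definition J :: "(real \<times> real \<Rightarrow> real \<times> real \<Rightarrow> real) \<Rightarrow> 'x \<Rightarrow> 'a" where
  "J \<psi>' x = integral UNIV (\<lambda>z. dbar \<psi>' z * ikap z * f (x + plane_map u v z))"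

lemma adm_J_solves:
  assumes "adm b x \<psi> \<psi>' H C \<delta>"
  obtains \<rho> where "\<rho> > 0" "\<And>y. y \<in> ball x \<rho> \<Longrightarrow> adm b y \<psi> \<psi>' H C \<delta>" "solves R (J \<psi>') (ball x \<rho>)"
proof -
  obtain \<rho> where \<rho>: "\<rho> > 0" "\<And>y. y \<in> ball x \<rho> \<Longrightarrow> adm b y \<psi> \<psi>' H C \<delta>"
    using adm_locally[OF assms] by blast
  have "solves R (J \<psi>') (ball x \<rho>)"
    unfolding J_def
    by (rule kernel_integral_solves[OF adm_kernel(1-4)[OF assms] f open_collar])
      (use adm_kernel(5)[OF \<rho>(2)] in blast)+
  with \<rho> that show ?thesis by blast
qed

lemma adm_integrable:
  assumes "adm b x \<psi> \<psi>' H C \<delta>"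
  shows "(\<lambda>z. dbar \<psi>' z * ikap z * f (x + plane_map u v z)) integrable_on UNIV"
proof -
  obtain \<rho> where \<rho>: "\<rho> > 0" "\<And>y. y \<in> ball x \<rho> \<Longrightarrow> adm b y \<psi> \<psi>' H C \<delta>"
    using adm_locally[OF assms] by blast
  have cf: "continuous_on (\<Omega> - K) f"
    using solves_isCont[OF f] by (intro continuous_at_imp_continuous_on) auto
  have "continuous_on (ball x \<rho> \<times> UNIV) (\<lambda>(y, z). dbar \<psi>' z * ikap z * f (y + plane_map u v z))"
    by (rule kernel_param_continuous[OF adm_kernel(1,3,4)[OF assms] cf open_collar open_ball])
      (use adm_kernel(5)[OF \<rho>(2)] in blast)+
  from continuous_on_slice[OF this, of x UNIV] \<rho>(1)
  have "continuous_on UNIV (\<lambda>z. dbar \<psi>' z * ikap z * f (x + plane_map u v z))" by simp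
  then show ?thesis
    by (rule integrable_continuous_compact_support[OF _ adm_kernel(3)[OF assms]])
      (simp add: adm_kernel(4)[OF assms])
qed

text \<open>Two admissible cutoffs with the same \<open>b\<close> agree near the slice of
  \<open>K\<close> and near the origin, so their difference lives where \<open>f\<close> solves the
  equation and avoids the pole. Cauchy's theorem gives 0.\<close>

lemma adm_J_unique:
  assumes A: "adm b x \<psi> \<psi>' H C \<delta>" and B: "adm b x \<phi> \<phi>' H2 C2 \<epsilon>"
  shows "J \<psi>' x = J \<phi>' x"
proof -
  note A' = admD[OF A] and B' = admD[OF B]
  have "integral UNIV (\<lambda>z. dbar (\<lambda>z h. \<psi>' z h - \<phi>' z h) z * (ikap z * f (x + plane_map u v z))) = 0"
  proof (rule integral_dbar_eq_0[OF C1_function_diff[OF A'(1) B'(1)]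
        compact_diff[OF compact_Un[OF A'(5) B'(5)] open_Int[OF A'(2) B'(2)]]])
    show "\<psi> z - \<phi> z = 0" if "z \<notin> C \<union> C2 - H \<inter> H2" for z
      using that A'(3)[of z] A'(6)[of z] B'(3)[of z] B'(6)[of z] by auto
    show pos: "0 < min \<delta> \<epsilon>" using A'(8) B'(8) by simp
    show d0: "\<psi> z - \<phi> z = 0" if "z \<in> ball 0 (min \<delta> \<epsilon>)" for z using that A'(9) B'(9) by simp
    have "\<forall>\<^sub>F z in at 0. norm z *\<^sub>R ((\<psi> z - \<phi> z) *\<^sub>R (ikap z * f (x + plane_map u v z))) = 0"
      using eventually_at_ball[OF pos, of 0 UNIV] by (rule eventually_mono) (use d0 in simp)
    then show "((\<lambda>z. norm z *\<^sub>R ((\<psi> z - \<phi> z) *\<^sub>R (ikap z * f (x + plane_map u v z)))) \<longlongrightarrow> 0) (at 0)"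
      by (rule tendsto_eventually)
    fix z :: "real \<times> real" assume z: "z \<in> C \<union> C2 - H \<inter> H2" "z \<noteq> 0"
    then have "x + plane_map u v z \<in> \<Omega> - K" using A'(4,7) B'(4,7) by blast
    then show "planar (\<lambda>z. ikap z * f (x + plane_map u v z)) z"
      by (intro planar_mult planar_ikap z(2) solves_planar[OF f plane elliptic])
  qed
  then show ?thesis
    using adm_integrable[OF A] adm_integrable[OF B]
    by (simp add: J_def dbar_diff left_diff_distrib Henstock_Kurzweil_Integration.integral_diff mult.assoc)
qed

text \<open>Any admissible cutoff gives the same value, so one cutoff can serve on a whole ball,
  where \<open>J\<close> is known to be a solution.\<close>

definition ext :: "real \<Rightarrow> 'x \<Rightarrow> 'a" where
  "ext b x = J (SOME \<psi>'. \<exists>\<psi> H C \<delta>. adm b x \<psi> \<psi>' H C \<delta>) x"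

lemma ext_eq:
  assumes "adm b x \<psi> \<psi>' H C \<delta>"
  shows "ext b x = J \<psi>' x"
proof -
  have "\<exists>\<psi>' \<psi> H C \<delta>. adm b x \<psi> \<psi>' H C \<delta>" using assms by blast
  from someI_ex[OF this] show ?thesis
    unfolding ext_def using adm_J_unique assms by blast
qed

lemma ext_solves:
  assumes "\<And>x. x \<in> S \<Longrightarrow> \<exists>\<psi> \<psi>' H C \<delta>. adm b x \<psi> \<psi>' H C \<delta>"
  shows "solves R (ext b) S"
proof (rule solves_locally)
  fix x assume "x \<in> S"
  then obtain \<psi> \<psi>' H C \<delta> where A: "adm b x \<psi> \<psi>' H C \<delta>" using assms by blast
  then obtain \<rho> where \<rho>: "\<rho> > 0" "\<And>y. y \<in> ball x \<rho> \<Longrightarrow> adm b y \<psi> \<psi>' H C \<delta>" "solves R (J \<psi>') (ball x \<rho>)"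
    using adm_J_solves by blast
  have "solves R (ext b) (ball x \<rho>)"
    by (rule solves_transform[OF \<rho>(3) open_ball]) (use ext_eq[OF \<rho>(2)] in simp)
  then show "\<exists>T. x \<in> T \<and> solves R (ext b) T" using \<rho>(1) by (intro exI[of _ "ball x \<rho>"]) simp
qed

text \<open>\<open>f1\<close> uses cutoffs equal to 1 at the origin, \<open>f2\<close> cutoffs equal
  to 0 there. They differ by a bump around the origin, which the Cauchy formula evaluates to the
  period times \<open>f x\<close>; dividing by the period gives the splitting.\<close>

theorem collar_splitting:
  obtains f1 f2 where "solves R f1 \<Omega>" "solves R f2 (- K)" "\<And>x. x \<in> \<Omega> - K \<Longrightarrow> f x = f1 x - f2 x"
    "\<And>x. (\<And>z. x + plane_map u v z \<notin> K) \<Longrightarrow> f2 x = 0"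
proof -
  \<comment> \<open>A fixed bump defines the period \<open>N\<close> and its inverse once and for
    all; other bumps have the same period.\<close>
  obtain \<eta> \<eta>' H0 C0 where \<eta>: "C1_function \<eta> \<eta>'" "open H0" "{0} \<subseteq> H0" "\<And>z. z \<in> H0 \<Longrightarrow> \<eta> z = 1" "compact C0"
    "C0 \<subseteq> ball (0::real \<times> real) 1" "\<And>z. z \<notin> C0 \<Longrightarrow> \<eta> z = 0"
    using C1_cutoff_exists[of "{0::real \<times> real}" "ball 0 1"] by (metis compact_sing open_ball centre_in_ball
        empty_subsetI insert_subset zero_less_one)
  obtain \<delta>0 where \<delta>0: "\<delta>0 > 0" "ball 0 \<delta>0 \<subseteq> H0" using \<eta>(2,3) by (metis insert_subset openE)
  have \<eta>\<delta>: "\<eta> z = 1" if "z \<in> ball 0 \<delta>0" for z using that \<delta>0(2) \<eta>(4) by blast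
  define N where "N = integral UNIV (\<lambda>z. dbar \<eta>' z * ikap z)"
  obtain d where d: "central d" "d * N = 1"
    using period_invertible[OF \<eta>(1,5,7) \<delta>0(1) \<eta>\<delta>] unfolding N_def by metis
  show ?thesis
  proof (rule that[of "\<lambda>x. d * ext 1 x" "\<lambda>x. d * ext 0 x"])
    show "solves R (\<lambda>x. d * ext 1 x) \<Omega>"
      by (intro solves_mult_central d(1) ext_solves adm_exists_1)
    show "solves R (\<lambda>x. d * ext 0 x) (- K)"
      by (intro solves_mult_central d(1) ext_solves adm_exists_0) simp
  next
    fix x assume x: "x \<in> \<Omega> - K"
    then obtain \<psi> \<psi>' H C \<delta> where A: "adm 0 x \<psi> \<psi>' H C \<delta>" using adm_exists_0 by blast
    note A' = admD[OF A]
    define G where "G = {z. x + plane_map u v z \<in> \<Omega> - K}"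
    have G: "open G" "0 \<in> G" unfolding G_def using open_plane_slice[OF open_collar] x by (auto simp: plane_map_def)
    then obtain \<phi> \<phi>' H1 C1 where \<phi>: "C1_function \<phi> \<phi>'" "open H1" "{0} \<subseteq> H1" "\<And>z. z \<in> H1 \<Longrightarrow> \<phi> z = 1"
      "compact C1" "C1 \<subseteq> G" "\<And>z. z \<notin> C1 \<Longrightarrow> \<phi> z = 0"
      using C1_cutoff_exists[of "{0}" G] by (metis compact_sing empty_subsetI insert_subset)
    obtain \<delta>1 where \<delta>1: "\<delta>1 > 0" "ball 0 \<delta>1 \<subseteq> H1" using \<phi>(2,3) by (metis insert_subset openE)
    have \<phi>\<delta>: "\<phi> z = 1" if "z \<in> ball 0 \<delta>1" for z using that \<delta>1(2) \<phi>(4) by blast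
    have oC1: "open (- C1)" using \<phi>(5) compact_imp_closed by auto
    have fpl: "planar (\<lambda>z. f (x + plane_map u v z)) z" if "z \<in> C1" for z
      using that \<phi>(6) by (intro solves_planar[OF f plane elliptic]) (auto simp: G_def)
    \<comment> \<open>The bump \<open>\<phi>\<close>, supported over \<open>\<Omega> - K\<close>,
      turns a cutoff with \<open>b = 0\<close> into one with \<open>b = 1\<close>. Removing
      \<open>C1\<close> from \<open>H\<close> still leaves a neighbourhood of the slice of
      \<open>K\<close>, since \<open>C1\<close> avoids it.\<close>
    have B: "adm 1 x (\<lambda>z. \<psi> z + \<phi> z) (\<lambda>z h. \<psi>' z h + \<phi>' z h) (H - C1) (C \<union> C1) (min \<delta> \<delta>1)"
      unfolding adm_def
    proof (intro conjI allI ballI impI)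
      show "C1_function (\<lambda>z. \<psi> z + \<phi> z) (\<lambda>z h. \<psi>' z h + \<phi>' z h)" by (rule C1_function_add[OF A'(1) \<phi>(1)])
      show "open (H - C1)" using A'(2) \<phi>(5) compact_imp_closed by (intro open_Diff) auto
      show "compact (C \<union> C1)" by (rule compact_Un[OF A'(5) \<phi>(5)])
      show "0 < min \<delta> \<delta>1" using A'(8) \<delta>1(1) by simp
      show "\<psi> z + \<phi> z = 1" if "z \<in> H - C1" for z using that A'(3) \<phi>(7) by simp
      show "\<psi> z + \<phi> z = 0" if "z \<notin> C \<union> C1" for z using that A'(6) \<phi>(7) by simp
      show "\<psi> z + \<phi> z = 1" if "z \<in> ball 0 (min \<delta> \<delta>1)" for z using that A'(9) \<phi>\<delta> by simp
      show "z \<in> H - C1" if "x + plane_map u v z \<in> K" for z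
        using that A'(4) \<phi>(6) by (auto simp: G_def)
      show "x + plane_map u v z \<in> \<Omega>" if "z \<in> C \<union> C1" for z
        using that A'(7)[of z] \<phi>(6) by (auto simp: G_def)
    qed
    have int\<phi>: "(\<lambda>z. dbar \<phi>' z * ikap z * f (x + plane_map u v z)) integrable_on UNIV"
      using integrable_dbar_mult[OF \<phi>(1,5,7) \<delta>1(1) \<phi>\<delta> planar_mult[OF planar_ikap fpl]] by (simp add: mult.assoc)
    have "ext 1 x = J (\<lambda>z h. \<psi>' z h + \<phi>' z h) x" by (rule ext_eq[OF B])
    also have "\<dots> = J \<psi>' x + J \<phi>' x"
      using adm_integrable[OF A] int\<phi>
      by (simp add: J_def dbar_add distrib_right Henstock_Kurzweil_Integration.integral_add)
    also have "J \<phi>' x = N * f x"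
      using cauchy_formula[OF \<phi>(1,5,7) \<delta>1(1) \<phi>\<delta> fpl]
        period_unique[OF \<phi>(1,5,7) \<delta>1(1) \<phi>\<delta> \<eta>(1,5,7) \<delta>0(1) \<eta>\<delta>]
      by (simp add: J_def N_def mult.assoc plane_map_def)
    also have "J \<psi>' x = ext 0 x" by (rule ext_eq[OF A, symmetric])
    finally have "d * ext 1 x = d * ext 0 x + d * N * f x" by (simp add: distrib_left mult.assoc)
    then show "f x = d * ext 1 x - d * ext 0 x" using d(2) by simp
  next
    fix x assume x: "\<And>z. x + plane_map u v z \<notin> K"
    \<comment> \<open>When the slice is empty, the zero cutoff is admissible.\<close>
    have "adm 0 x (\<lambda>_. 0) (\<lambda>_ _. 0) {} {} 1" using x by (auto simp: adm_def C1_function_def)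
    from ext_eq[OF this] show "d * ext 0 x = 0" by (simp add: J_def dbar_def)
  qed
qed

end

section \<open>Hartogs extension in a subspace\<close>

text \<open>Follow the segment from \<open>x\<close> to \<open>\<omega>\<close> up to the first
  parameter in the closure. As \<open>\<Omega>\<close> is relatively open, this first point cannot
  lie in \<open>\<Omega>\<close>.\<close>

lemma exit_through_frontier:
  fixes S :: "'x::euclidean_space set"
  assumes S: "subspace S" and \<Omega>: "openin (top_of_set S) \<Omega>" and \<omega>: "\<omega> \<in> \<Omega>"
    and x: "x \<in> S" "x \<notin> closure \<Omega>"
  obtains A y where "connected A" "x \<in> A" "y \<in> A" "y \<in> top_of_set S frontier_of \<Omega>" "A \<subseteq> S"
    "A \<inter> closure \<Omega> \<subseteq> {y}"
proof -
  define g where "g t = x + t *\<^sub>R (\<omega> - x)" for t :: real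
  have \<omega>S: "\<omega> \<in> S" using \<Omega> \<omega> openin_imp_subset by auto
  have gS: "g t \<in> S" for t
    unfolding g_def using S x(1) \<omega>S by (intro subspace_add subspace_scale subspace_diff)
  have cg: "continuous_on D g" for D unfolding g_def by (intro continuous_intros)
  define T where "T = {0..1} \<inter> g -` closure \<Omega>"
  have "closed T" unfolding T_def by (intro continuous_closed_preimage cg) auto
  then have cT: "compact T" using compact_Int_closed[OF compact_Icc] by (metis T_def closed_vimage_Int
      closed_closure compact_Icc compact_eq_bounded_closed bounded_subset inf_le1)
  have "1 \<in> T" using \<omega> closure_subset by (auto simp: T_def g_def)
  then obtain \<tau> where \<tau>: "\<tau> \<in> T" "\<And>t. t \<in> T \<Longrightarrow> \<tau> \<le> t"
    using compact_attains_inf[OF cT] by blast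
  have "g 0 = x" by (simp add: g_def)
  then have \<tau>0: "0 < \<tau>" "\<tau> \<le> 1" using \<tau>(1) x(2) by (auto simp: T_def less_le)
  have notin: "g t \<notin> closure \<Omega>" if "0 \<le> t" "t < \<tau>" for t
    using \<tau>(2)[of t] that \<tau>0 by (auto simp: T_def)
  obtain V where V: "open V" "\<Omega> = S \<inter> V" using \<Omega> openin_open by blast
  have "g \<tau> \<notin> \<Omega>"
  proof
    assume "g \<tau> \<in> \<Omega>"
    then have "g \<tau> \<in> V" using V by auto
    moreover have "open (g -` V)" using V(1) cg by (intro open_vimage) auto
    ultimately obtain e where e: "e > 0" "ball \<tau> e \<subseteq> g -` V" by (metis openE vimageI)
    define t where "t = max 0 (\<tau> - e / 2)"
    have t: "0 \<le> t" "t < \<tau>" "t \<in> ball \<tau> e" using e(1) \<tau>0 by (auto simp: t_def dist_real_def max_def)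
    then have "g t \<in> \<Omega>" using e(2) V(2) gS by auto
    then show False using notin[OF t(1,2)] closure_subset by blast
  qed
  moreover have "g \<tau> \<in> closure \<Omega>" using \<tau>(1) by (simp add: T_def)
  ultimately have fr: "g \<tau> \<in> top_of_set S frontier_of \<Omega>"
    unfolding frontier_of_def interior_of_openin[OF \<Omega>] closure_of_subtopology
    using gS \<Omega> openin_imp_subset by (fastforce simp: closure_of_subtopology inf.absorb2)
  show ?thesis
  proof (rule that[of "g ` {0..\<tau>}" "g \<tau>"])
    show "connected (g ` {0..\<tau>})" by (intro connected_continuous_image cg) auto
    show "x \<in> g ` {0..\<tau>}" using \<open>g 0 = x\<close> \<tau>0 by force
    show "g \<tau> \<in> g ` {0..\<tau>}" using \<tau>0 by auto
    show "g ` {0..\<tau>} \<subseteq> S" using gS by auto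
    show "g ` {0..\<tau>} \<inter> closure \<Omega> \<subseteq> {g \<tau>}" using notin by (force simp: less_le)
  qed (rule fr)
qed

text \<open>Injectivity of the plane map makes the slices bounded, and the vector \<open>w\<close>
  off the plane yields a translate of the plane far away from \<open>\<Omega>\<close>.\<close>

theorem hartogs_extension_subspace:
  fixes S :: "'x::euclidean_space set"
    and R :: "('x \<times> 'x \<times> 'a::{euclidean_space,real_algebra_1}) set"
  assumes S: "subspace S" and RS: "\<And>u v c. (u, v, c) \<in> R \<Longrightarrow> u \<in> S \<and> v \<in> S \<and> central c"
    and spanR: "S \<subseteq> span ({u. \<exists>v c. (u, v, c) \<in> R \<and> elliptic c} \<union> {v. \<exists>u c. (u, v, c) \<in> R \<and> elliptic c})"
    and plane: "(u, v, a) \<in> R" "elliptic a" "inj (plane_map u v)"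
    and w: "w \<in> S" "w \<notin> range (plane_map u v)"
    and \<Omega>: "openin (top_of_set S) \<Omega>" "bounded \<Omega>" and fr: "connected (top_of_set S frontier_of \<Omega>)"
    and U: "openin (top_of_set S) U" "top_of_set S frontier_of \<Omega> \<subseteq> U"
    and f: "\<And>x. x \<in> U \<Longrightarrow> \<exists>f'. (f has_derivative f') (at x within U) \<and> (\<forall>(u, v, c)\<in>R. f' v = c * f' u)"
  obtains F W where "solves R F \<Omega>" "openin (top_of_set S) W" "top_of_set S frontier_of \<Omega> \<subseteq> W" "W \<subseteq> U"
    "\<And>x. x \<in> \<Omega> \<inter> W \<Longrightarrow> F x = f x"
proof (cases "\<Omega> = {}")
  case True
  show ?thesis by (rule that[of f U]) (use True U in \<open>auto simp: solves_def\<close>)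
next
  case False
  then obtain \<omega> where \<omega>: "\<omega> \<in> \<Omega>" by blast
  \<comment> \<open>The collar construction works in the full space, so \<open>f\<close> and the
    sets are pulled back by a projection \<open>\<pi>\<close> onto \<open>S\<close>.\<close>
  obtain \<pi> where \<pi>: "range \<pi> \<subseteq> S" "linear \<pi>" "\<And>v. v \<in> S \<Longrightarrow> \<pi> v = v"
    using linear_exists_left_inverse_on[OF linear_id S] by auto
  have \<pi>S: "\<pi> x \<in> S" for x using \<pi>(1) by auto
  have c\<pi>: "continuous_on UNIV \<pi>" using \<pi>(2) by (simp add: linear_continuous_on linear_conv_bounded_linear)
  have clS: "closed S" using S by (rule closed_subspace)
  obtain V where V: "open V" "\<Omega> = S \<inter> V" using \<Omega>(1) openin_open by blast
  obtain V' where V': "open V'" "U = S \<inter> V'" using U(1) openin_open by blast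
  have \<Omega>S: "\<Omega> \<subseteq> S" using V by auto
  have fr_eq: "top_of_set S frontier_of \<Omega> = S \<inter> closure \<Omega> - \<Omega>"
    unfolding frontier_of_def interior_of_openin[OF \<Omega>(1)]
    using \<Omega>S by (simp add: closure_of_subtopology inf.absorb2)
  define K where "K = \<Omega> - U"
  \<comment> \<open>\<open>K\<close> is closed in the ambient space because the frontier of
    \<open>\<Omega>\<close> lies in \<open>U\<close>.\<close>
  have K_eq: "K = S \<inter> closure \<Omega> - V'"
    using U(2) V' \<Omega>S closure_subset unfolding K_def fr_eq by blast
  have clK: "closed K" unfolding K_eq using clS V'(1) by (intro closed_Diff closed_Int) auto
  define \<Omega>' K' f' where "\<Omega>' = \<pi> -` \<Omega>" and "K' = \<pi> -` K" and "f' x = f (\<pi> x)" for x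
  have o\<Omega>': "open \<Omega>'"
  proof -
    have "\<Omega>' = \<pi> -` V" using V(2) \<pi>S by (auto simp: \<Omega>'_def)
    then show ?thesis using V(1) c\<pi> by (simp add: open_vimage)
  qed
  have clK': "closed K'" unfolding K'_def using clK c\<pi> by (intro closed_vimage)
  \<comment> \<open>The extra triples say that solutions are locally constant along the kernel of
    \<open>\<pi>\<close>; together with the directions in \<open>S\<close> they span the
    space.\<close>
  define R' where "R' = R \<union> {(k, k, 0) |k. \<pi> k = 0}"
  let ?core = "{u. \<exists>v c. (u, v, c) \<in> R' \<and> elliptic c} \<union> {v. \<exists>u c. (u, v, c) \<in> R' \<and> (elliptic c \<or> c = 0)}"
  have core: "span ?core = UNIV"
  proof -
    have "x \<in> span ?core" for x
    proof -
      have "\<pi> (\<pi> x) = \<pi> x" using \<pi>(3) \<pi>S by blast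
      then have "\<pi> (x - \<pi> x) = 0" by (simp add: linear_diff[OF \<pi>(2)])
      then have "x - \<pi> x \<in> span ?core" by (intro span_base) (auto simp: R'_def)
      moreover have "S \<subseteq> span ?core"
        by (rule order_trans[OF spanR], rule span_mono) (auto simp: R'_def)
      then have "\<pi> x \<in> span ?core" using \<pi>S by blast
      ultimately have "(x - \<pi> x) + \<pi> x \<in> span ?core" by (rule span_add)
      then show ?thesis by simp
    qed
    then show ?thesis by blast
  qed
  interpret linear_system R'
    by unfold_locales (use RS core in \<open>auto simp: R'_def\<close>)
  have sf: "solves R' f' (\<pi> -` U)"
    unfolding solves_def
  proof
    fix x assume "x \<in> \<pi> -` U"
    then have x: "\<pi> x \<in> U" by simp
    then obtain D where D: "(f has_derivative D) (at (\<pi> x) within U)" "\<forall>(u, v, c)\<in>R. D v = c * D u"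
      using f by blast
    \<comment> \<open>\<open>U\<close> is relatively open, so derivatives within \<open>U\<close>
      and within \<open>S\<close> agree; the latter is what composition with \<open>\<pi>\<close>
      needs.\<close>
    have "at (\<pi> x) within U = at (\<pi> x) within S"
      by (rule at_within_nhd[of _ V']) (use x V' in auto)
    then have "(f has_derivative D) (at (\<pi> x) within range \<pi>)"
      using D(1) \<pi>(1) has_derivative_subset by metis
    from has_derivative_in_compose[OF linear_imp_has_derivative[OF \<pi>(2)] this]
    have "(f' has_derivative (\<lambda>h. D (\<pi> h))) (at x)" by (simp add: f'_def[abs_def])
    moreover have "\<forall>(u, v, c)\<in>R'. D (\<pi> v) = c * D (\<pi> u)"
    proof -
      have "D 0 = 0" using D(1) has_derivative_linear linear_0 by blast
      then show ?thesis using D(2) RS \<pi>(3) by (fastforce simp: R'_def)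
    qed
    ultimately show "\<exists>D. (f' has_derivative D) (at x) \<and> (\<forall>(u, v, c)\<in>R'. D v = c * D u)" by blast
  qed
  have "u \<in> S" "v \<in> S" using RS[OF plane(1)] by auto
  then have plS: "plane_map u v z \<in> S" for z
    unfolding plane_map_def using S by (intro subspace_add subspace_scale)
  have \<pi>pl: "\<pi> (x + plane_map u v z) = \<pi> x + plane_map u v z" for x z
    by (simp add: linear_add[OF \<pi>(2)] \<pi>(3)[OF plS])
  obtain P where P: "P > 0" "\<And>x. norm (\<pi> x) \<le> norm x * P"
    using \<pi>(2) bounded_linear.pos_bounded linear_conv_bounded_linear by blast
  obtain m where m: "m > 0" "\<And>z. m * norm z \<le> norm (plane_map u v z)"
    using linear_inj_bounded_below_pos[OF linear_plane_map plane(3)] by metis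
  obtain B where B: "B > 0" "\<And>x. x \<in> closure \<Omega> \<Longrightarrow> norm x \<le> B"
    using bounded_closure[OF \<Omega>(2)] unfolding bounded_pos by blast
  have KB: "norm x \<le> B" if "x \<in> K" for x using that B(2) closure_subset by (auto simp: K_def)
  interpret collar R' a u v \<Omega>' K' f'
  proof unfold_locales
    show "elliptic a" by (rule plane(2))
    show "(u, v, a) \<in> R'" using plane(1) by (simp add: R'_def)
    show "open \<Omega>'" "closed K'" by (rule o\<Omega>', rule clK')
    show "K' \<subseteq> \<Omega>'" by (auto simp: K'_def \<Omega>'_def K_def)
    show "solves R' f' (\<Omega>' - K')"
      by (rule solves_subset[OF sf]) (auto simp: K'_def \<Omega>'_def K_def)
    fix X :: "'x set" assume "bounded X"
    then obtain b where b: "\<And>x. x \<in> X \<Longrightarrow> norm x \<le> b" by (auto simp: bounded_iff)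
    have "norm z \<le> (B + b * P) / m" if "x \<in> X" "x + plane_map u v z \<in> K'" for x z
    proof -
      have "norm (\<pi> x + plane_map u v z) \<le> B" using that(2) KB \<pi>pl by (simp add: K'_def)
      moreover have "norm (\<pi> x) \<le> b * P"
        using P b[OF that(1)] by (meson order_trans mult_right_mono less_imp_le)
      moreover have "m * norm z \<le> norm (\<pi> x + plane_map u v z) + norm (\<pi> x)"
        using m(2)[of z] norm_triangle_ineq4[of "\<pi> x + plane_map u v z" "\<pi> x"] by simp
      ultimately show ?thesis using m(1) by (simp add: pos_le_divide_eq mult.commute)
    qed
    then show "bounded {z. \<exists>x\<in>X. x + plane_map u v z \<in> K'}" unfolding bounded_iff by blast
  qed
  obtain f1 f2 where F: "solves R' f1 \<Omega>'" "solves R' f2 (- K')" "\<And>x. x \<in> \<Omega>' - K' \<Longrightarrow> f' x = f1 x - f2 x"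
    "\<And>x. (\<And>z. x + plane_map u v z \<notin> K') \<Longrightarrow> f2 x = 0"
    using collar_splitting by blast
  have "subspace (range (plane_map u v))"
    using linear_subspace_image[OF linear_plane_map subspace_UNIV] .
  then have "open (- range (plane_map u v))" by (intro open_Compl closed_subspace)
  then obtain d where d: "d > 0" "ball w d \<subseteq> - range (plane_map u v)" using w(2) by (metis ComplI openE)
  have wd: "d \<le> norm (w + plane_map u v z)" for z
  proof -
    have "plane_map u v (- z) \<notin> ball w d" using d(2) by blast
    then show ?thesis by (simp add: dist_norm linear_neg[OF linear_plane_map] not_less)
  qed
  \<comment> \<open>Every point of the plane through \<open>w\<close> has norm at least
    \<open>d\<close>; scaling by \<open>l\<close> raises this to \<open>B + 2\<close>, which leaves
    room for perturbing \<open>x0\<close> by less than 1 while staying outside the ball of radius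
    \<open>B\<close>.\<close>
  define l where "l = (B + 2) / d"
  have l: "l > 0" "l * d = B + 2" using B(1) d(1) by (simp_all add: l_def)
  define x0 where "x0 = l *\<^sub>R w"
  have x0S: "x0 \<in> S" unfolding x0_def using S w(1) by (rule subspace_scale)
  have far: "B + 2 \<le> norm (x0 + plane_map u v z)" for z
  proof -
    have "B + 2 \<le> l * norm (w + plane_map u v (z /\<^sub>R l))" using wd l by (metis mult_left_mono less_imp_le)
    also have "\<dots> = norm (l *\<^sub>R (w + plane_map u v (z /\<^sub>R l)))" using l(1) by simp
    also have "l *\<^sub>R (w + plane_map u v (z /\<^sub>R l)) = x0 + plane_map u v z"
      using l(1) unfolding x0_def scaleR_right_distrib linear_cmul[OF linear_plane_map, symmetric]
      by (simp del: scaleR_Pair)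
    finally show ?thesis .
  qed
  have x0cl: "x0 \<notin> closure \<Omega>" using far[of 0] B(2)[of x0] by (auto simp: plane_map_def)
  have z0: "zero_near f2 x0"
    unfolding zero_near_def
  proof (intro exI conjI ballI)
    show "1 / P > 0" using P by simp
    fix y assume y: "y \<in> ball x0 (1 / P)"
    show "f2 y = 0"
    proof (rule F(4))
      fix z
      have "norm (x0 - \<pi> y) = norm (\<pi> (x0 - y))" by (simp add: linear_diff[OF \<pi>(2)] \<pi>(3)[OF x0S])
      also have "\<dots> \<le> norm (x0 - y) * P" by (rule P(2))
      also have "\<dots> < 1" using y P(1) by (simp add: dist_norm field_simps)
      finally have "norm (x0 - \<pi> y) < 1" .
      then have "B < norm (\<pi> y + plane_map u v z)"
        using far[of z] norm_triangle_ineq[of "x0 - \<pi> y" "\<pi> y + plane_map u v z"] by simp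
      then show "y + plane_map u v z \<notin> K'" using KB[of "\<pi> y + plane_map u v z"] by (auto simp: K'_def \<pi>pl)
    qed
  qed
  obtain A y where A: "connected A" "x0 \<in> A" "y \<in> A" "y \<in> top_of_set S frontier_of \<Omega>" "A \<subseteq> S"
    "A \<inter> closure \<Omega> \<subseteq> {y}"
    using exit_through_frontier[OF S \<Omega>(1) \<omega> x0S x0cl] by blast
  \<comment> \<open>The path meets the closure of \<open>\<Omega>\<close> only in the frontier,
    which lies in \<open>U\<close>; hence path and frontier, sharing the point \<open>y\<close>,
    form a connected set off \<open>K'\<close>.\<close>
  let ?C = "A \<union> top_of_set S frontier_of \<Omega>"
  have "connected ?C" using A fr by (intro connected_Un) auto
  moreover have "?C \<subseteq> - K'"
  proof
    fix x assume x: "x \<in> ?C"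
    then have "\<pi> x = x" using A(5) \<pi>(3) fr_eq by auto
    moreover have "x \<notin> K"
    proof
      assume xK: "x \<in> K"
      then have "x \<in> closure \<Omega>" using closure_subset by (auto simp: K_def)
      then have "x \<in> top_of_set S frontier_of \<Omega>" using x A(4,6) by blast
      then show False using xK U(2) by (auto simp: K_def)
    qed
    ultimately show "x \<in> - K'" by (simp add: K'_def)
  qed
  ultimately have zfr: "zero_near f2 x" if "x \<in> top_of_set S frontier_of \<Omega>" for x
    using unique_continuation[OF F(2) _ _ _ _ z0, of ?C x] clK' A(2) that by blast
  show ?thesis
  proof (rule that[of f1 "S \<inter> {x. zero_near f2 x} \<inter> U"])
    show "solves R f1 \<Omega>"
      unfolding solves_def
    proof
      fix x assume "x \<in> \<Omega>"
      then have "x \<in> \<Omega>'" using \<pi>(3) \<Omega>S by (auto simp: \<Omega>'_def)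
      then obtain D where "(f1 has_derivative D) (at x)" "\<forall>(u, v, c)\<in>R'. D v = c * D u"
        using F(1) unfolding solves_def by blast
      then show "\<exists>D. (f1 has_derivative D) (at x) \<and> (\<forall>(u, v, c)\<in>R. D v = c * D u)"
        unfolding R'_def by blast
    qed
    show "openin (top_of_set S) (S \<inter> {x. zero_near f2 x} \<inter> U)"
      by (intro openin_Int openin_open_Int open_zero_near U(1))
    show "top_of_set S frontier_of \<Omega> \<subseteq> S \<inter> {x. zero_near f2 x} \<inter> U"
      using zfr U(2) fr_eq by blast
    fix x assume x: "x \<in> \<Omega> \<inter> (S \<inter> {x. zero_near f2 x} \<inter> U)"
    then have "\<pi> x = x" using \<pi>(3) by blast
    moreover have "f2 x = 0" using x by (force simp: zero_near_def)
    ultimately show "f1 x = f x"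
      using F(3)[of x] x by (simp add: \<Omega>'_def K'_def K_def f'_def)
  qed blast
qed

section \<open>Superspaces\<close>

lemma linear_axis: "linear (axis i :: 'a::real_vector \<Rightarrow> 'a ^ 'v::finite)"
  by (auto intro!: linearI simp: axis_def vec_eq_iff)

lemma axis_nth_if: "axis i x $ j = (if j = i then x else 0)"
  by (simp add: axis_def)

lemma vec_eq_sum_axis: "x = (\<Sum>i\<in>UNIV. axis i (x $ i))" for x :: "'a::real_vector ^ 'v::finite"
  by (simp add: vec_eq_iff axis_nth_if sum.delta')

text \<open>The line through \<open>x\<close> in a direction of \<open>S\<close> stays in
  \<open>U\<close> for small parameters because \<open>U\<close> is relatively open, so the
  two-sided partial derivative can be read off from the derivative within \<open>U\<close>.\<close>

lemma pd_eq_derivative: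
  fixes f :: "'a::{euclidean_space,real_algebra_1} ^ 'v::finite \<Rightarrow> 'a"
  assumes S: "subspace S" and U: "openin (top_of_set S) U" and x: "x \<in> U"
    and f': "(f has_derivative f') (at x within U)" and b: "axis i b \<in> S"
  shows "pd f i b x = f' (axis i b)"
proof -
  obtain V where V: "open V" "U = S \<inter> V" using U openin_open by blast
  define q where "q t = x + t *\<^sub>R axis i b" for t :: real
  define T where "T = q -` V"
  have "open T" unfolding T_def q_def by (intro open_vimage V(1) continuous_intros)
  have T0: "0 \<in> T" using x V(2) by (simp add: T_def q_def)
  have "q t \<in> S" for t
    unfolding q_def using S x V(2) b by (intro subspace_add subspace_scale) auto
  then have qT: "q ` T \<subseteq> U" using V(2) by (auto simp: T_def)
  have q': "(q has_derivative (\<lambda>t. t *\<^sub>R axis i b)) (at 0 within T)"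
    unfolding q_def by (auto intro!: derivative_eq_intros)
  have "(f has_derivative f') (at (q 0) within q ` T)"
    using has_derivative_subset[OF f' qT] by (simp add: q_def)
  from has_derivative_in_compose[OF q' this]
  have "((\<lambda>t. f (q t)) has_derivative (\<lambda>t. f' (t *\<^sub>R axis i b))) (at 0)"
    unfolding at_within_open[OF T0 \<open>open T\<close>] .
  then have "((\<lambda>t. f (q t)) has_vector_derivative f' (axis i b)) (at 0)"
    using linear_cmul[OF has_derivative_linear[OF f']] by (simp add: has_vector_derivative_def)
  then show ?thesis unfolding pd_def q_def by (rule vector_derivative_at)
qed

lemma comm_superalgebraD:
  assumes "comm_superalgebra \<Lambda>"
  shows "subspace (\<Lambda> 0)" "subspace (\<Lambda> 1)" "\<And>x. \<exists>u\<in>\<Lambda> 0. \<exists>v\<in>\<Lambda> 1. x = u + v"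
    "\<And>a b. a \<in> \<Lambda> 0 \<Longrightarrow> b \<in> \<Lambda> 0 \<Longrightarrow> a * b \<in> \<Lambda> 0" "\<And>a b. a \<in> \<Lambda> 0 \<Longrightarrow> b \<in> \<Lambda> 1 \<Longrightarrow> a * b \<in> \<Lambda> 1"
    "\<And>a b. a \<in> \<Lambda> 0 \<Longrightarrow> b \<in> \<Lambda> 0 \<Longrightarrow> a * b = b * a" "\<And>a b. a \<in> \<Lambda> 0 \<Longrightarrow> b \<in> \<Lambda> 1 \<Longrightarrow> a * b = b * a"
proof -
  have *: "a * b \<in> \<Lambda> ((i + j) mod 2) \<and> a * b = (-1) ^ (i * j) * (b * a)"
    if "i \<in> {0,1}" "j \<in> {0,1}" "a \<in> \<Lambda> i" "b \<in> \<Lambda> j" for i j a b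
    using assms that unfolding comm_superalgebra_def by blast
  show "subspace (\<Lambda> 0)" "subspace (\<Lambda> 1)" "\<And>x. \<exists>u\<in>\<Lambda> 0. \<exists>v\<in>\<Lambda> 1. x = u + v"
    using assms unfolding comm_superalgebra_def by blast+
  show "\<And>a b. a \<in> \<Lambda> 0 \<Longrightarrow> b \<in> \<Lambda> 0 \<Longrightarrow> a * b \<in> \<Lambda> 0" "\<And>a b. a \<in> \<Lambda> 0 \<Longrightarrow> b \<in> \<Lambda> 0 \<Longrightarrow> a * b = b * a"
    using *[of 0 0] by auto
  show "\<And>a b. a \<in> \<Lambda> 0 \<Longrightarrow> b \<in> \<Lambda> 1 \<Longrightarrow> a * b \<in> \<Lambda> 1" "\<And>a b. a \<in> \<Lambda> 0 \<Longrightarrow> b \<in> \<Lambda> 1 \<Longrightarrow> a * b = b * a"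
    using *[of 0 1] by auto
qed

text \<open>The sign \<open>(-1) ^ (i * j)\<close> is 1 when one factor is even.\<close>

lemma central_even:
  assumes "comm_superalgebra \<Lambda>" "c \<in> \<Lambda> 0"
  shows "central c"
  unfolding central_def
proof
  fix y
  obtain u v where "u \<in> \<Lambda> 0" "v \<in> \<Lambda> 1" "y = u + v" using comm_superalgebraD(3)[OF assms(1)] by blast
  then show "c * y = y * c"
    using comm_superalgebraD(6,7)[OF assms(1) assms(2)] by (simp add: algebra_simps)
qed

lemma subspace_superspace:
  assumes "subspace (\<Lambda> 0)" "subspace (\<Lambda> 1)"
  shows "subspace (superspace \<Lambda> E)"
  using assms by (auto simp: superspace_def subspace_def)

section \<open>Blocks of coordinate directions and their equations\<close>

locale superspace_setup =
  fixes \<Lambda> :: "nat \<Rightarrow> 'a::{euclidean_space, real_algebra_1} set"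
    and p q r :: nat and s :: "nat \<Rightarrow> nat" and e \<epsilon> a :: "nat \<Rightarrow> 'a"
    and E :: "'v::finite set"
  assumes csa: "comm_superalgebra \<Lambda>" and A0: "cond_A0 \<Lambda> p e" and A1: "cond_A1 \<Lambda> q r s \<epsilon> a"
begin

abbreviation "S \<equiv> superspace \<Lambda> E"

lemma subspace_S: "subspace S"
  using subspace_superspace comm_superalgebraD(1,2)[OF csa] by blast

lemma basis_e: "inj_on e {0..p}" "independent (e ` {0..p})" "span (e ` {0..p}) = \<Lambda> 0"
  "e 0 = 1" "(\<Sum>k=0..p. (e k)\<^sup>2) = 0"
  using A0 by (auto simp: cond_A0_def indexed_basis_def)

lemma basis_\<epsilon>: "inj_on \<epsilon> {1..q}" "independent (\<epsilon> ` {1..q})" "span (\<epsilon> ` {1..q}) = \<Lambda> 1"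
  using A1 by (auto simp: cond_A1_def indexed_basis_def)

lemma block_bounds: "s 1 = 1" "s (r + 1) = q + 1" "strict_mono_on {1..r+1} s"
  using A1 by (auto simp: cond_A1_def)

lemma block:
  assumes "k \<in> {1..r}"
  shows "\<And>j. j \<in> {s k..<s (k + 1)} \<Longrightarrow> \<epsilon> j = a j * \<epsilon> (s k)" "a (s k) = 1"
    "(\<Sum>j = s k..<s (k + 1). (a j)\<^sup>2) = 0"
proof -
  have "(\<forall>j\<in>{s k..<s (k + 1)}. \<epsilon> j = a j * \<epsilon> (s k)) \<and> a (s k) = 1 \<and>
      (\<Sum>j = s k..<s (k + 1). (a j)\<^sup>2) = 0"
    using A1 assms unfolding cond_A1_def by (elim conjE) (erule bspec)
  then show "\<And>j. j \<in> {s k..<s (k + 1)} \<Longrightarrow> \<epsilon> j = a j * \<epsilon> (s k)" "a (s k) = 1"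
    "(\<Sum>j = s k..<s (k + 1). (a j)\<^sup>2) = 0" by blast+
qed

lemma a_even: "j \<in> {1..q} \<Longrightarrow> a j \<in> \<Lambda> 0"
  using A1 by (auto simp: cond_A1_def)

lemma e_even: "j \<le> p \<Longrightarrow> e j \<in> \<Lambda> 0"
  using basis_e(3) span_base[of "e j" "e ` {0..p}"] by auto

lemma \<epsilon>_odd: "j \<in> {1..q} \<Longrightarrow> \<epsilon> j \<in> \<Lambda> 1"
  using basis_\<epsilon>(3) span_base[of "\<epsilon> j" "\<epsilon> ` {1..q}"] by auto

lemma s_mono: "k \<in> {1..r+1} \<Longrightarrow> l \<in> {1..r+1} \<Longrightarrow> k \<le> l \<Longrightarrow> s k \<le> s l"
  using strict_mono_onD[OF block_bounds(3), of k l] by (cases "k = l") (simp_all add: less_imp_le)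

lemma s_less: "k \<in> {1..r} \<Longrightarrow> s k < s (k + 1)"
  using strict_mono_onD[OF block_bounds(3), of k "k + 1"] by simp

lemma block_subset:
  assumes "k \<in> {1..r}"
  shows "{s k..<s (k + 1)} \<subseteq> {1..q}"
proof -
  have "1 \<le> s k" using s_mono[of 1 k] block_bounds(1) assms by auto
  moreover have "s (k + 1) \<le> q + 1" using s_mono[of "k + 1" "r + 1"] block_bounds(2) assms by auto
  ultimately show ?thesis by auto
qed

lemma block_unique:
  assumes "k \<in> {1..r}" "l \<in> {1..r}" "t \<in> {s k..<s (k + 1)}" "t \<in> {s l..<s (l + 1)}"
  shows "k = l"
proof (rule ccontr)
  assume "k \<noteq> l"
  then consider "k + 1 \<le> l" | "l + 1 \<le> k" by linarith
  then show False
  proof cases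
    case 1 then show False using s_mono[of "k + 1" l] assms by auto
  next
    case 2 then show False using s_mono[of "l + 1" k] assms by auto
  qed
qed

lemma block_cover:
  assumes "j \<in> {1..q}"
  obtains k where "k \<in> {1..r}" "j \<in> {s k..<s (k + 1)}"
proof -
  define A where "A = {k \<in> {1..r+1}. s k \<le> j}"
  have A: "finite A" "1 \<in> A" using block_bounds(1) assms by (auto simp: A_def)
  define k where "k = Max A"
  have k: "k \<in> A" using Max_in[OF A(1)] A(2) by (auto simp: k_def)
  have "k \<noteq> r + 1" using k block_bounds(2) assms by (auto simp: A_def)
  then have kr: "k \<in> {1..r}" using k by (auto simp: A_def)
  have "k + 1 \<notin> A" using Max_ge[OF A(1), of "k + 1"] by (auto simp: k_def)
  then have "j < s (k + 1)" using kr by (auto simp: A_def)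
  with kr k that show ?thesis by (auto simp: A_def)
qed

text \<open>
  A block \<open>(i, g, d, \<alpha>)\<close> consists of the coordinate directions \<open>axis i (\<alpha> j * g)\<close> with \<open>j \<le> d\<close>:
  all directions of an even variable, or one block of an odd one.
\<close>
inductive_set blocks :: "('v \<times> 'a \<times> nat \<times> (nat \<Rightarrow> 'a)) set" where
  even: "i \<in> E \<Longrightarrow> (i, 1, p, e) \<in> blocks"
| odd: "i \<notin> E \<Longrightarrow> k \<in> {1..r} \<Longrightarrow> (i, \<epsilon> (s k), s (k + 1) - 1 - s k, \<lambda>j. a (s k + j)) \<in> blocks"

lemma blocksD:
  assumes "(i, g, d, \<alpha>) \<in> blocks"
  shows "\<alpha> 0 = 1" "(\<Sum>j\<le>d. (\<alpha> j)\<^sup>2) = 0" "j \<le> d \<Longrightarrow> \<alpha> j \<in> \<Lambda> 0" "g \<noteq> 0"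
    "c \<in> \<Lambda> 0 \<Longrightarrow> axis i (c * g) \<in> S" "axis i g \<in> S"
proof -
  have "\<alpha> 0 = 1 \<and> (\<Sum>j\<le>d. (\<alpha> j)\<^sup>2) = 0 \<and> (\<forall>j\<le>d. \<alpha> j \<in> \<Lambda> 0) \<and> g \<noteq> 0 \<and>
    (\<forall>c\<in>\<Lambda> 0. axis i (c * g) \<in> S)"
    using assms
  proof cases
    case even
    then show ?thesis
      using basis_e(4,5) e_even subspace_0[OF comm_superalgebraD(1)[OF csa]] subspace_0[OF comm_superalgebraD(2)[OF csa]]
      by (auto simp: superspace_def axis_nth_if atLeast0AtMost)
  next
    case (odd k)
    have lt: "s k < s (k + 1)" by (rule s_less[OF odd(5)])
    have sub: "{s k..<s (k + 1)} \<subseteq> {1..q}" by (rule block_subset[OF odd(5)])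
    have "(\<Sum>j\<le>d. (\<alpha> j)\<^sup>2) = (\<Sum>j = s k..<s (k + 1). (a j)\<^sup>2)"
      by (rule sum.reindex_bij_witness[of _ "\<lambda>j. j - s k" "\<lambda>j. j + s k"])
        (use lt in \<open>auto simp: odd add.commute\<close>)
    moreover have "\<alpha> j \<in> \<Lambda> 0" if "j \<le> d" for j
      using that lt sub a_even[of "s k + j"] by (auto simp: odd subset_iff)
    moreover have "s k \<in> {1..q}" using lt sub by auto
    then have "g \<in> \<Lambda> 1" "g \<noteq> 0"
      using \<epsilon>_odd dependent_zero[of "\<epsilon> ` {1..q}"] basis_\<epsilon>(2) by (force simp: odd)+
    ultimately show ?thesis
      using block(2,3)[OF odd(5)] comm_superalgebraD(5)[OF csa] odd(4)
        subspace_0[OF comm_superalgebraD(1)[OF csa]] subspace_0[OF comm_superalgebraD(2)[OF csa]]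
      by (auto simp: superspace_def axis_nth_if odd)
  qed
  then show *: "\<alpha> 0 = 1" "(\<Sum>j\<le>d. (\<alpha> j)\<^sup>2) = 0" "j \<le> d \<Longrightarrow> \<alpha> j \<in> \<Lambda> 0" "g \<noteq> 0"
    "c \<in> \<Lambda> 0 \<Longrightarrow> axis i (c * g) \<in> S" for j c by blast+
  have "(1::'a) \<in> \<Lambda> 0" using e_even[of 0] basis_e(4) by simp
  from *(5)[OF this] show "axis i g \<in> S" by simp
qed

text \<open>Coefficients range over the whole real span: the equation is linear in \<open>c\<close>,
  and since \<open>\<alpha> 0 = 1\<close> is never elliptic, elliptic coefficients are found among
  the combinations.\<close>

definition eqs :: "(('a ^ 'v) \<times> ('a ^ 'v) \<times> 'a) set" where
  "eqs = {(axis i g, axis i (c * g), c) |i g c. \<exists>d \<alpha>. (i, g, d, \<alpha>) \<in> blocks \<and> c \<in> span (\<alpha> ` {..d})}"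

lemma block_span_even:
  assumes "(i, g, d, \<alpha>) \<in> blocks"
  shows "span (\<alpha> ` {..d}) \<subseteq> \<Lambda> 0"
  by (rule span_minimal[OF _ comm_superalgebraD(1)[OF csa]]) (use blocksD(3)[OF assms] in auto)

lemma eqs_in_S:
  assumes "(u, v, c) \<in> eqs"
  shows "u \<in> S \<and> v \<in> S \<and> central c"
proof -
  obtain i g d \<alpha> where b: "(i, g, d, \<alpha>) \<in> blocks" "c \<in> span (\<alpha> ` {..d})" "u = axis i g" "v = axis i (c * g)"
    using assms by (auto simp: eqs_def)
  then have "c \<in> \<Lambda> 0" using block_span_even by blast
  then show ?thesis using blocksD(5,6)[OF b(1)] central_even[OF csa] b by simp
qed

text \<open>By \<open>cond_A0\<close> or \<open>cond_A1\<close> the squares of the coefficients of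
  this curve sum to 0, so only finitely many integers give an element with a real
  eigenvalue.\<close>

lemma block_elliptic_parameters:
  assumes "(i, g, d, \<alpha>) \<in> blocks"
  shows "infinite {t::nat. elliptic (\<Sum>k\<le>d. (real t ^ k) *\<^sub>R \<alpha> k)}"
proof -
  have "finite {t::nat. \<not> elliptic (\<Sum>k\<le>d. (real t ^ k) *\<^sub>R \<alpha> k)}"
    by (rule finite_not_elliptic_parameters[OF _ blocksD(1,2)[OF assms]])
      (use central_even[OF csa] blocksD(3)[OF assms] in blast)
  then have "infinite (- {t::nat. \<not> elliptic (\<Sum>k\<le>d. (real t ^ k) *\<^sub>R \<alpha> k)})"
    by (simp add: Compl_eq_Diff_UNIV)
  then show ?thesis by (simp add: Compl_eq)
qed

lemma block_eqs:
  assumes "(i, g, d, \<alpha>) \<in> blocks"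
  shows "(axis i g, axis i ((\<Sum>k\<le>d. (real t ^ k) *\<^sub>R \<alpha> k) * g), \<Sum>k\<le>d. (real t ^ k) *\<^sub>R \<alpha> k) \<in> eqs"
proof -
  have "(\<Sum>k\<le>d. (real t ^ k) *\<^sub>R \<alpha> k) \<in> span (\<alpha> ` {..d})"
    by (intro span_sum span_scale span_base) auto
  then show ?thesis using assms unfolding eqs_def by blast
qed

text \<open>A single direction \<open>axis i (\<alpha> j * g)\<close> may have a coefficient that is
  not elliptic. Infinitely many points of the curve are elliptic, and a subspace containing
  infinitely many values of a vector polynomial contains its coefficients.\<close>

lemma eqs_span:
  "S \<subseteq> span ({u. \<exists>v c. (u, v, c) \<in> eqs \<and> elliptic c} \<union> {v. \<exists>u c. (u, v, c) \<in> eqs \<and> elliptic c})"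
    (is "S \<subseteq> span ?core")
proof
  have blk: "axis i (\<alpha> j * g) \<in> span ?core" if b: "(i, g, d, \<alpha>) \<in> blocks" and j: "j \<le> d" for i g d \<alpha> j
  proof (rule vector_polynomial_in_subspace[OF subspace_span, where c = "\<lambda>j. axis i (\<alpha> j * g)" and d = d])
    have "{t::nat. elliptic (\<Sum>k\<le>d. (real t ^ k) *\<^sub>R \<alpha> k)}
        \<subseteq> {t. (\<Sum>k\<le>d. real t ^ k *\<^sub>R axis i (\<alpha> k * g)) \<in> span ?core}"
    proof
      fix t :: nat assume "t \<in> {t. elliptic (\<Sum>k\<le>d. (real t ^ k) *\<^sub>R \<alpha> k)}"
      then have "axis i ((\<Sum>k\<le>d. (real t ^ k) *\<^sub>R \<alpha> k) * g) \<in> ?core"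
        using block_eqs[OF b, of t] by blast
      moreover have "axis i ((\<Sum>k\<le>d. (real t ^ k) *\<^sub>R \<alpha> k) * g) = (\<Sum>k\<le>d. real t ^ k *\<^sub>R axis i (\<alpha> k * g))"
        by (simp add: sum_distrib_right linear_sum[OF linear_axis] linear_cmul[OF linear_axis])
      ultimately show "t \<in> {t. (\<Sum>k\<le>d. real t ^ k *\<^sub>R axis i (\<alpha> k * g)) \<in> span ?core}"
        using span_base[of _ ?core] by simp
    qed
    then show "infinite {t. (\<Sum>k\<le>d. real t ^ k *\<^sub>R axis i (\<alpha> k * g)) \<in> span ?core}"
      using block_elliptic_parameters[OF b] finite_subset by blast
  qed (rule j)
  have ax: "axis i y \<in> span ?core" if "\<And>b. b \<in> B \<Longrightarrow> axis i b \<in> span ?core" "y \<in> span B" for i y B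
  proof -
    have "axis i ` span B = span (axis i ` B)" using linear_span_image[OF linear_axis] by metis
    also have "\<dots> \<subseteq> span ?core" by (rule span_minimal) (use that(1) in auto)
    finally show ?thesis using that(2) by blast
  qed
  fix x assume x: "x \<in> S"
  have "axis i (x $ i) \<in> span ?core" for i
  proof (cases "i \<in> E")
    case True
    show ?thesis
    proof (rule ax)
      show "x $ i \<in> span (e ` {0..p})" using x True by (simp add: basis_e(3) superspace_def)
      show "axis i b \<in> span ?core" if "b \<in> e ` {0..p}" for b
        using that blk[OF blocks.even[OF True]] by force
    qed
  next
    case False
    show ?thesis
    proof (rule ax)
      show "x $ i \<in> span (\<epsilon> ` {1..q})" unfolding basis_\<epsilon>(3) using x False by (simp add: superspace_def)
      show "axis i b \<in> span ?core" if b: "b \<in> \<epsilon> ` {1..q}" for b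
      proof -
        obtain j where j: "j \<in> {1..q}" "b = \<epsilon> j" using b by blast
        obtain k where k: "k \<in> {1..r}" "j \<in> {s k..<s (k + 1)}" using block_cover[OF j(1)] by blast
        have "axis i (a (s k + (j - s k)) * \<epsilon> (s k)) \<in> span ?core"
          by (rule blk[OF blocks.odd[OF False k(1)]]) (use k(2) in auto)
        then show ?thesis using block(1)[OF k] k(2) j(2) by simp
      qed
    qed
  qed
  then have "(\<Sum>i\<in>UNIV. axis i (x $ i)) \<in> span ?core" by (intro span_sum)
  then show "x \<in> span ?core" using vec_eq_sum_axis[of x] by simp
qed

section \<open>The form d'' and the system of equations\<close>

lemma d_second_even:
  assumes i: "i \<in> E" and j: "j \<in> {1..p}"
  shows "d_second E p e q r s \<epsilon> a f x (axis i (e j)) = pd f i (e j) x - e j * pd f i (e 0) x"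
proof -
  have rep: "representation (e ` {0..p}) (axis i (e j) $ i') (e j') = (if i' = i \<and> j' = j then 1 else 0)"
    if "j' \<in> {1..p}" for i' j'
  proof (cases "i' = i")
    case True
    have "e j' = e j \<longleftrightarrow> j' = j" using inj_onD[OF basis_e(1), of j' j] that j by auto
    then show ?thesis using True representation_basis[OF basis_e(2), of "e j"] j by (auto simp: axis_nth_if)
  qed (simp add: axis_nth_if representation_zero)
  have "(\<Sum>i'\<in>E. \<Sum>j'=1..p. representation (e ` {0..p}) (axis i (e j) $ i') (e j') *\<^sub>R
      (pd f i' (e j') x - e j' * pd f i' (e 0) x)) =
    (\<Sum>i'\<in>E. \<Sum>j'=1..p. if i' = i \<and> j' = j then pd f i (e j) x - e j * pd f i (e 0) x else 0)"
    by (intro sum.cong refl) (simp add: rep)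
  also have "\<dots> = (\<Sum>i'\<in>E. if i' = i then pd f i (e j) x - e j * pd f i (e 0) x else 0)"
    using j by (intro sum.cong refl) (simp add: sum.delta')
  also have "\<dots> = pd f i (e j) x - e j * pd f i (e 0) x" using i by (simp add: sum.delta')
  finally have 1: "(\<Sum>i'\<in>E. \<Sum>j'=1..p. representation (e ` {0..p}) (axis i (e j) $ i') (e j') *\<^sub>R
      (pd f i' (e j') x - e j' * pd f i' (e 0) x)) = pd f i (e j) x - e j * pd f i (e 0) x" .
  have "axis i (e j) $ i' = 0" if "i' \<in> - E" for i' using that i by (auto simp: axis_nth_if)
  then show ?thesis unfolding d_second_def 1 by (simp add: representation_zero)
qed

lemma d_second_odd:
  assumes i: "i \<notin> E" and k: "k \<in> {1..r}" and t: "t \<in> {s k + 1..<s (k + 1)}"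
  shows "d_second E p e q r s \<epsilon> a f x (axis i (\<epsilon> t)) = pd f i (\<epsilon> t) x - a t * pd f i (\<epsilon> (s k)) x"
proof -
  have "t \<in> {s k..<s (k + 1)}" using t by simp
  then have tq: "t \<in> {1..q}" using block_subset[OF k] by blast
  let ?X = "pd f i (\<epsilon> t) x - a t * pd f i (\<epsilon> (s k)) x"
  have rep: "representation (\<epsilon> ` {1..q}) (axis i (\<epsilon> t) $ i') (\<epsilon> t') = (if i' = i \<and> t' = t then 1 else 0)"
    if "t' \<in> {1..q}" for i' t'
  proof (cases "i' = i")
    case True
    have "\<epsilon> t' = \<epsilon> t \<longleftrightarrow> t' = t" using inj_onD[OF basis_\<epsilon>(1), of t' t] that tq by auto
    then show ?thesis using True representation_basis[OF basis_\<epsilon>(2), of "\<epsilon> t"] tq by (auto simp: axis_nth_if)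
  qed (simp add: axis_nth_if representation_zero)
  have "(\<Sum>i'\<in>-E. \<Sum>k'=1..r. \<Sum>t' = s k' + 1..<s (k' + 1).
        representation (\<epsilon> ` {1..q}) (axis i (\<epsilon> t) $ i') (\<epsilon> t') *\<^sub>R
          (pd f i' (\<epsilon> t') x - a t' * pd f i' (\<epsilon> (s k')) x)) =
    (\<Sum>i'\<in>-E. \<Sum>k'=1..r. \<Sum>t' = s k' + 1..<s (k' + 1). if t' = t then (if i' = i \<and> k' = k then ?X else 0) else 0)"
  proof (intro sum.cong refl)
    fix i' k' t' assume k': "k' \<in> {1..r}" and t': "t' \<in> {s k' + 1..<s (k' + 1)}"
    have "t' \<in> {s k'..<s (k' + 1)}" using t' by simp
    then have tq': "t' \<in> {1..q}" using block_subset[OF k'] by blast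
    \<comment> \<open>Blocks are disjoint, so the index \<open>t\<close> determines its block and
      the triple sum reduces to one term.\<close>
    have kk: "k' = k" if "t' = t" using block_unique[OF k' k, of t] t t' that by auto
    show "representation (\<epsilon> ` {1..q}) (axis i (\<epsilon> t) $ i') (\<epsilon> t') *\<^sub>R
          (pd f i' (\<epsilon> t') x - a t' * pd f i' (\<epsilon> (s k')) x) =
        (if t' = t then (if i' = i \<and> k' = k then ?X else 0) else 0)"
      unfolding rep[OF tq'] using kk by auto
  qed
  also have "\<dots> = (\<Sum>i'\<in>-E. \<Sum>k'=1..r. if k' = k then (if i' = i then ?X else 0) else 0)"
    using t by (intro sum.cong refl) (auto simp: sum.delta')
  also have "\<dots> = (\<Sum>i'\<in>-E. if i' = i then ?X else 0)"
    using k by (intro sum.cong refl) (simp add: sum.delta')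
  also have "\<dots> = ?X" using i by (simp add: sum.delta')
  finally have 1: "(\<Sum>i'\<in>-E. \<Sum>k'=1..r. \<Sum>t' = s k' + 1..<s (k' + 1).
        representation (\<epsilon> ` {1..q}) (axis i (\<epsilon> t) $ i') (\<epsilon> t') *\<^sub>R
          (pd f i' (\<epsilon> t') x - a t' * pd f i' (\<epsilon> (s k')) x)) = ?X" .
  have "axis i (\<epsilon> t) $ i' = 0" if "i' \<in> E" for i' using that i by (auto simp: axis_nth_if)
  then show ?thesis unfolding d_second_def 1 by (simp add: representation_zero)
qed

text \<open>Tested on coordinate directions, the form gives the equations for the coefficients
  \<open>\<alpha> j\<close>; linearity of the derivative extends them to their span.\<close>

lemma qS_imp_eqs:
  assumes f: "qS_differentiable_on \<Lambda> E p e q r s \<epsilon> a f U" and U: "openin (top_of_set S) U" and x: "x \<in> U"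
  shows "\<exists>f'. (f has_derivative f') (at x within U) \<and> (\<forall>(u, v, c)\<in>eqs. f' v = c * f' u)"
proof -
  obtain f' where f': "(f has_derivative f') (at x within U)"
    using f x unfolding qS_differentiable_on_def differentiable_on_def differentiable_def by blast
  have lin: "linear f'" using f' has_derivative_linear by blast
  have d0: "d_second E p e q r s \<epsilon> a f x h = 0" if "h \<in> S" for h
    using f x that unfolding qS_differentiable_on_def by blast
  note pd = pd_eq_derivative[OF subspace_S U x f']
  have base: "f' (axis i (\<alpha> j * g)) = \<alpha> j * f' (axis i g)" if b: "(i, g, d, \<alpha>) \<in> blocks" and j: "j \<le> d" for i g d \<alpha> j
    using b
  proof cases
    case even
    show ?thesis
    proof (cases "j = 0")
      \<comment> \<open>The direction \<open>j = 0\<close> does not occur in the form; its equation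
        is trivial because \<open>e 0 = 1\<close>.\<close>
      case True
      then show ?thesis by (simp add: even basis_e(4))
    next
      case False
      have jp: "j \<in> {1..p}" using False j even by auto
      have S: "axis i (e j) \<in> S" "axis i (e 0) \<in> S"
        using blocksD(5)[OF b, of "e j"] blocksD(6)[OF b] e_even jp by (auto simp: even basis_e(4))
      show ?thesis
        using d0[OF S(1)] d_second_even[OF even(4) jp, of f x] pd[OF S(1)] pd[OF S(2)]
        by (simp add: even basis_e(4))
    qed
  next
    case (odd k)
    have lt: "s k < s (k + 1)" by (rule s_less[OF odd(5)])
    show ?thesis
    proof (cases "j = 0")
      case True
      then show ?thesis using block(2)[OF odd(5)] by (simp add: odd)
    next
      case False
      have t: "s k + j \<in> {s k + 1..<s (k + 1)}" "s k + j \<in> {s k..<s (k + 1)}" using False j lt by (auto simp: odd)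
      have eps: "\<epsilon> (s k + j) = a (s k + j) * \<epsilon> (s k)" by (rule block(1)[OF odd(5) t(2)])
      have S: "axis i (\<epsilon> (s k + j)) \<in> S" "axis i (\<epsilon> (s k)) \<in> S"
        using blocksD(5)[OF b blocksD(3)[OF b j]] blocksD(6)[OF b] by (auto simp: odd eps)
      show ?thesis
        using d0[OF S(1)] d_second_odd[OF odd(4,5) t(1), of f x] pd[OF S(1)] pd[OF S(2)]
        by (simp add: odd eps)
    qed
  qed
  have "f' (axis i (c * g)) = c * f' (axis i g)"
    if b: "(i, g, d, \<alpha>) \<in> blocks" and c: "c \<in> span (\<alpha> ` {..d})" for i g d \<alpha> c
  proof -
    have "subspace {c. f' (axis i (c * g)) = c * f' (axis i g)}"
      by (auto simp: subspace_def distrib_right linear_add[OF linear_axis] linear_add[OF lin]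
          linear_cmul[OF linear_axis] linear_cmul[OF lin] linear_0[OF linear_axis] linear_0[OF lin])
    moreover have "\<alpha> ` {..d} \<subseteq> {c. f' (axis i (c * g)) = c * f' (axis i g)}" using base[OF b] by auto
    ultimately have "span (\<alpha> ` {..d}) \<subseteq> {c. f' (axis i (c * g)) = c * f' (axis i g)}"
      by (intro span_minimal)
    then show ?thesis using c by blast
  qed
  then show ?thesis using f' by (intro exI[of _ f']) (auto simp: eqs_def)
qed

lemma eqs_imp_qS:
  assumes F: "solves eqs F \<Omega>" and \<Omega>: "openin (top_of_set S) \<Omega>"
  shows "qS_differentiable_on \<Lambda> E p e q r s \<epsilon> a F \<Omega>"
  unfolding qS_differentiable_on_def
proof (intro conjI ballI)
  show "F differentiable_on \<Omega>"
    using F has_derivative_at_withinI unfolding solves_def differentiable_on_def differentiable_def by blast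
  fix x h assume x: "x \<in> \<Omega>"
  obtain F' where F': "(F has_derivative F') (at x)" "\<forall>(u, v, c)\<in>eqs. F' v = c * F' u"
    using F x by (auto simp: solves_def)
  note pd = pd_eq_derivative[OF subspace_S \<Omega> x has_derivative_at_withinI[OF F'(1)]]
  have base: "pd F i (\<alpha> j * g) x = \<alpha> j * pd F i g x" if b: "(i, g, d, \<alpha>) \<in> blocks" and j: "j \<le> d" for i g d \<alpha> j
  proof -
    have "\<alpha> j \<in> span (\<alpha> ` {..d})" using j by (intro span_base) auto
    then have "(axis i g, axis i (\<alpha> j * g), \<alpha> j) \<in> eqs" using b unfolding eqs_def by blast
    then have "F' (axis i (\<alpha> j * g)) = \<alpha> j * F' (axis i g)" using F'(2) by auto
    then show ?thesis using pd[OF blocksD(5)[OF b blocksD(3)[OF b j]]] pd[OF blocksD(6)[OF b]] by simp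
  qed
  have "pd F i (e j) x - e j * pd F i (e 0) x = 0" if "i \<in> E" "j \<in> {1..p}" for i j
    using base[OF blocks.even[OF that(1)], of j] that(2) basis_e(4) by simp
  moreover have "pd F i (\<epsilon> t) x - a t * pd F i (\<epsilon> (s k)) x = 0"
    if "i \<in> - E" "k \<in> {1..r}" "t \<in> {s k + 1..<s (k + 1)}" for i k t
  proof -
    have "\<epsilon> t = a t * \<epsilon> (s k)" by (rule block(1)[OF that(2)]) (use that(3) in auto)
    \<comment> \<open>Indices within a block start at 0, so \<open>t\<close> becomes
      \<open>t - s k\<close>.\<close>
    then show ?thesis using base[OF blocks.odd[of i k], of "t - s k"] that by auto
  qed
  ultimately show "d_second E p e q r s \<epsilon> a F x h = 0" unfolding d_second_def by simp
qed

text \<open>For an odd variable, \<open>\<Lambda> 1\<close> being nonzero forces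
  \<open>q > 0\<close>, and then \<open>r > 0\<close>, since \<open>r = 0\<close> would give
  \<open>q + 1 = s 1 = 1\<close>.\<close>

lemma block_exists:
  assumes "- E \<noteq> {} \<longrightarrow> \<Lambda> 1 \<noteq> {0}"
  obtains g d \<alpha> where "(i, g, d, \<alpha>) \<in> blocks"
proof (cases "i \<in> E")
  case True
  then show ?thesis using that blocks.even by blast
next
  case False
  then have "\<Lambda> 1 \<noteq> {0}" using assms by blast
  have "q \<noteq> 0"
  proof
    assume "q = 0"
    then have "span (\<epsilon> ` {1..q}) = {0}" by simp
    with basis_\<epsilon>(3) \<open>\<Lambda> 1 \<noteq> {0}\<close> show False by metis
  qed
  have "r \<noteq> 0"
  proof
    assume "r = 0"
    then have "s (0 + 1) = q + 1" using block_bounds(2) by (simp only:)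
    then show False using block_bounds(1) \<open>q \<noteq> 0\<close> by simp
  qed
  then show ?thesis using that blocks.odd[OF False, of 1] by auto
qed

end

theorem mainTheorem3:
  fixes \<Lambda> :: "nat \<Rightarrow> 'a::{euclidean_space, real_algebra_1} set"
    and p q r :: nat and s :: "nat \<Rightarrow> nat" and e \<epsilon> a :: "nat \<Rightarrow> 'a"
    and n m :: nat and E :: "'v::finite set"
    and \<Omega> U :: "('a ^ 'v) set" and f :: "'a ^ 'v \<Rightarrow> 'a"
  assumes "comm_superalgebra \<Lambda>"
    and "cond_A0 \<Lambda> p e"
    and "cond_A1 \<Lambda> q r s \<epsilon> a"
    and "card E = n" and "card (- E) = m"
    and "n + m \<ge> 2"
    and "m \<ge> 1 \<longrightarrow> \<Lambda> 1 \<noteq> {0}"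
    and "openin (top_of_set (superspace \<Lambda> E)) \<Omega>" and "connected \<Omega>" and "bounded \<Omega>"
    and "connected (top_of_set (superspace \<Lambda> E) frontier_of \<Omega>)"
    and "openin (top_of_set (superspace \<Lambda> E)) U" and "connected U"
    and "top_of_set (superspace \<Lambda> E) frontier_of \<Omega> \<subseteq> U"
    and "qS_differentiable_on \<Lambda> E p e q r s \<epsilon> a f U"
  shows "\<exists>F. qS_differentiable_on \<Lambda> E p e q r s \<epsilon> a F \<Omega> \<and>
    (\<exists>W. openin (top_of_set (superspace \<Lambda> E)) W \<and>
         top_of_set (superspace \<Lambda> E) frontier_of \<Omega> \<subseteq> W \<and> W \<subseteq> U \<and>
         (\<forall>x\<in>\<Omega> \<inter> W. F x = f x))"
proof -
  interpret superspace_setup \<Lambda> p q r s e \<epsilon> a E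
    by unfold_locales (rule assms)+
  have ne: "- E \<noteq> {} \<longrightarrow> \<Lambda> 1 \<noteq> {0}"
  proof
    assume "- E \<noteq> {}"
    then have "card (- E) > 0" by (simp add: card_gt_0_iff)
    then have "m \<ge> 1" using assms(5) by linarith
    then show "\<Lambda> 1 \<noteq> {0}" using assms(7) by blast
  qed
  \<comment> \<open>Two distinct variables exist: the elliptic plane is taken in \<open>i1\<close>,
    the direction off the plane in \<open>i2\<close>.\<close>
  have "card (UNIV :: 'v set) = n + m"
    using assms(4,5) card_Un_disjoint[of E "- E"] by simp
  then obtain i1 i2 :: 'v where i: "i1 \<noteq> i2"
    using assms(6) card_le_Suc0_iff_eq[of "UNIV :: 'v set"] by auto
  obtain g1 d1 \<alpha>1 where b1: "(i1, g1, d1, \<alpha>1) \<in> blocks" using block_exists[OF ne] by metis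
  obtain g2 d2 \<alpha>2 where b2: "(i2, g2, d2, \<alpha>2) \<in> blocks" using block_exists[OF ne] by metis
  obtain t :: nat where t: "elliptic (\<Sum>k\<le>d1. (real t ^ k) *\<^sub>R \<alpha>1 k)"
    using block_elliptic_parameters[OF b1] by (metis (no_types, lifting) Collect_empty_eq finite.emptyI)
  define c where "c = (\<Sum>k\<le>d1. (real t ^ k) *\<^sub>R \<alpha>1 k)"
  have c: "(axis i1 g1, axis i1 (c * g1), c) \<in> eqs" "elliptic c"
    using block_eqs[OF b1, of t] t by (simp_all add: c_def)
  interpret elliptic_plane c by unfold_locales (rule c(2))
  \<comment> \<open>In the variable \<open>i1\<close> the plane map multiplies \<open>g1\<close> by
    \<open>kap z\<close>, so its injectivity follows from that of multiplication by
    \<open>kap z\<close>.\<close>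
  have pl: "plane_map (axis i1 g1) (axis i1 (c * g1)) z = axis i1 (kap z * g1)" for z
    by (simp add: plane_map_def kap_def distrib_right linear_add[OF linear_axis] linear_cmul[OF linear_axis])
  have inj: "inj (plane_map (axis i1 g1) (axis i1 (c * g1)))"
    unfolding linear_injective_0[OF linear_plane_map] pl
    using kap_mult_eq_0 blocksD(4)[OF b1] by (metis axis_eq_0_iff)
  have w: "axis i2 g2 \<notin> range (plane_map (axis i1 g1) (axis i1 (c * g1)))"
  proof
    assume "axis i2 g2 \<in> range (plane_map (axis i1 g1) (axis i1 (c * g1)))"
    then obtain z where "axis i2 g2 = axis i1 (kap z * g1)" using pl by auto
    then have "axis i2 g2 $ i2 = axis i1 (kap z * g1) $ i2" by simp
    then show False using i blocksD(4)[OF b2] by (simp add: axis_nth_if)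
  qed
  obtain F W where F: "solves eqs F \<Omega>" and W: "openin (top_of_set S) W" "top_of_set S frontier_of \<Omega> \<subseteq> W"
    "W \<subseteq> U" "\<And>x. x \<in> \<Omega> \<inter> W \<Longrightarrow> F x = f x"
    using hartogs_extension_subspace[OF subspace_S eqs_in_S eqs_span c inj blocksD(6)[OF b2] w
        assms(8,10,11,12,14) qS_imp_eqs[OF assms(15,12)]] by metis
  show ?thesis using eqs_imp_qS[OF F assms(8)] W by blast
qed

end
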